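(* Let $f\in\operatorname{Sym}\mathscr P\langle\mathbf q,\bar{\mathbf q}\rangle$, $g_1,\dots,g_m\in\operatorname{Sym}\mathbb R\langle\mathbf q,\bar{\mathbf q}\rangle$, $h_1,\dots,h_\ell\in\mathbb R\langle\mathbf q,\bar{\mathbf q}\rangle$, and let $\mathbf y=(y_w)_{w\in\mathcal W_{2d}}$ be an optimal solution of the order-$d$ moment relaxation (with optimal value $f_d$) of the problem of minimizing $f$ over $K_{\mathbf g,\mathbf h}$ (with optimal value $f_{\min}$). Let $$\delta=\max\left\{1,\ \lceil\deg(g_i)/2\rceil\ (i=1,\dots,m),\ \lceil\deg(h_j)/2\rceil\ (j=1,\dots,\ell)\right\}.$$ Assume $d\ge\delta$ and $$\operatorname{rank}_{\mathbb H}\mathbf M_d(\mathbf y)=\operatorname{rank}_{\mathbb H}\mathbf M_{d-\delta}(\mathbf y)=r.$$ If $d\ge2$ and $\delta=1$, further assume the scalar-consistency condition $\pi\left(\mathcal I_n^{\mathbb R}\cap\mathbb R\langle\mathbf q,\bar{\mathbf q}\rangle_4\right)=0$, where $(\mathscr H,\pi,\xi)$ is the canonical flat representation of $\mathbf y$. Then $f_d=f_{\min}$. Moreover, there exist distinct points $\mathbf q^{(1)},\dots,\mathbf q^{(N)}\in K_{\mathbf g,\mathbf h}$, $N\le r$, and weights $\lambda_1,\dots,\lambda_N>0$ with $\sum_{\nu=1}^N\lambda_\nu=1$, such that $\mu=\sum_{\nu=1}^N\lambda_\nu\delta_{\mathbf q^{(\nu)}}$ represents $\mathbf y$, and every $\mathbf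 q^{(\nu)}$ is an optimal solution of the problem of minimizing $f$ over $K_{\mathbf g,\mathbf h}$.
   Context: $\mathbb H$ is the skew field of quaternions, $\mathcal R(a)$ the real part. Fix $n\ge1$ and letters $q_1,\dots,q_n,\bar q_1,\dots,\bar q_n$. $\mathcal W$ is the set of words (including the empty word $1$) in these letters; $|w|$ is the length, $\mathcal W_t$ the words of length at most $t$; $w^*$ is obtained by reversing $w$ and exchanging $q_i\leftrightarrow\bar q_i$. $\mathcal F_n=\mathbb R\langle\mathbf q,\bar{\mathbf q}\rangle$ is the free real $*$-algebra spanned by words, with degree; $\mathbb R\langle\mathbf q,\bar{\mathbf q}\rangle_t$ is the subspace of degree at most $t$. Every word has a normal form $\prod_i|q_i|^{2\alpha_i}\tilde w$ obtained by writing consecutive factors $q_i\bar q_i$ or $\bar q_iq_i$ as $|q_i|^2$ and moving them to the front until $\tilde w$ contains no such factor; moments $y_w$ depend only on the normal form of $w$. $\mathscr P\langle\mathbf q,\bar{\mathbf q}\rangle$ is the space of finite sums $p=\sum_{a,b\in\mathcal W}a\,p_{a,b}\,b$, $p_{a,b}\in\mathbb H$ (inside the real free product of $\mathbb H$ and $\mathcal F_n$, constants not commuting with letters), with $p^*=\sum b^*\bar p_{a,b}a^*$. $\operatorname{Sym}$ denotes elements with $p=p^*$; $[a,b]$ is the commutator. Words $u,v$ are cyclically equivalent, $u\stackrel{\mathrm{cyc}}{\sim}v$, if $u=w_1w_2$, $v=w_2w_1$ for some words. $K_{\mathbf g,\mathbf h}=\{\mathbf a\in\mathbb H^n:g_i(\mathbf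 a,\bar{\mathbf a})\ge0\ (1\le i\le m),\ h_j(\mathbf a,\bar{\mathbf a})=0\ (1\le j\le\ell)\}$ (evaluation $q_i\mapsto a_i$, $\bar q_i\mapsto\bar a_i$), $f_{\min}=\inf_{K_{\mathbf g,\mathbf h}}f$. $\mathcal I_n^{\mathbb R}$ is the ideal of all $p\in\mathcal F_n$ vanishing under evaluation at every $\mathbf a\in\mathbb H^n$. For $\mathbf y=(y_w)_{w\in\mathcal W_{2d}}$ in $\mathbb H$: $L_{\mathbf y}(\sum p_ww)=\sum p_wy_w\in\mathbb H$ for real $p_w$; $L_{\mathbf y}^{\mathcal R}(\sum a\,p_{a,b}\,b)=\mathcal R(\sum p_{a,b}y_{ba})$; $[\mathbf M_t(\mathbf y)]_{u,v}=L_{\mathbf y}(u^*v)$, $[\mathbf M_t(g\mathbf y)]_{u,v}=L_{\mathbf y}(u^*gv)$, $u,v\in\mathcal W_t$; $\succeq0$ means Hermitian with nonnegative quadratic form on quaternionic vectors; $\operatorname{rank}_{\mathbb H}$ is the quaternionic (right column) rank. Order-$d$ moment relaxation ($2d$ at least the degrees of $f$, $g_i$, $h_j$): $f_d$ is the infimum of $L_{\mathbf y}^{\mathcal R}(f)$ over $\mathbf y=(y_w)_{w\in\mathcal W_{2d}}$ in $\mathbb H$ with $y_1=1$; $y_w=\overline{y_{w^*}}$; $\mathcal R(y_u)=\mathcal R(y_v)$ whenever $u\stackrel{\mathrm{cyc}}{\sim}v$; $\mathbf M_d(\mathbf y)\succeq0$; $\mathbf M_{d-\lceil\deg(g_i)/2\rceil}(g_i\mathbf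 y)\succeq0$ for all $i$; $L_{\mathbf y}(uh_jv)=0$ for all $j$ and words with $|u|+|v|\le2d-\deg h_j$; and $L_{\mathbf y}(u[w+w^*,q_i]v)=0$ for all $i$ and words with $|u|+|v|+|w|\le2d-1$. Canonical flat representation (defined when $\mathbf M_d(\mathbf y)\succeq0$ and $\operatorname{rank}_{\mathbb H}\mathbf M_d(\mathbf y)=\operatorname{rank}_{\mathbb H}\mathbf M_{d-1}(\mathbf y)=r$): choose vectors $\boldsymbol v_w$, $w\in\mathcal W_d$, spanning a right quaternionic Hilbert space $\mathscr H$ of $\mathbb H$-dimension $r$ (inner product conjugate-linear in the first, right-linear in the second argument) with $\langle\boldsymbol v_u,\boldsymbol v_v\rangle=y_{u^*v}$; then $\mathscr H=\operatorname{span}_{\mathbb H}\{\boldsymbol v_w:w\in\mathcal W_{d-1}\}$, and for each letter $a$ the rule $X_a\boldsymbol v_w=\boldsymbol v_{aw}$ ($w\in\mathcal W_{d-1}$) gives a well-defined right-$\mathbb H$-linear operator with $X_{a^*}=X_a^*$. $\pi:\mathcal F_n\to B_{\mathbb H}(\mathscr H)$ is the unital real $*$-representation with $\pi(a_1\cdots a_m)=X_{a_1}\cdots X_{a_m}$, and $\xi=\boldsymbol v_1$. A measure $\mu$ represents $\mathbf y$ if $y_w=\int w(\mathbf a,\bar{\mathbf a})\,d\mu(\mathbf a)$ for all $w\in\mathcal W_{2d}$. *)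

theory Defs
  imports "HOL-Analysis.Analysis" "HOL-Library.Poly_Mapping"
begin

section \<open>The skew field of quaternions\<close>

datatype quat = Quat (qre: real) (qi: real) (qj: real) (qk: real)

lemma quat_eq_iff: "x = y \<longleftrightarrow> qre x = qre y \<and> qi x = qi y \<and> qj x = qj y \<and> qk x = qk y"
  by (cases x; cases y) auto

definition qcnj :: "quat \<Rightarrow> quat" where
  "qcnj x = Quat (qre x) (- qi x) (- qj x) (- qk x)"

lemma qcnj_sel [simp]:
  "qre (qcnj x) = qre x" "qi (qcnj x) = - qi x" "qj (qcnj x) = - qj x" "qk (qcnj x) = - qk x"
  by (simp_all add: qcnj_def)

instantiation quat :: ring_1
begin

definition "0 = Quat 0 0 0 0"
definition "1 = Quat 1 0 0 0"
definition "x + y = Quat (qre x + qre y) (qi x + qi y) (qj x + qj y) (qk x + qk y)"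
definition "x - y = Quat (qre x - qre y) (qi x - qi y) (qj x - qj y) (qk x - qk y)"
definition "- x = Quat (- qre x) (- qi x) (- qj x) (- qk x)"
definition "x * y = Quat
  (qre x * qre y - qi x * qi y - qj x * qj y - qk x * qk y)
  (qre x * qi y + qi x * qre y + qj x * qk y - qk x * qj y)
  (qre x * qj y - qi x * qk y + qj x * qre y + qk x * qi y)
  (qre x * qk y + qi x * qj y - qj x * qi y + qk x * qre y)"

instance
  by standard
    (simp_all add: zero_quat_def one_quat_def plus_quat_def minus_quat_def uminus_quat_def
      times_quat_def algebra_simps)

end

lemma quat_sel [simp]:
  "qre 0 = 0" "qi 0 = 0" "qj 0 = 0" "qk 0 = 0"
  "qre 1 = 1" "qi 1 = 0" "qj 1 = 0" "qk 1 = 0"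
  "qre (x + y) = qre x + qre y" "qi (x + y) = qi x + qi y"
  "qj (x + y) = qj x + qj y" "qk (x + y) = qk x + qk y"
  "qre (x - y) = qre x - qre y" "qi (x - y) = qi x - qi y"
  "qj (x - y) = qj x - qj y" "qk (x - y) = qk x - qk y"
  "qre (- x) = - qre x" "qi (- x) = - qi x" "qj (- x) = - qj x" "qk (- x) = - qk x"
  by (simp_all add: zero_quat_def one_quat_def plus_quat_def minus_quat_def uminus_quat_def)

lemma quat_times_sel:
  "qre (x * y) = qre x * qre y - qi x * qi y - qj x * qj y - qk x * qk y"
  "qi (x * y) = qre x * qi y + qi x * qre y + qj x * qk y - qk x * qj y"
  "qj (x * y) = qre x * qj y - qi x * qk y + qj x * qre y + qk x * qi y"
  "qk (x * y) = qre x * qk y + qi x * qj y - qj x * qi y + qk x * qre y"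
  by (simp_all add: times_quat_def)

instantiation quat :: real_algebra_1
begin

definition "scaleR r x = Quat (r * qre x) (r * qi x) (r * qj x) (r * qk x)"

instance
  by standard (simp_all add: scaleR_quat_def quat_eq_iff quat_times_sel algebra_simps)

end

lemma scaleR_quat_sel [simp]:
  "qre (r *\<^sub>R x) = r * qre x" "qi (r *\<^sub>R x) = r * qi x"
  "qj (r *\<^sub>R x) = r * qj x" "qk (r *\<^sub>R x) = r * qk x"
  by (simp_all add: scaleR_quat_def)

instantiation quat :: real_inner
begin

definition "inner x y = qre x * qre y + qi x * qi y + qj x * qj y + qk x * qk y" for x y :: quat
definition "norm x = sqrt (inner x x)" for x :: quat
definition "sgn x = x /\<^sub>R norm x" for x :: quat
definition "dist x y = norm (x - y)" for x y :: quat
definition [code del]: "(uniformity :: (quat \<times> quat) filter) =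
  (INF e\<in>{0 <..}. principal {(x, y). dist x y < e})"
definition [code del]: "open (U :: quat set) \<longleftrightarrow>
  (\<forall>x\<in>U. eventually (\<lambda>(x', y). x' = x \<longrightarrow> y \<in> U) uniformity)"

instance
proof
  fix x y z :: quat and r :: real
  show "inner x x = 0 \<longleftrightarrow> x = 0"
  proof
    assume "inner x x = 0"
    then have "(qre x)\<^sup>2 + (qi x)\<^sup>2 + (qj x)\<^sup>2 + (qk x)\<^sup>2 = 0"
      by (simp add: inner_quat_def power2_eq_square)
    then show "x = 0"
      by (simp add: quat_eq_iff add_nonneg_eq_0_iff)
  qed (simp add: inner_quat_def)
  show "0 \<le> inner x x"
    by (simp add: inner_quat_def)
qed (simp_all add: inner_quat_def norm_quat_def sgn_quat_def dist_quat_def uniformity_quat_def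
      open_quat_def algebra_simps)

end

instantiation quat :: real_normed_div_algebra
begin

definition "inverse x = qcnj x /\<^sub>R (norm x)\<^sup>2" for x :: quat
definition "divide x y = x * inverse y" for x y :: quat

instance
proof
  fix x y :: quat
  have n: "(norm z)\<^sup>2 = (qre z)\<^sup>2 + (qi z)\<^sup>2 + (qj z)\<^sup>2 + (qk z)\<^sup>2" for z :: quat
    by (simp add: norm_quat_def inner_quat_def power2_eq_square)
  have c: "x * qcnj x = of_real ((norm x)\<^sup>2)" "qcnj x * x = of_real ((norm x)\<^sup>2)"
    unfolding n by (simp_all add: quat_eq_iff quat_times_sel of_real_def power2_eq_square)
  show "x \<noteq> 0 \<Longrightarrow> inverse x * x = 1" "x \<noteq> 0 \<Longrightarrow> x * inverse x = 1"
    by (simp_all add: inverse_quat_def c of_real_def)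
  show "x div y = x * inverse y"
    by (simp add: divide_quat_def)
  show "inverse (0 :: quat) = 0"
    by (simp add: inverse_quat_def quat_eq_iff)
  have "(norm (x * y))\<^sup>2 = (norm x * norm y)\<^sup>2"
    unfolding power_mult_distrib n quat_times_sel by algebra
  then show "norm (x * y) = norm x * norm y"
    by (simp add: power2_eq_iff_nonneg)
qed

end

instantiation quat :: euclidean_space
begin

definition "Basis = {Quat 1 0 0 0, Quat 0 1 0 0, Quat 0 0 1 0, Quat 0 0 0 1}"

instance
proof
  fix u v x :: quat
  show "(Basis :: quat set) \<noteq> {}" "finite (Basis :: quat set)"
    by (simp_all add: Basis_quat_def)
  show "u \<in> Basis \<Longrightarrow> v \<in> Basis \<Longrightarrow> inner u v = (if u = v then 1 else 0)"
    unfolding Basis_quat_def by (elim insertE emptyE; simp only: inner_quat_def quat.sel quat.inject) simp_all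
  show "(\<forall>u\<in>Basis. inner x u = 0) \<longleftrightarrow> x = 0"
  proof
    assume "\<forall>u\<in>Basis. inner x u = 0"
    then have "inner x (Quat 1 0 0 0) = 0" "inner x (Quat 0 1 0 0) = 0"
      "inner x (Quat 0 0 1 0) = 0" "inner x (Quat 0 0 0 1) = 0"
      by (simp_all add: Basis_quat_def)
    then show "x = 0"
      by (simp add: inner_quat_def quat_eq_iff)
  qed (simp add: inner_quat_def)
qed

end

definition qnonneg :: "quat \<Rightarrow> bool" where
  "qnonneg x \<longleftrightarrow> (\<exists>t\<ge>0. x = of_real t)"


section \<open>Words and the free real *-algebra\<close>

text \<open>The number of variables is the cardinality of the finite index type \<open>'n\<close>.\<close>

datatype 'n letter = Q (idx: 'n) | Qbar (idx: 'n)

fun lstar :: "'n letter \<Rightarrow> 'n letter" where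
  "lstar (Q i) = Qbar i"
| "lstar (Qbar i) = Q i"

text \<open>Words are wrapped in a type of their own so that \<^typ>\<open>'a \<Rightarrow>\<^sub>0 'b\<close> provides the monoid algebra.
  Since that library type writes the monoid of exponents additively, concatenation of words
  is \<open>+\<close> and the empty word is \<open>0\<close>.\<close>

datatype 'n qword = QWord (letters: "'n letter list")

instantiation qword :: (type) monoid_add
begin

definition "0 = QWord []"
definition "u + v = QWord (letters u @ letters v)"

instance
  by standard (simp_all add: zero_qword_def plus_qword_def)

end

definition wlen :: "'n qword \<Rightarrow> nat" where
  "wlen w = length (letters w)"

definition wstar :: "'n qword \<Rightarrow> 'n qword" where
  "wstar w = QWord (rev (map lstar (letters w)))"

definition words :: "nat \<Rightarrow> 'n qword set" where
  "words t = {w. wlen w \<le> t}"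

definition cyc_equiv :: "'n qword \<Rightarrow> 'n qword \<Rightarrow> bool" where
  "cyc_equiv u v \<longleftrightarrow> (\<exists>w1 w2. u = w1 + w2 \<and> v = w2 + w1)"

text \<open>The normal form \<open>\<Prod>\<^sub>i |q\<^sub>i|\<^bsup>2 \<alpha> i\<^esup> w'\<close> is stored as the pair of the exponents \<open>\<alpha>\<close> and the letters
  of the reduced word \<open>w'\<close>; it is computed by multiplying with one letter at a time from the left.\<close>

fun nf_cons :: "'n letter \<Rightarrow> ('n \<Rightarrow> nat) \<times> 'n letter list \<Rightarrow> ('n \<Rightarrow> nat) \<times> 'n letter list" where
  "nf_cons a (\<alpha>, []) = (\<alpha>, [a])"
| "nf_cons a (\<alpha>, b # w) =
    (if b = lstar a then (\<alpha>(idx a := Suc (\<alpha> (idx a))), w) else (\<alpha>, a # b # w))"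

definition normal_form :: "'n qword \<Rightarrow> ('n \<Rightarrow> nat) \<times> 'n letter list" where
  "normal_form w = foldr nf_cons (letters w) (\<lambda>_. 0, [])"

type_synonym 'n ncpoly = "'n qword \<Rightarrow>\<^sub>0 real"

definition mono_of :: "'n qword \<Rightarrow> 'n ncpoly" where
  "mono_of w = Poly_Mapping.single w 1"

definition ncstar :: "'n ncpoly \<Rightarrow> 'n ncpoly" where
  "ncstar p = (\<Sum>w\<in>Poly_Mapping.keys p. Poly_Mapping.single (wstar w) (Poly_Mapping.lookup p w))"

definition ncdeg :: "'n ncpoly \<Rightarrow> nat" where
  "ncdeg p = Max (insert 0 (wlen ` Poly_Mapping.keys p))"

definition half_deg :: "'n ncpoly \<Rightarrow> nat" where
  "half_deg p = nat \<lceil>real (ncdeg p) / 2\<rceil>"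

definition commutator :: "'n ncpoly \<Rightarrow> 'n ncpoly \<Rightarrow> 'n ncpoly" where
  "commutator a b = a * b - b * a"

fun eval_letter :: "quat ^ 'n \<Rightarrow> 'n letter \<Rightarrow> quat" where
  "eval_letter a (Q i) = a $ i"
| "eval_letter a (Qbar i) = qcnj (a $ i)"

definition eval_word :: "quat ^ 'n \<Rightarrow> 'n qword \<Rightarrow> quat" where
  "eval_word a w = prod_list (map (eval_letter a) (letters w))"

definition eval_nc :: "quat ^ 'n \<Rightarrow> 'n ncpoly \<Rightarrow> quat" where
  "eval_nc a p = (\<Sum>w\<in>Poly_Mapping.keys p. Poly_Mapping.lookup p w *\<^sub>R eval_word a w)"

definition vanishing_ideal :: "'n::finite ncpoly set" where
  "vanishing_ideal = {p. \<forall>a. eval_nc a p = 0}"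


section \<open>Polynomials with quaternionic coefficients\<close>

text \<open>A value \<open>p\<close> of the following type presents the element \<open>\<Sum> a p\<^sub>a\<^sub>b b\<close> of the free product of the
  quaternions and the free algebra. Presentations are not unique, because real coefficients commute
  with words. The products \<open>w\<close> and \<open>a e b\<close>, with \<open>w, a, b\<close> words and \<open>e\<close> one of the three imaginary
  units, are linearly independent in the free product, so two presentations give the same element
  iff their coefficients at all these products agree; this is \<open>qp_equal\<close>.\<close>

type_synonym 'n qpoly = "('n qword \<times> 'n qword) \<Rightarrow>\<^sub>0 quat"

definition qp_equal :: "'n qpoly \<Rightarrow> 'n qpoly \<Rightarrow> bool" where
  "qp_equal p p' \<longleftrightarrow>
    (\<forall>a b. qi (Poly_Mapping.lookup p (a, b)) = qi (Poly_Mapping.lookup p' (a, b)) \<and>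
           qj (Poly_Mapping.lookup p (a, b)) = qj (Poly_Mapping.lookup p' (a, b)) \<and>
           qk (Poly_Mapping.lookup p (a, b)) = qk (Poly_Mapping.lookup p' (a, b))) \<and>
    (\<forall>w. (\<Sum>(a, b)\<in>{(a, b). a + b = w}. qre (Poly_Mapping.lookup p (a, b))) =
         (\<Sum>(a, b)\<in>{(a, b). a + b = w}. qre (Poly_Mapping.lookup p' (a, b))))"

definition qpstar :: "'n qpoly \<Rightarrow> 'n qpoly" where
  "qpstar p = (\<Sum>(a, b)\<in>Poly_Mapping.keys p.
     Poly_Mapping.single (wstar b, wstar a) (qcnj (Poly_Mapping.lookup p (a, b))))"

text \<open>Degree of a presentation; the degree of an element is the least degree of its presentations.\<close>

definition qpdeg :: "'n qpoly \<Rightarrow> nat" where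
  "qpdeg p = Max (insert 0 ((\<lambda>(a, b). wlen a + wlen b) ` Poly_Mapping.keys p))"

definition eval_qp :: "quat ^ 'n \<Rightarrow> 'n qpoly \<Rightarrow> quat" where
  "eval_qp x p = (\<Sum>(a, b)\<in>Poly_Mapping.keys p.
     eval_word x a * Poly_Mapping.lookup p (a, b) * eval_word x b)"


section \<open>The optimization problem\<close>

definition feasible_set :: "'n ncpoly list \<Rightarrow> 'n ncpoly list \<Rightarrow> (quat ^ 'n) set" where
  "feasible_set gs hs =
    {a. (\<forall>g\<in>set gs. qnonneg (eval_nc a g)) \<and> (\<forall>h\<in>set hs. eval_nc a h = 0)}"

text \<open>Self-adjoint polynomials have real values, so the real part loses nothing here.
  The infimum is \<open>\<infinity>\<close> on an empty feasible set.\<close>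

definition f_min :: "'n::finite qpoly \<Rightarrow> 'n ncpoly list \<Rightarrow> 'n ncpoly list \<Rightarrow> ereal" where
  "f_min f gs hs = (INF a\<in>feasible_set gs hs. ereal (qre (eval_qp a f)))"

definition is_minimizer ::
  "'n::finite qpoly \<Rightarrow> 'n ncpoly list \<Rightarrow> 'n ncpoly list \<Rightarrow> quat ^ 'n \<Rightarrow> bool" where
  "is_minimizer f gs hs a \<longleftrightarrow>
    a \<in> feasible_set gs hs \<and> ereal (qre (eval_qp a f)) = f_min f gs hs"


section \<open>Quaternionic matrices\<close>

definition qpsd :: "'i set \<Rightarrow> ('i \<Rightarrow> 'i \<Rightarrow> quat) \<Rightarrow> bool" where
  "qpsd I M \<longleftrightarrow>
    (\<forall>u\<in>I. \<forall>v\<in>I. M u v = qcnj (M v u)) \<and>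
    (\<forall>x. qnonneg (\<Sum>u\<in>I. \<Sum>v\<in>I. qcnj (x u) * M u v * x v))"

text \<open>Right column rank of a matrix with finite index set: the largest number of columns that are
  linearly independent over the quaternions acting from the right.\<close>

definition columns_independent :: "'i set \<Rightarrow> ('i \<Rightarrow> 'i \<Rightarrow> quat) \<Rightarrow> 'i set \<Rightarrow> bool" where
  "columns_independent I M J \<longleftrightarrow>
    (\<forall>c. (\<forall>u\<in>I. (\<Sum>v\<in>J. M u v * c v) = 0) \<longrightarrow> (\<forall>v\<in>J. c v = 0))"

definition qrank :: "'i set \<Rightarrow> ('i \<Rightarrow> 'i \<Rightarrow> quat) \<Rightarrow> nat" where
  "qrank I M = Max (card ` {J. J \<subseteq> I \<and> columns_independent I M J})"


section \<open>The moment relaxation\<close>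

text \<open>Moment sequences \<open>(y\<^sub>w)\<close> with \<open>w\<close> of length at most \<open>2d\<close> are total functions on words;
  values at longer words are never used.\<close>

definition L :: "('n qword \<Rightarrow> quat) \<Rightarrow> 'n ncpoly \<Rightarrow> quat" where
  "L y p = (\<Sum>w\<in>Poly_Mapping.keys p. Poly_Mapping.lookup p w *\<^sub>R y w)"

definition LR :: "('n qword \<Rightarrow> quat) \<Rightarrow> 'n qpoly \<Rightarrow> real" where
  "LR y p = qre (\<Sum>(a, b)\<in>Poly_Mapping.keys p. Poly_Mapping.lookup p (a, b) * y (b + a))"

definition moment_matrix :: "('n qword \<Rightarrow> quat) \<Rightarrow> 'n qword \<Rightarrow> 'n qword \<Rightarrow> quat" where
  "moment_matrix y u v = L y (mono_of (wstar u) * mono_of v)"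

definition localizing_matrix ::
  "'n ncpoly \<Rightarrow> ('n qword \<Rightarrow> quat) \<Rightarrow> 'n qword \<Rightarrow> 'n qword \<Rightarrow> quat" where
  "localizing_matrix g y u v = L y (mono_of (wstar u) * g * mono_of v)"

definition moment_feasible ::
  "'n ncpoly list \<Rightarrow> 'n ncpoly list \<Rightarrow> nat \<Rightarrow> ('n qword \<Rightarrow> quat) \<Rightarrow> bool" where
  "moment_feasible gs hs d y \<longleftrightarrow>
    (\<forall>u\<in>words (2 * d). \<forall>v\<in>words (2 * d). normal_form u = normal_form v \<longrightarrow> y u = y v) \<and>
    y 0 = 1 \<and>
    (\<forall>w\<in>words (2 * d). y w = qcnj (y (wstar w))) \<and>
    (\<forall>u\<in>words (2 * d). \<forall>v\<in>words (2 * d). cyc_equiv u v \<longrightarrow> qre (y u) = qre (y v)) \<and>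
    qpsd (words d) (moment_matrix y) \<and>
    (\<forall>g\<in>set gs. qpsd (words (d - half_deg g)) (localizing_matrix g y)) \<and>
    (\<forall>h\<in>set hs. \<forall>u v. wlen u + wlen v + ncdeg h \<le> 2 * d \<longrightarrow>
      L y (mono_of u * h * mono_of v) = 0) \<and>
    (\<forall>i u v w. wlen u + wlen v + wlen w + 1 \<le> 2 * d \<longrightarrow>
      L y (mono_of u * commutator (mono_of w + mono_of (wstar w)) (mono_of (QWord [Q i]))
        * mono_of v) = 0)"

definition relax_value ::
  "'n qpoly \<Rightarrow> 'n ncpoly list \<Rightarrow> 'n ncpoly list \<Rightarrow> nat \<Rightarrow> ereal" where
  "relax_value f gs hs d = (INF y\<in>{y. moment_feasible gs hs d y}. ereal (LR y f))"

definition relax_optimal ::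
  "'n qpoly \<Rightarrow> 'n ncpoly list \<Rightarrow> 'n ncpoly list \<Rightarrow> nat \<Rightarrow> ('n qword \<Rightarrow> quat) \<Rightarrow> bool" where
  "relax_optimal f gs hs d y \<longleftrightarrow>
    moment_feasible gs hs d y \<and> ereal (LR y f) = relax_value f gs hs d"

definition flatness_gap :: "'n ncpoly list \<Rightarrow> 'n ncpoly list \<Rightarrow> nat" where
  "flatness_gap gs hs = Max ({1} \<union> half_deg ` set gs \<union> half_deg ` set hs)"


section \<open>Right quaternionic inner product spaces and the canonical flat representation\<close>

locale right_quat_inner_space =
  fixes rscale :: "'h::ab_group_add \<Rightarrow> quat \<Rightarrow> 'h"
    and ip :: "'h \<Rightarrow> 'h \<Rightarrow> quat"
  assumes rscale_add_left: "rscale (x + z) c = rscale x c + rscale z c"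
    and rscale_add_right: "rscale x (c + c') = rscale x c + rscale x c'"
    and rscale_mult: "rscale x (c * c') = rscale (rscale x c) c'"
    and rscale_one: "rscale x 1 = x"
    and ip_add_right: "ip x (z + z') = ip x z + ip x z'"
    and ip_rscale_right: "ip x (rscale z c) = ip x z * c"
    and ip_commute: "ip z x = qcnj (ip x z)"
    and ip_nonneg: "qnonneg (ip x x)"
    and ip_definite: "ip x x = 0 \<Longrightarrow> x = 0"

definition rspan :: "('h::ab_group_add \<Rightarrow> quat \<Rightarrow> 'h) \<Rightarrow> 'h set \<Rightarrow> 'h set" where
  "rspan rscale S = {\<Sum>x\<in>F. rscale x (c x) |F c. finite F \<and> F \<subseteq> S}"

definition rindependent :: "('h::ab_group_add \<Rightarrow> quat \<Rightarrow> 'h) \<Rightarrow> 'h set \<Rightarrow> bool" where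
  "rindependent rscale S \<longleftrightarrow>
    (\<forall>F c. finite F \<longrightarrow> F \<subseteq> S \<longrightarrow> (\<Sum>x\<in>F. rscale x (c x)) = 0 \<longrightarrow> (\<forall>x\<in>F. c x = 0))"

definition flat_space ::
  "('h::ab_group_add \<Rightarrow> quat \<Rightarrow> 'h) \<Rightarrow> nat \<Rightarrow> ('n qword \<Rightarrow> 'h) \<Rightarrow> 'h set" where
  "flat_space rscale d bv = rspan rscale (bv ` words d)"

text \<open>The Hilbert space is the right span \<open>flat_space\<close> of the vectors \<open>bv w\<close> inside an arbitrary right
  quaternionic inner product space; being finite-dimensional, it is complete. Under flatness the
  vectors of the words of length at most \<open>d - 1\<close> span it, so the operators \<open>X a\<close> are determined on it,
  and \<open>X (lstar a)\<close> is the adjoint of \<open>X a\<close>.\<close>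

definition canonical_flat_rep ::
  "('h::ab_group_add \<Rightarrow> quat \<Rightarrow> 'h) \<Rightarrow> ('h \<Rightarrow> 'h \<Rightarrow> quat) \<Rightarrow> nat \<Rightarrow> nat \<Rightarrow> ('n qword \<Rightarrow> quat) \<Rightarrow>
   ('n qword \<Rightarrow> 'h) \<Rightarrow> ('n letter \<Rightarrow> 'h \<Rightarrow> 'h) \<Rightarrow> bool" where
  "canonical_flat_rep rscale ip d r y bv X \<longleftrightarrow>
    right_quat_inner_space rscale ip \<and>
    (\<forall>u\<in>words d. \<forall>v\<in>words d. ip (bv u) (bv v) = y (wstar u + v)) \<and>
    (\<exists>B. finite B \<and> card B = r \<and> rindependent rscale B \<and> rspan rscale B = flat_space rscale d bv) \<and>
    (\<forall>a. \<forall>x\<in>flat_space rscale d bv. X a x \<in> flat_space rscale d bv) \<and>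
    (\<forall>a. \<forall>x\<in>flat_space rscale d bv. \<forall>z\<in>flat_space rscale d bv. X a (x + z) = X a x + X a z) \<and>
    (\<forall>a. \<forall>x\<in>flat_space rscale d bv. \<forall>c. X a (rscale x c) = rscale (X a x) c) \<and>
    (\<forall>a. \<forall>w\<in>words (d - 1). X a (bv w) = bv (QWord [a] + w))"

definition flat_rep ::
  "('h::ab_group_add \<Rightarrow> quat \<Rightarrow> 'h) \<Rightarrow> ('n letter \<Rightarrow> 'h \<Rightarrow> 'h) \<Rightarrow> 'n ncpoly \<Rightarrow> 'h \<Rightarrow> 'h" where
  "flat_rep rscale X p x = (\<Sum>w\<in>Poly_Mapping.keys p.
     rscale (foldr X (letters w) x) (of_real (Poly_Mapping.lookup p w)))"

definition scalar_consistent ::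
  "('h::ab_group_add \<Rightarrow> quat \<Rightarrow> 'h) \<Rightarrow> nat \<Rightarrow> ('n::finite qword \<Rightarrow> 'h) \<Rightarrow> ('n letter \<Rightarrow> 'h \<Rightarrow> 'h) \<Rightarrow> bool" where
  "scalar_consistent rscale d bv X \<longleftrightarrow>
    (\<forall>p\<in>vanishing_ideal. ncdeg p \<le> 4 \<longrightarrow>
      (\<forall>x\<in>flat_space rscale d bv. flat_rep rscale X p x = 0))"


section \<open>Representing measures\<close>

definition atomic_measure ::
  "nat \<Rightarrow> (nat \<Rightarrow> real) \<Rightarrow> (nat \<Rightarrow> 'a::topological_space) \<Rightarrow> 'a measure" where
  "atomic_measure N lam pt = measure_of UNIV (sets borel)
     (\<lambda>A. \<Sum>\<nu>=1..N. ennreal (lam \<nu>) * indicator A (pt \<nu>))"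

lemma sets_atomic_measure [simp]: "sets (atomic_measure N lam pt) = sets borel"
  using sets.sigma_sets_eq[of borel] by (simp add: atomic_measure_def)

lemma emeasure_atomic_measure:
  assumes "A \<in> sets borel"
  shows "emeasure (atomic_measure N lam pt) A =
    (\<Sum>\<nu>=1..N. ennreal (lam \<nu>) * indicator A (pt \<nu>))"
proof (rule emeasure_measure_of[OF atomic_measure_def])
  show "countably_additive (sets (atomic_measure N lam pt))
      (\<lambda>A. \<Sum>\<nu>=1..N. ennreal (lam \<nu>) * indicator A (pt \<nu>))"
  proof (rule countably_additiveI)
    fix A :: "nat \<Rightarrow> 'a set"
    assume "disjoint_family A"
    then show "suminf (\<lambda>i. \<Sum>\<nu>=1..N. ennreal (lam \<nu>) * indicator (A i) (pt \<nu>)) =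
        (\<Sum>\<nu>=1..N. ennreal (lam \<nu>) * indicator (\<Union>i. A i) (pt \<nu>))"
      by (simp only: suminf_sum[OF summableI] ennreal_suminf_cmult suminf_indicator)
  qed
  show "positive (sets (atomic_measure N lam pt))
      (\<lambda>A. \<Sum>\<nu>=1..N. ennreal (lam \<nu>) * indicator A (pt \<nu>))"
    by (simp only: positive_def indicator_simps empty_iff not_False_eq_True mult_zero_right
        sum.neutral_const)
  show "A \<in> sets (atomic_measure N lam pt)"
    using assms by simp
qed simp

definition represents ::
  "nat \<Rightarrow> (quat ^ 'n::finite) measure \<Rightarrow> ('n qword \<Rightarrow> quat) \<Rightarrow> bool" where
  "represents d \<mu> y \<longleftrightarrow>
    (\<forall>w\<in>words (2 * d). has_bochner_integral \<mu> (\<lambda>a. eval_word a w) (y w))"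

end

(* Flatness makes the moment matrix the Gram matrix of vectors bv w in a finite-dimensional right
   quaternionic inner product space spanned by short words, so every letter a acts by an operator
   X a with adjoint X (lstar a). The commutator constraints (for flatness gap at least 2) or scalar
   consistency (for gap 1) make W = w + w* central for all words w of length at most 3. On a minimal
   invariant subspace the self-adjoint central operators W are real scalars. Hence the skew parts
   Y a = X a - X (lstar a) satisfy Clifford relations AB + BA real, and ABC - CBA real for triples;
   the latter forces them into the span of I, J, IJ for two anticommuting complex structures (or
   fewer), and averaging a vector over I, J, IJ gives a joint eigenvector, X a v = v c_a with c_a
   quaternionic. So all X a are diagonal in one orthonormal basis. Decomposing
   the vector of the empty word along this basis, the nonzero components have their eigenvalues as
   atoms and their squared norms as weights. Localizing matrices tested on these components give
   feasibility of the atoms, and comparison with Dirac moments gives optimality. *)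

theory Submission
  imports Defs "HOL-Library.Function_Algebras"
begin

section \<open>Quaternions and right quaternionic spaces\<close>

text \<open>Right multiplication by a nonreal quaternion is not right-linear, and rescaling an
  eigenvector by a quaternion conjugates its eigenvalue. In general only real eigenvalues have
  eigenspaces that are subspaces, so centrality can be exploited only through self-adjoint
  operators; the nonreal parts need the separate Clifford argument. The length 3 comes from the
  triple relation: pair relations alone admit four or more anticommuting complex structures, and
  these have no joint eigenvector, because at most three imaginary unit quaternions anticommute
  pairwise. The commutator of such a W with a letter has degree at most 4, which explains the degree
  in scalar consistency. Between \<open>bv u\<close> and \<open>bv v\<close> it is visible to the
  moments only if |u| + |v| + 4 \<le> 2d. Words of length at most d - 2 satisfy this, and they span
  if the gap is at least 2; with gap 1 the spanning words may have length d - 1, in total two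
  letters too many. For d = 1 the whole space is the line through the vector of the empty
  word.\<close>

lemma qcnj_qcnj [simp]: "qcnj (qcnj x) = x"
  by (simp add: quat_eq_iff)

lemma qcnj_simps [simp]:
  "qcnj 0 = 0" "qcnj 1 = 1" "qcnj (x + y) = qcnj x + qcnj y" "qcnj (x - y) = qcnj x - qcnj y"
  "qcnj (- x) = - qcnj x" "qcnj (t *\<^sub>R x) = t *\<^sub>R qcnj x"
  by (simp_all add: quat_eq_iff)

lemma qcnj_mult: "qcnj (x * y) = qcnj y * qcnj x"
  by (simp add: quat_eq_iff quat_times_sel)

lemma of_real_quat_sel [simp]:
  "qre (of_real t) = t" "qi (of_real t) = 0" "qj (of_real t) = 0" "qk (of_real t) = 0"
  by (simp_all add: of_real_def)

lemma qcnj_of_real [simp]: "qcnj (of_real t) = of_real t"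
  by (simp add: quat_eq_iff)

lemma qcnj_sum: "qcnj (sum f A) = (\<Sum>a\<in>A. qcnj (f a))"
  by (induction A rule: infinite_finite_induct) auto

lemma qre_sum: "qre (sum f A) = (\<Sum>a\<in>A. qre (f a))"
  by (induction A rule: infinite_finite_induct) auto

lemma of_real_quat_commute: "of_real t * x = x * (of_real t :: quat)"
  by (simp add: of_real_def)

lemma qcnj_mult_self: "qcnj x * x = of_real ((norm x)\<^sup>2)"
  by (simp add: quat_eq_iff quat_times_sel norm_quat_def inner_quat_def)

lemma mult_qcnj_self: "x * qcnj x = of_real ((norm x)\<^sup>2)"
  by (simp add: quat_eq_iff quat_times_sel norm_quat_def inner_quat_def)

lemma norm_qcnj [simp]: "norm (qcnj x) = norm x"
  by (simp add: norm_quat_def inner_quat_def)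

lemma qre_mult_commute: "qre (x * y) = qre (y * x)"
  by (simp add: quat_times_sel)

lemma qnonneg_iff: "qnonneg x \<longleftrightarrow> x = of_real (qre x) \<and> 0 \<le> qre x"
  by (auto simp: qnonneg_def)

lemma add_qcnj: "x + qcnj x = of_real (2 * qre x)"
  by (simp add: quat_eq_iff del: of_real_mult)

text \<open>Gaussian elimination by induction on the rows. The unknowns stand to the right of the
  matrix entries, so elimination factors act on rows from the left and commutativity never
  enters.\<close>

lemma division_ring_kernel_nontrivial:
  fixes A :: "'j \<Rightarrow> 'k \<Rightarrow> 'a::division_ring"
  assumes "finite J" "finite K" "card J < card K"
  shows "\<exists>c. (\<exists>v\<in>K. c v \<noteq> 0) \<and> (\<forall>u\<in>J. (\<Sum>v\<in>K. A u v * c v) = 0)"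
  using assms
proof (induction J arbitrary: A K rule: finite_induct)
  case empty
  then show ?case
    by (intro exI[of _ "\<lambda>_. 1"]) (auto simp: card_gt_0_iff)
next
  case (insert j J)
  show ?case
  proof (cases "\<forall>v\<in>K. A j v = 0")
    case True
    have "card J < card K"
      using insert by simp
    then show ?thesis
      using insert.IH[OF insert.prems(1), of A] True by auto
  next
    case False
    then obtain w where w: "w \<in> K" "A j w \<noteq> 0"
      by blast
    define K' where "K' = K - {w}"
    \<comment> \<open>Row \<open>u\<close> with its entry in the pivot column \<open>w\<close>
      cleared by a left multiple of row \<open>j\<close>; the pivot coordinate is recovered from row
      \<open>j\<close> in \<open>c'\<close>.\<close>
    define B where "B u v = A u v - A u w * inverse (A j w) * A j v" for u v
    have fK': "finite K'"
      using insert.prems by (simp add: K'_def)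
    have "card J < card K'"
      using insert w by (simp add: K'_def)
    from insert.IH[OF fK' this, of B] obtain c
      where c: "\<exists>v\<in>K'. c v \<noteq> 0" "\<forall>u\<in>J. (\<Sum>v\<in>K'. B u v * c v) = 0"
      by blast
    define s where "s = (\<Sum>v\<in>K'. A j v * c v)"
    define c' where "c' = c(w := - inverse (A j w) * s)"
    have split: "(\<Sum>v\<in>K. A u v * c' v) = (\<Sum>v\<in>K'. A u v * c v) - A u w * inverse (A j w) * s" for u
    proof -
      have "(\<Sum>v\<in>K. A u v * c' v) = A u w * c' w + (\<Sum>v\<in>K'. A u v * c' v)"
        using w insert.prems by (simp add: K'_def sum.remove)
      also have "(\<Sum>v\<in>K'. A u v * c' v) = (\<Sum>v\<in>K'. A u v * c v)"
        by (rule sum.cong) (auto simp: K'_def c'_def)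
      finally show ?thesis
        by (simp add: c'_def mult.assoc)
    qed
    have "(\<Sum>v\<in>K. A u v * c' v) = 0" if "u \<in> insert j J" for u
    proof (cases "u = j")
      case True
      then show ?thesis
        using w by (simp add: split flip: s_def)
    next
      case False
      with that c have "(\<Sum>v\<in>K'. B u v * c v) = 0"
        by auto
      then show ?thesis
        by (simp add: split B_def s_def left_diff_distrib sum_subtractf sum_distrib_left mult.assoc)
    qed
    moreover have "\<exists>v\<in>K. c' v \<noteq> 0"
      using c(1) by (auto simp: K'_def c'_def)
    ultimately show ?thesis
      by blast
  qed
qed

text \<open>Definiteness is absent because the form that a positive semidefinite matrix induces on
  functions of words has null vectors; it becomes definite only on a chosen subspace.\<close>

locale right_quat_semi_inner_space =
  fixes rscale :: "'h::ab_group_add \<Rightarrow> quat \<Rightarrow> 'h"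
    and ip :: "'h \<Rightarrow> 'h \<Rightarrow> quat"
  assumes rscale_add_left: "rscale (x + z) c = rscale x c + rscale z c"
    and rscale_add_right: "rscale x (c + c') = rscale x c + rscale x c'"
    and rscale_mult: "rscale x (c * c') = rscale (rscale x c) c'"
    and rscale_one: "rscale x 1 = x"
    and ip_add_right: "ip x (z + z') = ip x z + ip x z'"
    and ip_rscale_right: "ip x (rscale z c) = ip x z * c"
    and ip_commute: "ip z x = qcnj (ip x z)"
    and ip_nonneg: "qnonneg (ip x x)"
begin

lemma rscale_zero_left [simp]: "rscale 0 c = 0"
  using rscale_add_left[of 0 0 c] by simp

lemma rscale_zero_right [simp]: "rscale x 0 = 0"
  using rscale_add_right[of x 0 0] by simp

lemma rscale_minus_left: "rscale (- x) c = - rscale x c"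
  using rscale_add_left[of x "- x" c] by (simp add: eq_neg_iff_add_eq_0 add.commute)

lemma rscale_minus_right: "rscale x (- c) = - rscale x c"
  using rscale_add_right[of x c "- c"] by (simp add: eq_neg_iff_add_eq_0 add.commute)

lemma rscale_diff_left: "rscale (x - z) c = rscale x c - rscale z c"
  using rscale_add_left[of x "- z" c] by (simp add: rscale_minus_left)

lemma rscale_diff_right: "rscale x (c - c') = rscale x c - rscale x c'"
  using rscale_add_right[of x c "- c'"] by (simp add: rscale_minus_right)

lemma rscale_minus_one: "rscale x (- 1) = - x"
  by (simp add: rscale_minus_right rscale_one)

lemma rscale_sum_left: "rscale (sum f A) c = (\<Sum>a\<in>A. rscale (f a) c)"
  by (induction A rule: infinite_finite_induct) (auto simp: rscale_add_left)

lemma rscale_sum_right: "rscale x (sum f A) = (\<Sum>a\<in>A. rscale x (f a))"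
  by (induction A rule: infinite_finite_induct) (auto simp: rscale_add_right)

lemma rscale_eq_0D:
  assumes "rscale x c = 0" "c \<noteq> 0"
  shows "x = 0"
proof -
  have "x = rscale (rscale x c) (inverse c)"
    using assms(2) by (metis right_inverse rscale_mult rscale_one)
  then show ?thesis
    using assms by simp
qed

lemma ip_zero_right [simp]: "ip x 0 = 0"
  using ip_add_right[of x 0 0] by simp

lemma ip_zero_left [simp]: "ip 0 x = 0"
  using ip_commute[of 0 x] by simp

lemma ip_add_left: "ip (x + x') z = ip x z + ip x' z"
  using ip_commute[of "x + x'" z] ip_commute[of x z] ip_commute[of x' z] by (simp add: ip_add_right)

lemma ip_rscale_left: "ip (rscale x c) z = qcnj c * ip x z"
  using ip_commute[of "rscale x c" z] ip_commute[of x z] by (simp add: ip_rscale_right qcnj_mult)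

lemma ip_minus_right: "ip x (- z) = - ip x z"
  using ip_add_right[of x z "- z"] by (simp add: eq_neg_iff_add_eq_0 add.commute)

lemma ip_minus_left: "ip (- x) z = - ip x z"
  using ip_add_left[of x "- x" z] by (simp add: eq_neg_iff_add_eq_0 add.commute)

lemma ip_diff_right: "ip x (z - z') = ip x z - ip x z'"
  using ip_add_right[of x z "- z'"] by (simp add: ip_minus_right)

lemma ip_diff_left: "ip (x - x') z = ip x z - ip x' z"
  using ip_add_left[of x "- x'" z] by (simp add: ip_minus_left)

lemma ip_sum_right: "ip x (sum f A) = (\<Sum>a\<in>A. ip x (f a))"
  by (induction A rule: infinite_finite_induct) (auto simp: ip_add_right)

lemma ip_sum_left: "ip (sum f A) z = (\<Sum>a\<in>A. ip (f a) z)"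
  by (induction A rule: infinite_finite_induct) (auto simp: ip_add_left)

lemma ip_self: "ip x x = of_real (qre (ip x x))" "0 \<le> qre (ip x x)"
  using ip_nonneg[of x] by (simp_all add: qnonneg_iff)

lemma ip_pos: "ip x x \<noteq> 0 \<Longrightarrow> 0 < qre (ip x x)"
  using ip_self[of x] by (metis of_real_0 order_le_less)

text \<open>Moving \<open>z\<close> along a multiple of \<open>x\<close> changes its square norm
  linearly, since the quadratic term vanishes. A nonzero product \<open>ip z x\<close> would let
  this linear term push the square norm below zero; the factor \<open>qcnj a\<close> makes the term
  real.\<close>

lemma ip_null:
  assumes "ip x x = 0"
  shows "ip z x = 0"
proof (rule ccontr)
  define a where "a = ip z x"
  assume "ip z x \<noteq> 0"
  then have a: "0 < (norm a)\<^sup>2"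
    by (simp add: a_def)
  have xz: "ip x z = qcnj a"
    using ip_commute[of x z] by (simp add: a_def)
  have "0 \<le> qre (ip z z) - 2 * t * (norm a)\<^sup>2" for t :: real
  proof -
    let ?c = "of_real (- t) * qcnj a"
    have "ip (z + rscale x ?c) (z + rscale x ?c) = ip z z + (a * ?c + qcnj ?c * qcnj a)"
      by (simp add: ip_add_left ip_add_right ip_rscale_left ip_rscale_right assms xz flip: a_def)
    also have "qre \<dots> = qre (ip z z) - 2 * t * (norm a)\<^sup>2"
      by (simp add: qcnj_mult quat_times_sel norm_quat_def inner_quat_def algebra_simps)
    finally show ?thesis
      using ip_self(2)[of "z + rscale x ?c"] by simp
  qed
  \<comment> \<open>For this \<open>t\<close> the bound reads 0 \<le> - \<open>qre (ip z z)\<close>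
    - 2.\<close>
  from this[of "(qre (ip z z) + 1) / (norm a)\<^sup>2"] show False
    using a ip_self(2)[of z] by simp
qed

section \<open>Subspaces, right-linear operators and orthonormal sets\<close>

definition rsub :: "'h set \<Rightarrow> bool" where
  "rsub T \<longleftrightarrow> 0 \<in> T \<and> (\<forall>x\<in>T. \<forall>z\<in>T. x + z \<in> T) \<and> (\<forall>x\<in>T. \<forall>c. rscale x c \<in> T)"

definition rlin :: "'h set \<Rightarrow> ('h \<Rightarrow> 'h) \<Rightarrow> bool" where
  "rlin T A \<longleftrightarrow> (\<forall>x\<in>T. A x \<in> T) \<and> (\<forall>x\<in>T. \<forall>z\<in>T. A (x + z) = A x + A z) \<and>
     (\<forall>x\<in>T. \<forall>c. A (rscale x c) = rscale (A x) c)"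

definition orthonormal :: "'h set \<Rightarrow> bool" where
  "orthonormal E \<longleftrightarrow> (\<forall>x\<in>E. \<forall>z\<in>E. ip x z = (if x = z then 1 else 0))"

text \<open>Real factors keep the operator right-linear and let it commute with every right-linear
  operator.\<close>

definition scal :: "'h set \<Rightarrow> ('h \<Rightarrow> 'h) \<Rightarrow> bool" where
  "scal T A \<longleftrightarrow> (\<exists>t. \<forall>x\<in>T. A x = rscale x (of_real t))"

lemma rsubD:
  assumes "rsub T"
  shows "0 \<in> T" "x \<in> T \<Longrightarrow> z \<in> T \<Longrightarrow> x + z \<in> T" "x \<in> T \<Longrightarrow> rscale x c \<in> T"
    "x \<in> T \<Longrightarrow> - x \<in> T" "x \<in> T \<Longrightarrow> z \<in> T \<Longrightarrow> x - z \<in> T"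
proof -
  show 1: "0 \<in> T" "x \<in> T \<Longrightarrow> z \<in> T \<Longrightarrow> x + z \<in> T" "x \<in> T \<Longrightarrow> rscale x c \<in> T" for x z c
    using assms by (auto simp: rsub_def)
  show 2: "x \<in> T \<Longrightarrow> - x \<in> T" for x
    using 1(3)[of x "- 1"] by (simp add: rscale_minus_one)
  show "x \<in> T \<Longrightarrow> z \<in> T \<Longrightarrow> x - z \<in> T"
    using 1(2)[of x "- z"] 2[of z] by simp
qed

lemma rsub_sum: "rsub T \<Longrightarrow> (\<And>a. a \<in> A \<Longrightarrow> f a \<in> T) \<Longrightarrow> sum f A \<in> T"
  by (induction A rule: infinite_finite_induct) (auto simp: rsubD)

lemma rlinD:
  assumes "rlin T A"
  shows "x \<in> T \<Longrightarrow> A x \<in> T" "x \<in> T \<Longrightarrow> z \<in> T \<Longrightarrow> A (x + z) = A x + A z"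
    "x \<in> T \<Longrightarrow> A (rscale x c) = rscale (A x) c" "x \<in> T \<Longrightarrow> A (- x) = - A x"
    "rsub T \<Longrightarrow> x \<in> T \<Longrightarrow> z \<in> T \<Longrightarrow> A (x - z) = A x - A z"
    "rsub T \<Longrightarrow> A 0 = 0"
proof -
  show 1: "x \<in> T \<Longrightarrow> A x \<in> T" "x \<in> T \<Longrightarrow> z \<in> T \<Longrightarrow> A (x + z) = A x + A z"
    "x \<in> T \<Longrightarrow> A (rscale x c) = rscale (A x) c" for x z c
    using assms by (auto simp: rlin_def)
  show 2: "x \<in> T \<Longrightarrow> A (- x) = - A x" for x
    using 1(3)[of x "- 1"] by (simp add: rscale_minus_one)
  show "rsub T \<Longrightarrow> x \<in> T \<Longrightarrow> z \<in> T \<Longrightarrow> A (x - z) = A x - A z"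
    using 1(2)[of x "- z"] 2[of z] rsubD(4)[of T z] by simp
  show "rsub T \<Longrightarrow> A 0 = 0"
    using 1(3)[of 0 0] rsubD(1)[of T] by simp
qed

lemma rlin_sum:
  assumes "rsub T" "rlin T A" "\<And>k. k \<in> K \<Longrightarrow> f k \<in> T"
  shows "A (sum f K) = (\<Sum>k\<in>K. A (f k))"
  using assms(3)
  by (induction K rule: infinite_finite_induct)
    (auto simp: rlinD[OF assms(2)] assms(1) rsub_sum)

lemma rlin_add: "rsub T \<Longrightarrow> rlin T A \<Longrightarrow> rlin T B \<Longrightarrow> rlin T (\<lambda>x. A x + B x)"
  by (auto simp: rlin_def rsubD algebra_simps rscale_add_left)

lemma rlin_diff: "rsub T \<Longrightarrow> rlin T A \<Longrightarrow> rlin T B \<Longrightarrow> rlin T (\<lambda>x. A x - B x)"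
  by (auto simp: rlin_def rsubD algebra_simps rscale_diff_left)

lemma rlin_rscale_real: "rsub T \<Longrightarrow> rlin T A \<Longrightarrow> rlin T (\<lambda>x. rscale (A x) (of_real t))"
  by (auto simp: rlin_def rsubD rscale_add_left of_real_quat_commute simp flip: rscale_mult)

lemma rlin_foldr: "(\<And>a. rlin T (X a)) \<Longrightarrow> rlin T (foldr X w)"
  by (induction w) (auto simp: rlin_def)

lemma rlin_subset: "rlin S A \<Longrightarrow> T \<subseteq> S \<Longrightarrow> (\<And>x. x \<in> T \<Longrightarrow> A x \<in> T) \<Longrightarrow> rlin T A"
  by (auto simp: rlin_def subset_iff)

lemma scal_add: "scal T A \<Longrightarrow> scal T B \<Longrightarrow> scal T (\<lambda>x. A x + B x)"
  unfolding scal_def by (metis rscale_add_right of_real_add)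

lemma scal_diff: "scal T A \<Longrightarrow> scal T B \<Longrightarrow> scal T (\<lambda>x. A x - B x)"
  unfolding scal_def by (metis rscale_diff_right of_real_diff)

lemma scal_rscale: "scal T A \<Longrightarrow> scal T (\<lambda>x. rscale (A x) (of_real t))"
  unfolding scal_def by (metis rscale_mult of_real_mult)

lemma scal_cong: "(\<And>x. x \<in> T \<Longrightarrow> A x = B x) \<Longrightarrow> scal T A \<longleftrightarrow> scal T B"
  by (simp add: scal_def)

lemma orthonormal_empty [simp]: "orthonormal {}"
  by (simp add: orthonormal_def)

lemma ip_orthonormal_sum:
  assumes "orthonormal E" "finite E" "e \<in> E"
  shows "ip e (\<Sum>f\<in>E. rscale f (c f)) = c e"
proof -
  have "ip e (\<Sum>f\<in>E. rscale f (c f)) = (\<Sum>f\<in>E. ip e f * c f)"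
    by (simp add: ip_sum_right ip_rscale_right)
  also have "\<dots> = (\<Sum>f\<in>E. if f = e then c f else 0)"
    using assms by (intro sum.cong) (auto simp: orthonormal_def)
  finally show ?thesis
    using assms by simp
qed

lemma orthonormal_insert:
  assumes "orthonormal E" "ip e e = 1" "\<And>f. f \<in> E \<Longrightarrow> ip f e = 0"
  shows "orthonormal (insert e E)" "e \<notin> E"
proof -
  show "e \<notin> E"
    using assms(2,3) by fastforce
  have "ip e f = 0" if "f \<in> E" for f
    using assms(3)[OF that] ip_commute[of e f] by simp
  then show "orthonormal (insert e E)"
    using assms \<open>e \<notin> E\<close> by (auto simp: orthonormal_def)
qed

end

section \<open>Orthonormal bases\<close>

text \<open>Finite dimension is encoded as a bound on the size of orthonormal sets, so that
  maximality arguments run over cardinalities.\<close>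

locale right_quat_fin_dim = right_quat_semi_inner_space rscale ip
  for rscale :: "'h::ab_group_add \<Rightarrow> quat \<Rightarrow> 'h" and ip +
  fixes S :: "'h set" and r :: nat
  assumes sub: "rsub S"
    and definite: "x \<in> S \<Longrightarrow> ip x x = 0 \<Longrightarrow> x = 0"
    and bound: "finite E \<Longrightarrow> E \<subseteq> S \<Longrightarrow> orthonormal E \<Longrightarrow> card E \<le> r"
begin

lemma ex_normalised:
  assumes "x \<in> S" "x \<noteq> 0"
  obtains t where "t \<noteq> 0" "ip (rscale x (of_real t)) (rscale x (of_real t)) = 1"
proof
  define s where "s = qre (ip x x)"
  have "s > 0"
    using assms definite[of x] ip_pos[of x] by (auto simp: s_def)
  then show "1 / sqrt s \<noteq> 0"
    by simp
  define t where "t = 1 / sqrt s"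
  have t: "t * s * t = 1"
    using \<open>s > 0\<close> by (simp add: t_def)
  have "ip x x = of_real s"
    unfolding s_def by (rule ip_self)
  then have "ip (rscale x (of_real t)) (rscale x (of_real t)) = of_real (t * s * t)"
    by (simp add: ip_rscale_left ip_rscale_right mult.assoc)
  then show "ip (rscale x (of_real (1 / sqrt s))) (rscale x (of_real (1 / sqrt s))) = 1"
    unfolding t by (simp add: t_def)
qed

lemma ex_maximal_orthonormal:
  assumes "P {}"
  obtains E where "finite E" "E \<subseteq> S" "orthonormal E" "P E"
    "\<And>E'. finite E' \<Longrightarrow> E' \<subseteq> S \<Longrightarrow> orthonormal E' \<Longrightarrow> P E' \<Longrightarrow> card E' \<le> card E"
proof -
  let ?Q = "\<lambda>E. finite E \<and> E \<subseteq> S \<and> orthonormal E \<and> P E"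
  have "\<exists>E. ?Q E \<and> (\<forall>E'. ?Q E' \<longrightarrow> card E' \<le> card E)"
    by (rule ex_has_greatest_nat[where k = "{}" and b = "Suc r"]) (use assms bound in \<open>auto simp: less_Suc_eq_le\<close>)
  then obtain E where "?Q E" "\<forall>E'. ?Q E' \<longrightarrow> card E' \<le> card E"
    by blast
  then show ?thesis
    by (intro that[of E]) auto
qed

definition onb :: "'h set \<Rightarrow> 'h set \<Rightarrow> bool" where
  "onb T E \<longleftrightarrow> finite E \<and> E \<subseteq> T \<and> orthonormal E \<and> (\<forall>x\<in>T. x = (\<Sum>e\<in>E. rscale e (ip e x)))"

text \<open>One Gram-Schmidt step: the residual of \<open>x\<close> is orthogonal to
  \<open>E\<close>, nonzero, and can be normalised.\<close>

lemma extend_orthonormal: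
  assumes T: "rsub T" "T \<subseteq> S" and E: "finite E" "E \<subseteq> T" "orthonormal E"
    and x: "x \<in> T" "x \<noteq> (\<Sum>e\<in>E. rscale e (ip e x))"
  obtains e where "e \<in> T" "e \<notin> E" "orthonormal (insert e E)"
proof -
  define z where "z = x - (\<Sum>e\<in>E. rscale e (ip e x))"
  have z: "z \<in> T" "z \<noteq> 0"
    using T(1) E(2) x unfolding z_def by (auto intro!: rsubD(3,5) rsub_sum)
  then obtain t where t: "ip (rscale z (of_real t)) (rscale z (of_real t)) = 1"
    using T(2) by (meson ex_normalised subsetD)
  have "ip f (rscale z (of_real t)) = 0" if "f \<in> E" for f
    by (simp add: ip_rscale_right z_def ip_diff_right ip_orthonormal_sum[OF E(3,1) that])
  from orthonormal_insert[OF E(3) t this] show ?thesis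
    by (intro that[of "rscale z (of_real t)"] rsubD(3)[OF T(1) z(1)])
qed

text \<open>A residual vector would enlarge a largest orthonormal set. The maximality is exported
  because the comparison of dimensions in \<open>minimal_subspace\<close> relies on it.\<close>

lemma maximal_orthonormal_onb:
  assumes T: "rsub T" "T \<subseteq> S"
  obtains E where "onb T E" "\<And>E'. finite E' \<Longrightarrow> E' \<subseteq> T \<Longrightarrow> orthonormal E' \<Longrightarrow> card E' \<le> card E"
proof -
  obtain E where E: "finite E" "E \<subseteq> S" "orthonormal E" "E \<subseteq> T"
    "\<And>E'. finite E' \<Longrightarrow> E' \<subseteq> S \<Longrightarrow> orthonormal E' \<Longrightarrow> E' \<subseteq> T \<Longrightarrow> card E' \<le> card E"
    by (rule ex_maximal_orthonormal[of "\<lambda>E. E \<subseteq> T"]) auto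
  have "x = (\<Sum>e\<in>E. rscale e (ip e x))" if "x \<in> T" for x
  proof (rule ccontr)
    assume "x \<noteq> (\<Sum>e\<in>E. rscale e (ip e x))"
    from extend_orthonormal[OF T E(1,4,3) that this] obtain e
      where "e \<in> T" "e \<notin> E" "orthonormal (insert e E)" .
    then show False
      using E(1,4) T(2) E(5)[of "insert e E"] by auto
  qed
  then have "onb T E"
    using E by (auto simp: onb_def)
  then show ?thesis
  proof (rule that)
    show "card E' \<le> card E" if "finite E'" "E' \<subseteq> T" "orthonormal E'" for E'
      using E(5)[OF that(1) _ that(3,2)] that(2) T(2) by auto
  qed
qed

text \<open>The size of a largest orthonormal subset serves as dimension. A candidate of least
  dimension is minimal for inclusion: a vector outside a proper subspace would extend an orthonormal
  basis of that subspace by one element.\<close>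

lemma minimal_subspace:
  assumes "P T0" and P: "\<And>T. P T \<Longrightarrow> rsub T \<and> T \<subseteq> S"
  obtains T where "P T" "T \<subseteq> T0" "\<And>T'. P T' \<Longrightarrow> T' \<subseteq> T \<Longrightarrow> T' = T"
proof -
  define m where "m T = Max (card ` {E. finite E \<and> E \<subseteq> T \<and> orthonormal E})" for T
  have fin: "finite (card ` {E. finite E \<and> E \<subseteq> T \<and> orthonormal E})" if "T \<subseteq> S" for T
    by (rule finite_subset[of _ "{..r}"]) (use bound that in auto)
  obtain T where T: "P T" "T \<subseteq> T0" "\<And>T'. P T' \<Longrightarrow> T' \<subseteq> T0 \<Longrightarrow> m T \<le> m T'"
    using ex_has_least_nat[of "\<lambda>T. P T \<and> T \<subseteq> T0" T0 m] assms(1) by blast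
  have "T' = T" if T': "P T'" "T' \<subseteq> T" for T'
  proof (rule ccontr)
    assume "T' \<noteq> T"
    then obtain x where x: "x \<in> T" "x \<notin> T'"
      using T' by blast
    have sT: "rsub T" "T \<subseteq> S" "rsub T'" "T' \<subseteq> S"
      using P T' T by auto
    obtain E where E: "onb T' E" "\<And>E'. finite E' \<Longrightarrow> E' \<subseteq> T' \<Longrightarrow> orthonormal E' \<Longrightarrow> card E' \<le> card E"
      by (rule maximal_orthonormal_onb[OF sT(3,4) that])
    have E1: "finite E" "E \<subseteq> T'" "orthonormal E"
      using E by (auto simp: onb_def)
    have "(\<Sum>e\<in>E. rscale e (ip e x)) \<in> T'"
      using E1 by (intro rsub_sum rsubD(3) sT(3)) auto
    then have ne: "x \<noteq> (\<Sum>e\<in>E. rscale e (ip e x))"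
      using x by auto
    have ET: "E \<subseteq> T"
      using E1 T' by auto
    obtain e where e: "e \<in> T" "e \<notin> E" "orthonormal (insert e E)"
      by (rule extend_orthonormal[OF sT(1,2) E1(1) ET E1(3) x(1) ne that])
    have "m T' \<in> card ` {F. finite F \<and> F \<subseteq> T' \<and> orthonormal F}"
      unfolding m_def by (rule Max_in[OF fin[OF sT(4)]]) (auto intro: exI[of _ "{}"])
    then have "m T' \<le> card E"
      using E(2) by auto
    moreover have "card (insert e E) \<le> m T"
      unfolding m_def by (rule Max_ge[OF fin[OF sT(2)]]) (use E1 ET e in blast)
    moreover have "m T \<le> m T'"
      using T T' by auto
    ultimately show False
      using e E1 by simp
  qed
  then show ?thesis
    by (intro that[OF T(1,2)]) auto
qed

end

section \<open>Eigenvectors of self-adjoint operators\<close>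

lemma bounded_linear_qre: "bounded_linear qre"
proof -
  have "qre = (\<lambda>x. x \<bullet> 1)"
    by (simp add: fun_eq_iff inner_quat_def)
  then show ?thesis
    by (metis bounded_linear_inner_left)
qed

lemma bounded_linear_qcnj: "bounded_linear qcnj"
  by (intro linear_conv_bounded_linear[THEN iffD1] linearI) auto

lemma nonpos_if_quadratic_nonneg:
  fixes N D :: real
  assumes "\<And>s. 0 \<le> s\<^sup>2 * D - 2 * s * N" "0 \<le> D"
  shows "N \<le> 0"
proof (rule ccontr)
  assume "\<not> N \<le> 0"
  then have N: "N > 0"
    by simp
  \<comment> \<open>With this \<open>s\<close> the product s D equals N - s, so the quadratic
    becomes - s (s + N), which is negative.\<close>
  define s where "s = N / (D + 1)"
  have s: "s > 0" "s * (D + 1) = N"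
    using N assms(2) by (simp_all add: s_def)
  have "s\<^sup>2 * D - 2 * s * N = s * (s * (D + 1) - s - 2 * N)"
    by (simp add: power2_eq_square algebra_simps)
  also have "\<dots> = - (s * (s + N))"
    by (simp only: s) (simp add: algebra_simps)
  also have "\<dots> < 0"
    using s N by simp
  finally show False
    using assms(1)[of s] by simp
qed

text \<open>The ambient space carries no topology, so compactness is obtained in the product
  topology on coordinate functions. Coordinates outside \<open>E\<close> are frozen to 0, which puts
  the sphere into a product of compact sets.\<close>

lemma compact_coordinate_sphere:
  fixes E :: "'a set"
  assumes "finite E"
  shows "compact {c :: 'a \<Rightarrow> quat. (\<forall>e. e \<notin> E \<longrightarrow> c e = 0) \<and> (\<Sum>e\<in>E. (norm (c e))\<^sup>2) = 1}"
proof -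
  define P where "P = Pi\<^sub>E UNIV (\<lambda>e. if e \<in> E then cball 0 1 else {0 :: quat})"
  have "compact P"
    using compactin_PiE[of "\<lambda>_. euclidean" UNIV "\<lambda>e. if e \<in> E then cball 0 1 else {0 :: quat}"]
    by (simp add: euclidean_product_topology P_def compactin_euclidean_iff)
  moreover have "closed {c :: 'a \<Rightarrow> quat. (\<Sum>e\<in>E. (norm (c e))\<^sup>2) = 1}"
    by (intro closed_Collect_eq continuous_intros continuous_on_product_coordinates)
  ultimately have "compact (P \<inter> {c. (\<Sum>e\<in>E. (norm (c e))\<^sup>2) = 1})"
    by (rule compact_Int_closed)
  also have "P \<inter> {c. (\<Sum>e\<in>E. (norm (c e))\<^sup>2) = 1} =
      {c. (\<forall>e. e \<notin> E \<longrightarrow> c e = 0) \<and> (\<Sum>e\<in>E. (norm (c e))\<^sup>2) = 1}"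
  proof -
    have "norm (c e) \<le> 1" if "e \<in> E" "(\<Sum>e\<in>E. (norm (c e))\<^sup>2) = 1" for c :: "'a \<Rightarrow> quat" and e
    proof -
      have "(norm (c e))\<^sup>2 \<le> 1"
        using member_le_sum[of e E "\<lambda>e. (norm (c e))\<^sup>2"] that assms by simp
      then show ?thesis
        by (simp add: power_le_one_iff abs_square_le_1)
    qed
    then show ?thesis
      by (auto simp: P_def PiE_iff split: if_splits)
  qed
  finally show ?thesis .
qed

context right_quat_fin_dim
begin

lemma ip_onb_sum:
  assumes "onb T E"
  shows "ip (\<Sum>e\<in>E. rscale e (c e)) (\<Sum>e\<in>E. rscale e (c e)) = of_real (\<Sum>e\<in>E. (norm (c e))\<^sup>2)"
proof -
  have "ip (\<Sum>e\<in>E. rscale e (c e)) (\<Sum>e\<in>E. rscale e (c e))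
      = (\<Sum>e\<in>E. qcnj (c e) * ip e (\<Sum>f\<in>E. rscale f (c f)))"
    by (simp add: ip_sum_left ip_rscale_left)
  also have "\<dots> = (\<Sum>e\<in>E. of_real ((norm (c e))\<^sup>2))"
    using assms by (intro sum.cong refl) (simp add: onb_def ip_orthonormal_sum qcnj_mult_self)
  finally show ?thesis
    by simp
qed

text \<open>Variational argument: the Rayleigh quotient attains its maximum on the unit sphere by
  compactness, and vanishing of the first variation there is the eigenvalue equation.\<close>

lemma selfadjoint_eigenvector:
  assumes T: "rsub T" "T \<subseteq> S" and x0: "x0 \<in> T" "x0 \<noteq> 0" and A: "rlin T A"
    and sa: "\<And>x z. x \<in> T \<Longrightarrow> z \<in> T \<Longrightarrow> ip (A x) z = ip x (A z)"
  obtains t v where "v \<in> T" "v \<noteq> 0" "A v = rscale v (of_real t)"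
proof -
  obtain E where E: "onb T E"
    by (rule maximal_orthonormal_onb[OF T])
  have fE: "finite E" and ET: "E \<subseteq> T"
    and expand: "x \<in> T \<Longrightarrow> x = (\<Sum>e\<in>E. rscale e (ip e x))" for x
    using E by (auto simp: onb_def)
  define V where "V c = (\<Sum>e\<in>E. rscale e (c e))" for c
  define \<phi> where "\<phi> c = qre (ip (V c) (A (V c)))" for c
  define K where "K = {c :: 'h \<Rightarrow> quat. (\<forall>e. e \<notin> E \<longrightarrow> c e = 0) \<and> (\<Sum>e\<in>E. (norm (c e))\<^sup>2) = 1}"
  have VT: "V c \<in> T" for c
    unfolding V_def using ET by (intro rsub_sum[OF T(1)] rsubD(3)[OF T(1)]) auto
  have AV: "A (V c) = (\<Sum>f\<in>E. rscale (A f) (c f))" for c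
    unfolding V_def using ET
    by (subst rlin_sum[OF T(1) A]) (auto intro!: rsubD(3)[OF T(1)] sum.cong rlinD(3)[OF A])
  have "\<phi> = (\<lambda>c. qre (\<Sum>f\<in>E. \<Sum>e\<in>E. qcnj (c e) * ip e (A f) * c f))"
    unfolding \<phi>_def AV
    by (simp add: fun_eq_iff V_def ip_sum_left ip_sum_right ip_rscale_left ip_rscale_right
        sum_distrib_right)
  then have cont: "continuous_on K \<phi>"
    by (simp only:) (intro continuous_intros bounded_linear.continuous_on[OF bounded_linear_qre]
        bounded_linear.continuous_on[OF bounded_linear_qcnj]
        continuous_on_subset[OF continuous_on_product_coordinates] subset_UNIV)
  have inK: "\<exists>c\<in>K. V c = x" if "x \<in> T" "ip x x = 1" for x
  proof
    let ?c = "\<lambda>e. if e \<in> E then ip e x else 0"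
    show V: "V ?c = x"
      unfolding V_def using expand[OF that(1)] by (simp cong: sum.cong)
    have "of_real (\<Sum>e\<in>E. (norm (?c e))\<^sup>2) = (of_real 1 :: quat)"
      using ip_onb_sum[OF E, of ?c] that V by (simp add: V_def)
    then show "?c \<in> K"
      unfolding of_real_eq_iff by (simp add: K_def)
  qed
  obtain t0 where "ip (rscale x0 (of_real t0)) (rscale x0 (of_real t0)) = 1"
    using ex_normalised[of x0] x0 T by auto
  then have "K \<noteq> {}"
    using inK[of "rscale x0 (of_real t0)"] rsubD(3)[OF T(1) x0(1)] by auto
  moreover have "compact K"
    unfolding K_def by (rule compact_coordinate_sphere[OF fE])
  ultimately obtain c0 where c0: "c0 \<in> K" "\<And>c. c \<in> K \<Longrightarrow> \<phi> c \<le> \<phi> c0"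
    using continuous_attains_sup[OF _ _ cont] by blast
  define v t where "v = V c0" and "t = \<phi> c0"
  have v: "v \<in> T" "ip v v = 1"
    using VT ip_onb_sum[OF E, of c0] c0(1) by (simp_all add: v_def V_def K_def del: of_real_sum of_real_power)
  \<comment> \<open>The homogeneous defect from the maximum: nonnegative on \<open>T\<close> and
    zero at \<open>v\<close>.\<close>
  define D where "D x = t * qre (ip x x) - qre (ip x (A x))" for x
  have D: "0 \<le> D x" if x: "x \<in> T" for x
  proof (cases "x = 0")
    case False
    then obtain s where s: "ip (rscale x (of_real s)) (rscale x (of_real s)) = 1" "s \<noteq> 0"
      using ex_normalised[of x] x T by auto
    then have "qre (of_real s * ip x x * of_real s) = 1"
      by (simp add: ip_rscale_left ip_rscale_right mult.assoc)
    then have s1: "s\<^sup>2 * qre (ip x x) = 1"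
      by (simp add: quat_times_sel power2_eq_square mult_ac)
    obtain c where "c \<in> K" "V c = rscale x (of_real s)"
      using inK[of "rscale x (of_real s)"] s x rsubD(3)[OF T(1)] by blast
    with c0(2) have "qre (ip (rscale x (of_real s)) (A (rscale x (of_real s)))) \<le> t"
      unfolding t_def by (metis \<phi>_def)
    then have "s\<^sup>2 * qre (ip x (A x)) \<le> t"
      by (simp add: rlinD(3)[OF A] x ip_rscale_left ip_rscale_right quat_times_sel
          power2_eq_square mult_ac)
    also have "t = s\<^sup>2 * (t * qre (ip x x))"
      using s1 by (simp add: mult.left_commute)
    finally have "0 \<le> s\<^sup>2 * D x"
      by (simp add: D_def right_diff_distrib)
    then show ?thesis
      using s(2) by (simp add: zero_le_mult_iff)
  qed (simp add: D_def)
  define n where "n = A v - rscale v (of_real t)"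
  have n: "n \<in> T"
    unfolding n_def using v by (intro rsubD[OF T(1)] rlinD(1)[OF A])
  \<comment> \<open>The maximiser is varied in the direction of its own residual \<open>n\<close>.
    The term linear in \<open>s\<close> is a multiple of \<open>ip n n\<close>, so nonnegativity for
    all \<open>s\<close> kills the residual.\<close>
  have "0 \<le> s\<^sup>2 * D n - 2 * s * qre (ip n n)" for s
  proof -
    have "D v = 0"
      using v by (simp add: D_def t_def \<phi>_def v_def)
    have re_sym: "qre (ip v (A n)) = qre (ip n (A v))" "qre (ip v n) = qre (ip n v)"
      using sa[OF v(1) n] ip_commute[of n "A v"] ip_commute[of n v] by simp_all
    have N: "qre (ip n n) = qre (ip n (A v)) - t * qre (ip n v)"
      by (subst (2) n_def) (simp add: ip_diff_right ip_rscale_right quat_times_sel)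
    have "D (v + rscale n (of_real s)) = D v + s\<^sup>2 * D n - 2 * s * qre (ip n n)"
      unfolding N by (simp add: D_def rlinD[OF A] v n rsubD(3)[OF T(1)] ip_add_left ip_add_right
          ip_rscale_left ip_rscale_right quat_times_sel re_sym power2_eq_square algebra_simps)
    then show ?thesis
      using D[of "v + rscale n (of_real s)"] \<open>D v = 0\<close> rsubD[OF T(1)] v n by simp
  qed
  from nonpos_if_quadratic_nonneg[OF this D[OF n]] have "ip n n = 0"
    using ip_pos[of n] by fastforce
  then have "n = 0"
    using definite n T by blast
  moreover have "v \<noteq> 0"
    using v by auto
  ultimately show ?thesis
    using that[of v t] v by (simp add: n_def)
qed

end

section \<open>Common eigenvectors of Clifford systems\<close>

definition "quat_i = Quat 0 1 0 0"
definition "quat_j = Quat 0 0 1 0"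
definition "quat_k = Quat 0 0 0 1"

lemma quat_units:
  "quat_i * quat_i = - 1" "quat_j * quat_j = - 1" "quat_k * quat_k = - 1"
  "quat_i * quat_j = quat_k" "quat_j * quat_k = quat_i" "quat_k * quat_i = quat_j"
  "quat_j * quat_i = - quat_k" "quat_k * quat_j = - quat_i" "quat_i * quat_k = - quat_j"
  "qcnj quat_i = - quat_i" "qcnj quat_j = - quat_j" "qcnj quat_k = - quat_k"
  by (simp_all add: quat_i_def quat_j_def quat_k_def quat_eq_iff quat_times_sel)

context right_quat_semi_inner_space
begin

text \<open>The map \<open>w\<close> is twice the real-linear projection onto the vectors on which
  \<open>I\<close> acts as right multiplication by i.\<close>

lemma complex_structure_eigenvector:
  assumes T: "rsub T" and u: "u \<in> T" "u \<noteq> 0" and I: "rlin T I"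
    and II: "\<And>x. x \<in> T \<Longrightarrow> I (I x) = - x"
  obtains v where "v \<in> T" "v \<noteq> 0" "I v = rscale v quat_i"
proof -
  define w where "w u = u - rscale (I u) quat_i" for u
  have wT: "w x \<in> T" if "x \<in> T" for x
    unfolding w_def using that by (intro rsubD[OF T] rlinD(1)[OF I])
  have w: "I (w x) = rscale (w x) quat_i" if "x \<in> T" for x
    using that by (simp add: w_def rlinD[OF I] T rsubD[OF T] II rscale_minus_left rscale_diff_left
        rscale_minus_one quat_units flip: rscale_mult)
  show ?thesis
  proof (cases "w u = 0")
    \<comment> \<open>Here \<open>I\<close> acts on \<open>u\<close> as right multiplication by -i.
      Since i and j anticommute, right multiplication by j turns the eigenvalue -i into i.\<close>
    case True
    have uj: "rscale u quat_j \<in> T"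
      using u rsubD[OF T] by simp
    have "rscale (I u) (quat_j * quat_i) = - rscale (rscale (I u) quat_i) quat_j"
      by (simp add: quat_units rscale_minus_right flip: rscale_mult)
    also have "rscale (I u) quat_i = u"
      using True by (simp add: w_def)
    finally have "w (rscale u quat_j) = rscale u quat_j + rscale u quat_j"
      using u by (simp add: w_def rlinD[OF I] flip: rscale_mult)
    also have "\<dots> = rscale u (quat_j + quat_j)"
      by (simp add: rscale_add_right)
    also have "\<dots> \<noteq> 0"
      using rscale_eq_0D[of u "quat_j + quat_j"] u(2) by (auto simp: quat_j_def quat_eq_iff)
    finally show ?thesis
      using that w wT uj by blast
  next
    case False
    then show ?thesis
      using that w wT u(1) by blast
  qed
qed

text \<open>The map \<open>P\<close> is 4 times the real-linear projection onto the vectors on which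
  \<open>I\<close> and \<open>J\<close> act as right multiplication by i and j. What remains is that
  \<open>P\<close> does not vanish on all quaternionic multiples of \<open>u\<close>.\<close>

lemma quaternionic_structure_eigenvector:
  assumes T: "rsub T" and u: "u \<in> T" "u \<noteq> 0" and I: "rlin T I" and J: "rlin T J"
    and II: "\<And>x. x \<in> T \<Longrightarrow> I (I x) = - x" and JJ: "\<And>x. x \<in> T \<Longrightarrow> J (J x) = - x"
    and JI: "\<And>x. x \<in> T \<Longrightarrow> J (I x) = - I (J x)"
  obtains v where "v \<in> T" "v \<noteq> 0" "I v = rscale v quat_i" "J v = rscale v quat_j"
proof -
  define P where "P u = u - rscale (I u) quat_i - rscale (J u) quat_j - rscale (I (J u)) quat_k" for u
  note lin = rlinD[OF I] rlinD[OF J] T rsubD[OF T]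
  have PT: "P x \<in> T" if "x \<in> T" for x
    unfolding P_def using that by (simp add: lin)
  have PI: "I (P x) = rscale (P x) quat_i" if "x \<in> T" for x
    using that by (simp add: P_def lin II JJ JI rscale_minus_left rscale_minus_right rscale_diff_left
        rscale_one quat_units flip: rscale_mult)
  have PJ: "J (P x) = rscale (P x) quat_j" if "x \<in> T" for x
    using that by (simp add: P_def lin II JJ JI rscale_minus_left rscale_minus_right rscale_diff_left
        rscale_one quat_units flip: rscale_mult)
  \<comment> \<open>Summing over the units q, the terms q i (qcnj q), q j (qcnj q), q k (qcnj q) cancel and 4 u remains.\<close>
  define R where "R q = rscale (P (rscale u q)) (qcnj q)" for q
  have R: "R q = rscale u (q * qcnj q) - rscale (I u) (q * quat_i * qcnj q)
      - rscale (J u) (q * quat_j * qcnj q) - rscale (I (J u)) (q * quat_k * qcnj q)" for q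
    using u by (simp add: R_def P_def lin rscale_diff_left mult.assoc flip: rscale_mult)
  have "R 1 + R quat_i + R quat_j + R quat_k = rscale u 1 + rscale u 1 + rscale u 1 + rscale u 1"
    unfolding R by (simp add: quat_units rscale_minus_right mult.assoc)
  also have "\<dots> = rscale u 4"
    by (simp flip: rscale_add_right)
  also have "\<dots> \<noteq> 0"
    using rscale_eq_0D[of u 4] u(2) by auto
  finally obtain q where "R q \<noteq> 0"
    by (metis add.right_neutral)
  then have "P (rscale u q) \<noteq> 0"
    by (auto simp: R_def)
  then show ?thesis
    using that PT PI PJ rsubD(3)[OF T u(1)] by blast
qed

text \<open>If \<open>F\<close> anticommutes with anticommuting complex structures \<open>I\<close>
  and \<open>J\<close>, then F J I = - I J F. So \<open>V3\<close> makes 2 I J F a real scalar, and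
  \<open>F\<close> is a real multiple of J I. An eigenvector for \<open>I\<close> and
  \<open>J\<close> is thereby one for all of \<open>V\<close>.\<close>

lemma clifford_common_eigenvector:
  assumes T: "rsub T" and u: "u \<in> T" "u \<noteq> 0"
    and V_lin: "\<And>A. A \<in> V \<Longrightarrow> rlin T A"
    and V_add: "\<And>A B. A \<in> V \<Longrightarrow> B \<in> V \<Longrightarrow> (\<lambda>x. A x + B x) \<in> V"
    and V_rscale: "\<And>A t. A \<in> V \<Longrightarrow> (\<lambda>x. rscale (A x) (of_real t)) \<in> V"
    and V2: "\<And>A B. A \<in> V \<Longrightarrow> B \<in> V \<Longrightarrow> scal T (\<lambda>x. A (B x) + B (A x))"
    and V3: "\<And>A B C. A \<in> V \<Longrightarrow> B \<in> V \<Longrightarrow> C \<in> V \<Longrightarrow> scal T (\<lambda>x. A (B (C x)) - C (B (A x)))"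
    and V_neg: "\<And>A x. A \<in> V \<Longrightarrow> x \<in> T \<Longrightarrow> A x \<noteq> 0 \<Longrightarrow>
      \<exists>t>0. \<forall>x\<in>T. A (A x) = rscale x (of_real (- t))"
  obtains v where "v \<in> T" "v \<noteq> 0" "\<And>A. A \<in> V \<Longrightarrow> \<exists>c. A v = rscale v c"
proof -
  have normalise: "\<exists>I\<in>V. (\<forall>x\<in>T. I (I x) = - x) \<and> (\<exists>s. \<forall>x. I x = rscale (A x) (of_real s))"
    if A: "A \<in> V" and x: "x \<in> T" "A x \<noteq> 0" for A x
  proof -
    obtain t where t: "t > 0" "\<And>x. x \<in> T \<Longrightarrow> A (A x) = rscale x (of_real (- t))"
      using V_neg[OF A x] by blast
    define s where "s = 1 / sqrt t"
    have s: "- (t * s * s) = - 1"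
      using t(1) by (simp add: s_def)
    define I where "I x = rscale (A x) (of_real s)" for x
    have "I (I x) = - x" if "x \<in> T" for x
    proof -
      have "I (I x) = rscale x (of_real (- (t * s * s)))"
        using that by (simp add: I_def rlinD[OF V_lin[OF A]] t(2) flip: rscale_mult)
      then show ?thesis
        unfolding s by (simp add: rscale_minus_one)
    qed
    moreover have "I \<in> V"
      unfolding I_def by (rule V_rscale[OF A])
    ultimately show ?thesis
      by (intro bexI[of _ I]) (auto simp: I_def)
  qed
  \<comment> \<open>If the anticommutator of \<open>B\<close> and \<open>I\<close> is s, then adding
    s/2 times \<open>I\<close> to \<open>B\<close> changes it by 2 (s/2) I I = - s.\<close>
  have orthogonalise: "\<exists>t. (\<lambda>x. B x + rscale (I x) (of_real t)) \<in> V \<and>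
      (\<forall>x\<in>T. B (I x) + rscale (I (I x)) (of_real t) = - I (B x + rscale (I x) (of_real t)))"
    if I: "I \<in> V" "\<And>x. x \<in> T \<Longrightarrow> I (I x) = - x" and B: "B \<in> V" for I B
  proof -
    note lin = rlinD[OF V_lin[OF I(1)]] rlinD[OF V_lin[OF B]] T rsubD[OF T]
    obtain s where s: "\<And>x. x \<in> T \<Longrightarrow> B (I x) + I (B x) = rscale x (of_real s)"
      using V2[OF B I(1)] unfolding scal_def by blast
    have half: "rscale x (of_real (s / 2)) + rscale x (of_real (s / 2)) = rscale x (of_real s)" for x
      by (metis field_sum_of_halves of_real_add rscale_add_right)
    have "B (I x) + rscale (I (I x)) (of_real (s / 2)) = - I (B x + rscale (I x) (of_real (s / 2)))"
      if "x \<in> T" for x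
    proof -
      have "B (I x) = rscale x (of_real s) - I (B x)"
        using s[OF that] by (simp add: algebra_simps)
      then show ?thesis
        using that half[of x] by (simp add: lin I(2) rscale_minus_left algebra_simps)
    qed
    then show ?thesis
      using V_add[OF B V_rscale[OF I(1)]] by blast
  qed
  \<comment> \<open>The cases are that \<open>V\<close> acts on \<open>T\<close> with real dimension
    zero, one, or at least two.\<close>
  consider "\<forall>A\<in>V. \<forall>x\<in>T. A x = 0"
    | (one) I where "I \<in> V" "\<And>x. x \<in> T \<Longrightarrow> I (I x) = - x"
        "\<forall>B\<in>V. \<exists>t. \<forall>x\<in>T. B x = rscale (I x) (of_real t)"
    | (two) I B where "I \<in> V" "\<And>x. x \<in> T \<Longrightarrow> I (I x) = - x"
        "B \<in> V" "\<And>t. \<exists>x\<in>T. B x \<noteq> rscale (I x) (of_real t)"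
    using normalise by metis
  then show ?thesis
  proof cases
    case 1
    show ?thesis
    proof (rule that[OF u])
      show "\<exists>c. A u = rscale u c" if "A \<in> V" for A
        using 1 u(1) that by (intro exI[of _ 0]) simp
    qed
  next
    case one
    obtain v where v: "v \<in> T" "v \<noteq> 0" "I v = rscale v quat_i"
      by (rule complex_structure_eigenvector[OF T u V_lin[OF one(1)] one(2)])
    show ?thesis
      using that[OF v(1,2)] one(3) v by (metis rscale_mult)
  next
    case two
    note I = two(1,2)
    obtain s where s: "(\<lambda>x. B x + rscale (I x) (of_real s)) \<in> V"
      "\<And>x. x \<in> T \<Longrightarrow> B (I x) + rscale (I (I x)) (of_real s) = - I (B x + rscale (I x) (of_real s))"
      using orthogonalise[OF I two(3)] by blast
    obtain x where x: "x \<in> T" "B x + rscale (I x) (of_real s) \<noteq> 0"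
      using two(4)[of "- s"] by (auto simp: rscale_minus_right eq_neg_iff_add_eq_0)
    obtain J r where J: "J \<in> V" "\<And>x. x \<in> T \<Longrightarrow> J (J x) = - x"
      and JB: "\<And>x. J x = rscale (B x + rscale (I x) (of_real s)) (of_real r)"
      using normalise[OF s(1) x] by blast
    note lin = rlinD[OF V_lin[OF I(1)]] rlinD[OF V_lin[OF J(1)]] T rsubD[OF T]
    have JI: "J (I x) = - I (J x)" if "x \<in> T" for x
    proof -
      have "B x + rscale (I x) (of_real s) \<in> T"
        using that rlinD(1)[OF V_lin[OF s(1)]] by blast
      then show ?thesis
        using that s(2) by (simp add: JB lin rscale_minus_left)
    qed
    obtain v where v: "v \<in> T" "v \<noteq> 0" "I v = rscale v quat_i" "J v = rscale v quat_j"
      by (rule quaternionic_structure_eigenvector[OF T u V_lin[OF I(1)] V_lin[OF J(1)] I(2) J(2) JI])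
    have "\<exists>c. C v = rscale v c" if C: "C \<in> V" for C
    proof -
      obtain t where t: "(\<lambda>x. C x + rscale (I x) (of_real t)) \<in> V"
        "\<And>x. x \<in> T \<Longrightarrow> C (I x) + rscale (I (I x)) (of_real t) = - I (C x + rscale (I x) (of_real t))"
        using orthogonalise[OF I C] by blast
      define D where "D = (\<lambda>x. C x + rscale (I x) (of_real t))"
      have D: "D \<in> V" and DI: "\<And>x. x \<in> T \<Longrightarrow> D (I x) = - I (D x)"
        using t by (simp_all add: D_def)
      obtain t' where t': "(\<lambda>x. D x + rscale (J x) (of_real t')) \<in> V"
        "\<And>x. x \<in> T \<Longrightarrow> D (J x) + rscale (J (J x)) (of_real t') = - J (D x + rscale (J x) (of_real t'))"
        using orthogonalise[OF J D] by blast
      \<comment> \<open>Adding a multiple of \<open>J\<close> preserves anticommutation with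
        \<open>I\<close>, because \<open>J\<close> itself anticommutes with
        \<open>I\<close>.\<close>
      define F where "F = (\<lambda>x. D x + rscale (J x) (of_real t'))"
      have F: "F \<in> V" and FJ: "\<And>x. x \<in> T \<Longrightarrow> F (J x) = - J (F x)"
        using t' by (simp_all add: F_def)
      have FT: "F v \<in> T"
        using v rlinD(1)[OF V_lin[OF F]] by blast
      have DT: "D v \<in> T"
        using v rlinD(1)[OF V_lin[OF D]] by blast
      have FI: "F (I v) = - I (F v)"
        using v(1) DT by (simp add: F_def DI lin JI rscale_minus_left del: v(3))
      obtain c where c: "I (J (F v)) - F (J (I v)) = rscale v (of_real c)"
        using V3[OF I(1) J(1) F] v(1) unfolding scal_def by blast
      have "J (F (I v)) = I (J (F v))"
        using FT by (simp add: FI JI lin)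
      then have "F (J (I v)) = - I (J (F v))"
        using FJ[OF rlinD(1)[OF V_lin[OF I(1)] v(1)]] by simp
      with c have "I (J (F v)) + I (J (F v)) = rscale v (of_real c)"
        by simp
      \<comment> \<open>The composite J I inverts I J, so applying it isolates
        \<open>F v\<close>.\<close>
      then have "J (I (I (J (F v)) + I (J (F v)))) = J (I (rscale v (of_real c)))"
        by simp
      then have "F v + F v = rscale v (quat_j * (quat_i * of_real c))"
        using v FT by (simp add: lin I(2) J(2) of_real_quat_commute flip: rscale_mult)
      then have "rscale (F v) 2 = rscale v (quat_j * (quat_i * of_real c))"
        using rscale_add_right[of "F v" 1 1] by (simp add: rscale_one)
      then have "rscale (rscale (F v) 2) (inverse 2) = rscale v (quat_j * (quat_i * of_real c) * inverse 2)"
        by (simp only: rscale_mult)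
      then have Fv: "F v = rscale v (quat_j * (quat_i * of_real c) * inverse 2)"
        by (metis right_inverse rscale_mult rscale_one zero_neq_numeral)
      have "C v = F v - rscale (J v) (of_real t') - rscale (I v) (of_real t)"
        by (simp add: F_def D_def)
      also have "\<dots> = rscale v (quat_j * (quat_i * of_real c) * inverse 2 - quat_j * of_real t' - quat_i * of_real t)"
        unfolding Fv v by (simp add: rscale_diff_right rscale_mult)
      finally show ?thesis
        by blast
    qed
    then show ?thesis
      using that[OF v(1,2)] by blast
  qed
qed

end

section \<open>Simultaneous diagonalisation\<close>

context right_quat_semi_inner_space
begin

text \<open>Real combinations only: these preserve both right-linearity and skewness.\<close>

inductive_set op_span :: "('h \<Rightarrow> 'h) set \<Rightarrow> ('h \<Rightarrow> 'h) set" for G where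
  base: "A \<in> G \<Longrightarrow> A \<in> op_span G"
| add: "A \<in> op_span G \<Longrightarrow> B \<in> op_span G \<Longrightarrow> (\<lambda>x. A x + B x) \<in> op_span G"
| rscale_real: "A \<in> op_span G \<Longrightarrow> (\<lambda>x. rscale (A x) (of_real t)) \<in> op_span G"

lemma op_span_rlin:
  assumes "A \<in> op_span G" "rsub T" "\<And>A. A \<in> G \<Longrightarrow> rlin T A"
  shows "rlin T A"
  using assms by (induction rule: op_span.induct) (auto intro: rlin_add rlin_rscale_real)

lemma op_span_skew:
  assumes "A \<in> op_span G" "x \<in> T" "z \<in> T"
    and "\<And>A. A \<in> G \<Longrightarrow> ip (A x) z = - ip x (A z)"
  shows "ip (A x) z = - ip x (A z)"
  using assms
  by (induction rule: op_span.induct)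
    (auto simp: ip_add_left ip_add_right ip_rscale_left ip_rscale_right of_real_quat_commute)

text \<open>Here \<open>\<Psi>\<close> is a relation with all operators but one held fixed,
  depending real-linearly on the remaining one. The pair and triple relations reach the span by one
  application per argument.\<close>

lemma op_span_scal:
  assumes "A \<in> op_span G" "\<And>A. A \<in> G \<Longrightarrow> scal T (\<Psi> A)"
    and "\<And>A B x. A \<in> op_span G \<Longrightarrow> B \<in> op_span G \<Longrightarrow> x \<in> T \<Longrightarrow> \<Psi> (\<lambda>x. A x + B x) x = \<Psi> A x + \<Psi> B x"
    and "\<And>A t x. A \<in> op_span G \<Longrightarrow> x \<in> T \<Longrightarrow>
      \<Psi> (\<lambda>x. rscale (A x) (of_real t)) x = rscale (\<Psi> A x) (of_real t)"
  shows "scal T (\<Psi> A)"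
  using assms(1)
proof (induction rule: op_span.induct)
  case (base A)
  then show ?case
    by (rule assms(2))
next
  case (add A B)
  have "scal T (\<Psi> (\<lambda>x. A x + B x)) \<longleftrightarrow> scal T (\<lambda>x. \<Psi> A x + \<Psi> B x)"
    by (intro scal_cong assms(3) add.hyps)
  then show ?case
    using scal_add[OF add.IH] by simp
next
  case (rscale_real A t)
  have "scal T (\<Psi> (\<lambda>x. rscale (A x) (of_real t))) \<longleftrightarrow> scal T (\<lambda>x. rscale (\<Psi> A x) (of_real t))"
    by (intro scal_cong assms(4) rscale_real.hyps)
  then show ?case
    using scal_rscale[OF rscale_real.IH] by simp
qed

lemma op_span_pairs_scal:
  assumes T: "rsub T" and G: "\<And>A. A \<in> G \<Longrightarrow> rlin T A"
    and GG: "\<And>A B. A \<in> G \<Longrightarrow> B \<in> G \<Longrightarrow> scal T (\<lambda>x. A (B x) + B (A x))"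
    and A: "A \<in> op_span G" and B: "B \<in> op_span G"
  shows "scal T (\<lambda>x. A (B x) + B (A x))"
proof -
  have "rlin T A" if "A \<in> op_span G" for A
    using op_span_rlin[OF that T G] .
  note lin = rlinD[OF this]
  have 1: "scal T (\<lambda>x. A (B x) + B (A x))" if "A \<in> G" "B \<in> op_span G" for A B
    by (rule op_span_scal[OF that(2), of T "\<lambda>B x. A (B x) + B (A x)"])
      (use that in \<open>auto simp: GG lin op_span.base rscale_add_left algebra_simps\<close>)
  show ?thesis
    by (rule op_span_scal[OF A, of T "\<lambda>A x. A (B x) + B (A x)"])
      (use 1 B in \<open>auto simp: lin rsubD[OF T] rscale_add_left algebra_simps\<close>)
qed

lemma op_span_triples_scal:
  assumes T: "rsub T" and G: "\<And>A. A \<in> G \<Longrightarrow> rlin T A"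
    and GG: "\<And>A B C. A \<in> G \<Longrightarrow> B \<in> G \<Longrightarrow> C \<in> G \<Longrightarrow> scal T (\<lambda>x. A (B (C x)) - C (B (A x)))"
    and A: "A \<in> op_span G" and B: "B \<in> op_span G" and C: "C \<in> op_span G"
  shows "scal T (\<lambda>x. A (B (C x)) - C (B (A x)))"
proof -
  have "rlin T A" if "A \<in> op_span G" for A
    using op_span_rlin[OF that T G] .
  note lin = rlinD[OF this]
  have 1: "scal T (\<lambda>x. A (B (C x)) - C (B (A x)))" if "A \<in> G" "B \<in> G" "C \<in> op_span G" for A B C
    by (rule op_span_scal[OF that(3), of T "\<lambda>C x. A (B (C x)) - C (B (A x))"])
      (use that in \<open>auto simp: GG lin op_span.base rscale_diff_left algebra_simps\<close>)
  have 2: "scal T (\<lambda>x. A (B (C x)) - C (B (A x)))" if "A \<in> G" "B \<in> op_span G" "C \<in> op_span G" for A B C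
    by (rule op_span_scal[OF that(2), of T "\<lambda>B x. A (B (C x)) - C (B (A x))"])
      (use that 1 in \<open>auto simp: lin rsubD[OF T] op_span.base rscale_diff_left algebra_simps\<close>)
  show ?thesis
    by (rule op_span_scal[OF A, of T "\<lambda>A x. A (B (C x)) - C (B (A x))"])
      (use 2 B C in \<open>auto simp: lin rsubD[OF T] rscale_diff_left algebra_simps\<close>)
qed

end

context right_quat_fin_dim
begin

text \<open>Schur's lemma. The eigenspace of a real eigenvalue is a right subspace, and it is
  invariant because \<open>A\<close> commutes with every \<open>X a\<close>; irreducibility makes it
  all of \<open>T\<close>.\<close>

lemma irreducible_selfadjoint_scal:
  assumes T: "rsub T" "T \<subseteq> S" "x0 \<in> T" "x0 \<noteq> 0"
    and A: "rlin T A" and sa: "\<And>x z. x \<in> T \<Longrightarrow> z \<in> T \<Longrightarrow> ip (A x) z = ip x (A z)"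
    and X: "\<And>a. rlin T (X a)" and comm: "\<And>a x. x \<in> T \<Longrightarrow> A (X a x) = X a (A x)"
    and irred: "\<And>T'. rsub T' \<Longrightarrow> T' \<subseteq> T \<Longrightarrow> \<exists>x\<in>T'. x \<noteq> 0 \<Longrightarrow> (\<And>a x. x \<in> T' \<Longrightarrow> X a x \<in> T') \<Longrightarrow> T' = T"
  shows "scal T A"
proof -
  obtain t v where v: "v \<in> T" "v \<noteq> 0" "A v = rscale v (of_real t)"
    using selfadjoint_eigenvector[OF T A sa] .
  define T' where "T' = {x \<in> T. A x = rscale x (of_real t)}"
  have "T' = T"
  proof (rule irred)
    show "rsub T'"
      unfolding rsub_def
      by (auto simp: T'_def rsubD[OF T(1)] rlinD[OF A] T(1) rscale_add_left of_real_quat_commute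
          simp flip: rscale_mult)
    show "X a x \<in> T'" if "x \<in> T'" for a x
      using that by (auto simp: T'_def comm rlinD[OF X])
  qed (use v in \<open>auto simp: T'_def\<close>)
  then show ?thesis
    by (auto simp: scal_def T'_def)
qed

text \<open>For skew operators the adjoint of A B is B A, and that of A B C is - C B A. So both
  Clifford expressions have the form Z + Z*, which expands into the operators \<open>W w\<close>
  with \<open>w\<close> of length 2 or 3.\<close>

lemma joint_eigenvector:
  fixes X :: "'a \<Rightarrow> 'h \<Rightarrow> 'h"
  assumes st: "\<And>a. st (st a) = a" and X_lin: "\<And>a. rlin S (X a)"
    and X_adj: "\<And>a x z. x \<in> S \<Longrightarrow> z \<in> S \<Longrightarrow> ip (X (st a) x) z = ip x (X a z)"
    and central: "\<And>w b x. length w \<le> 3 \<Longrightarrow> x \<in> S \<Longrightarrow>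
      foldr X w (X b x) + foldr X (rev (map st w)) (X b x) =
      X b (foldr X w x) + X b (foldr X (rev (map st w)) x)"
    and T0: "rsub T0" "T0 \<subseteq> S" "x0 \<in> T0" "x0 \<noteq> 0" "\<And>a x. x \<in> T0 \<Longrightarrow> X a x \<in> T0"
  obtains v where "v \<in> T0" "v \<noteq> 0" "\<And>a. \<exists>c. X a v = rscale v c"
proof -
  define P where "P T \<longleftrightarrow> rsub T \<and> T \<subseteq> S \<and> (\<exists>x\<in>T. x \<noteq> 0) \<and> (\<forall>a. \<forall>x\<in>T. X a x \<in> T)" for T
  have P0: "P T0"
    using T0 by (auto simp: P_def)
  have P_sub: "rsub T \<and> T \<subseteq> S" if "P T" for T
    using that by (simp add: P_def)
  obtain T where T: "P T" "T \<subseteq> T0" "\<And>T'. P T' \<Longrightarrow> T' \<subseteq> T \<Longrightarrow> T' = T"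
    by (rule minimal_subspace[where P = P, OF P0 P_sub that])
  have subT: "rsub T" "T \<subseteq> S"
    using T(1) by (auto simp: P_def)
  obtain u where u: "u \<in> T" "u \<noteq> 0"
    using T(1) by (auto simp: P_def)
  have XT: "rlin T (X a)" for a
    using T(1) by (intro rlin_subset[OF X_lin]) (auto simp: P_def)
  note lin = rlinD[OF XT] rsubD[OF subT(1)] subT(1)
  have adj: "ip (X a x) z = ip x (X (st a) z)" if "x \<in> T" "z \<in> T" for a x z
    using X_adj[of x z "st a"] that subT(2) by (auto simp: st)
  have adj_foldr: "ip (foldr X w x) z = ip x (foldr X (rev (map st w)) z)"
    if "x \<in> T" "z \<in> T" for w x z
    using that
    by (induction w arbitrary: z) (auto simp: adj lin rlinD(1)[OF rlin_foldr[OF XT]])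
  define W where "W w x = foldr X w x + foldr X (rev (map st w)) x" for w x
  have W_scal: "scal T (W w)" if "length w \<le> 3" for w
  proof (rule irreducible_selfadjoint_scal[OF subT u, of _ X])
    have W_lin: "rlin T (W w)"
      unfolding W_def by (intro rlin_add rlin_foldr XT subT(1))
    then show "rlin T (W w)" .
    show "ip (W w x) z = ip x (W w z)" if "x \<in> T" "z \<in> T" for x z
    proof -
      have "ip (foldr X (rev (map st w)) x) z = qcnj (ip z (foldr X (rev (map st w)) x))"
        by (rule ip_commute)
      also have "\<dots> = qcnj (ip (foldr X w z) x)"
        by (simp add: adj_foldr[OF that(2,1)])
      also have "\<dots> = ip x (foldr X w z)"
        by (rule ip_commute[symmetric])
      finally show ?thesis
        by (simp add: W_def ip_add_left ip_add_right adj_foldr[OF that])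
    qed
    show "W w (X a x) = X a (W w x)" if "x \<in> T" for a x
    proof -
      have "foldr X v x \<in> T" for v
        by (rule rlinD(1)[OF rlin_foldr[OF XT] that])
      then show ?thesis
        unfolding W_def
        using central[OF \<open>length w \<le> 3\<close> subsetD[OF subT(2) that], of a] rlinD(2)[OF XT]
        by metis
    qed
  qed (use XT T(3) subT in \<open>auto simp: P_def\<close>)
  define Y where "Y a x = X a x - X (st a) x" for a x
  define G where "G = range Y"
  have G_lin: "rlin T A" if "A \<in> G" for A
    using that unfolding G_def Y_def by (auto intro!: rlin_diff XT subT)
  have pair: "scal T (\<lambda>x. A (B x) + B (A x))" if AB: "A \<in> G" "B \<in> G" for A B
  proof -
    obtain a b where "A = Y a" "B = Y b"
      using AB by (auto simp: G_def)
    then have "x \<in> T \<Longrightarrow> A (B x) + B (A x) =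
        W [a, b] x - W [a, st b] x - W [st a, b] x + W [st a, st b] x" for x
      by (simp add: W_def Y_def lin st algebra_simps)
    then show ?thesis
      by (subst scal_cong) (auto intro!: scal_add scal_diff W_scal)
  qed
  have triple: "scal T (\<lambda>x. A (B (C x)) - C (B (A x)))" if AB: "A \<in> G" "B \<in> G" "C \<in> G" for A B C
  proof -
    obtain a b c where "A = Y a" "B = Y b" "C = Y c"
      using AB by (auto simp: G_def)
    then have "x \<in> T \<Longrightarrow> A (B (C x)) - C (B (A x)) =
        (W [a, b, c] x - W [a, b, st c] x - W [a, st b, c] x + W [a, st b, st c] x) -
        (W [st a, b, c] x - W [st a, b, st c] x - W [st a, st b, c] x + W [st a, st b, st c] x)" for x
      by (simp add: W_def Y_def lin st algebra_simps)
    then show ?thesis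
      by (subst scal_cong) (auto intro!: scal_add scal_diff W_scal)
  qed
  have V_lin: "rlin T A" if "A \<in> op_span G" for A
    using op_span_rlin[OF that subT(1) G_lin] .
  have V2: "scal T (\<lambda>x. A (B x) + B (A x))" if "A \<in> op_span G" "B \<in> op_span G" for A B
    using op_span_pairs_scal[where G = G, OF subT(1) G_lin pair that] .
  have V3: "scal T (\<lambda>x. A (B (C x)) - C (B (A x)))"
    if "A \<in> op_span G" "B \<in> op_span G" "C \<in> op_span G" for A B C
    using op_span_triples_scal[where G = G, OF subT(1) G_lin triple that] .
  have V_neg: "\<exists>t>0. \<forall>x\<in>T. A (A x) = rscale x (of_real (- t))"
    if A: "A \<in> op_span G" and x: "x \<in> T" "A x \<noteq> 0" for A x
  proof -
    have linA: "rlin T A"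
      by (rule V_lin[OF A])
    obtain s where s: "\<And>x. x \<in> T \<Longrightarrow> A (A x) + A (A x) = rscale x (of_real s)"
      using V2[OF A A] by (auto simp: scal_def)
    have AA: "A (A x) = rscale x (of_real (- (- s / 2)))" if "x \<in> T" for x
    proof -
      have "rscale (A (A x)) 2 = rscale x (of_real s)"
        using s[OF that] rscale_add_right[of "A (A x)" 1 1] by (simp add: rscale_one)
      then have "rscale (rscale (A (A x)) 2) (inverse 2) = rscale x (of_real s * inverse 2)"
        by (simp only: rscale_mult)
      also have "rscale (rscale (A (A x)) 2) (inverse 2) = A (A x)"
        by (metis right_inverse rscale_mult rscale_one zero_neq_numeral)
      also have "of_real s * inverse 2 = (of_real (s * inverse 2) :: quat)"
        by (simp only: of_real_mult of_real_inverse of_real_numeral)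
      also have "s * inverse 2 = - (- s / 2)"
        by simp
      finally show ?thesis .
    qed
    \<comment> \<open>Skewness decides the sign of the real square of \<open>A\<close>: the square
      norm of \<open>A x\<close> is -s/2 times that of \<open>x\<close>.\<close>
    have "ip (A x) (A x) = - ip x (A (A x))"
    proof (rule op_span_skew[OF A, of _ T])
      show "ip (B x) (A x) = - ip x (B (A x))" if "B \<in> G" for B
        using that x rlinD(1)[OF linA] by (auto simp: G_def Y_def ip_diff_left ip_diff_right adj st lin)
    qed (use x rlinD(1)[OF linA] in auto)
    then have "qre (ip (A x) (A x)) = - s / 2 * qre (ip x x)"
      using AA[OF x(1)] by (simp add: ip_rscale_right quat_times_sel del: of_real_minus of_real_divide)
    moreover have "0 < qre (ip (A x) (A x))"
      using ip_pos definite x rlinD(1)[OF linA] subT(2) by blast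
    ultimately have "0 < - s / 2 * qre (ip x x)"
      by simp
    then have "0 < - s / 2"
      using ip_self(2)[of x] by (simp only: zero_less_mult_iff) linarith
    then show ?thesis
      using AA by blast
  qed
  obtain v where v: "v \<in> T" "v \<noteq> 0" and ev: "\<And>A. A \<in> op_span G \<Longrightarrow> \<exists>c. A v = rscale v c"
    by (rule clifford_common_eigenvector[where V = "op_span G", OF subT(1) u V_lin op_span.add
          op_span.rscale_real V2 V3 V_neg that])
  have "\<exists>c. X a v = rscale v c" for a
  proof -
    obtain c where c: "Y a v = rscale v c"
      using ev[of "Y a"] by (auto simp: G_def intro: op_span.base)
    obtain s where "W [a] v = rscale v (of_real s)"
      using W_scal[of "[a]"] v by (auto simp: scal_def)
    \<comment> \<open>The symmetric part \<open>W [a]\<close> and the skew part \<open>Y a\<close>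
      add up to twice \<open>X a\<close>.\<close>
    with c have "X a v + X a v = rscale v (of_real s + c)"
      by (simp add: W_def Y_def rscale_add_right algebra_simps)
    then have "rscale (X a v) 2 = rscale v (of_real s + c)"
      using rscale_add_right[of "X a v" 1 1] by (simp add: rscale_one)
    then have "rscale (rscale (X a v) 2) (inverse 2) = rscale v ((of_real s + c) * inverse 2)"
      by (simp only: rscale_mult)
    then show ?thesis
      by (metis right_inverse rscale_mult rscale_one zero_neq_numeral)
  qed
  then show ?thesis
    using that v T(2) by blast
qed

text \<open>The complement of a largest orthonormal family of joint eigenvectors is invariant,
  because the operators are closed under adjoints and all of them preserve each eigenline. A nonzero
  complement would contain one more joint eigenvector.\<close>

theorem simultaneous_diagonalisation:
  fixes X :: "'a \<Rightarrow> 'h \<Rightarrow> 'h"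
  assumes st: "\<And>a. st (st a) = a" and X_lin: "\<And>a. rlin S (X a)"
    and X_adj: "\<And>a x z. x \<in> S \<Longrightarrow> z \<in> S \<Longrightarrow> ip (X (st a) x) z = ip x (X a z)"
    and central: "\<And>w b x. length w \<le> 3 \<Longrightarrow> x \<in> S \<Longrightarrow>
      foldr X w (X b x) + foldr X (rev (map st w)) (X b x) =
      X b (foldr X w x) + X b (foldr X (rev (map st w)) x)"
  obtains E where "onb S E" "\<And>a e. e \<in> E \<Longrightarrow> \<exists>c. X a e = rscale e c"
proof -
  obtain E where E: "finite E" "E \<subseteq> S" "orthonormal E" "\<forall>e\<in>E. \<forall>a. \<exists>c. X a e = rscale e c"
    "\<And>E'. finite E' \<Longrightarrow> E' \<subseteq> S \<Longrightarrow> orthonormal E' \<Longrightarrow>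
      \<forall>e\<in>E'. \<forall>a. \<exists>c. X a e = rscale e c \<Longrightarrow> card E' \<le> card E"
    by (rule ex_maximal_orthonormal[of "\<lambda>E. \<forall>e\<in>E. \<forall>a. \<exists>c. X a e = rscale e c"]) auto
  define T where "T = {x \<in> S. \<forall>e\<in>E. ip e x = 0}"
  have T: "rsub T" "T \<subseteq> S"
    by (auto simp: rsub_def T_def rsubD[OF sub] ip_add_right ip_rscale_right)
  have T_inv: "X a x \<in> T" if "x \<in> T" for a x
  proof -
    have "ip e (X a x) = 0" if e: "e \<in> E" for e
    proof -
      obtain c where "X (st a) e = rscale e c"
        using E(4) e by blast
      moreover have "ip e x = 0" "e \<in> S" "x \<in> S"
        using e \<open>x \<in> T\<close> E(2) by (auto simp: T_def)
      ultimately show ?thesis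
        using X_adj[of e x a] by (simp add: ip_rscale_left)
    qed
    then show ?thesis
      using that rlinD(1)[OF X_lin] by (simp add: T_def)
  qed
  have T0: "x = 0" if "x \<in> T" for x
  proof (rule ccontr)
    assume "x \<noteq> 0"
    obtain v where v: "v \<in> T" "v \<noteq> 0" "\<And>a. \<exists>c. X a v = rscale v c"
      by (rule joint_eigenvector[OF st X_lin X_adj central T \<open>x \<in> T\<close> \<open>x \<noteq> 0\<close> T_inv that])
    obtain t where t: "t \<noteq> 0" "ip (rscale v (of_real t)) (rscale v (of_real t)) = 1"
      using ex_normalised[of v] v T by auto
    define e where "e = rscale v (of_real t)"
    have "e \<in> T"
      using v rsubD(3)[OF T(1)] by (simp add: e_def)
    have e: "orthonormal (insert e E)" "e \<notin> E"
      using orthonormal_insert[OF E(3), of e] t \<open>e \<in> T\<close> by (auto simp: e_def T_def)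
    \<comment> \<open>The normalising factor is real, so it moves past the eigenvalue without
      conjugating it.\<close>
    have "\<exists>c. X a e = rscale e c" for a
    proof -
      obtain c where "X a v = rscale v c"
        using v(3) by blast
      then have "X a e = rscale v (c * of_real t)"
        using v(1) T(2) rlinD(3)[OF X_lin] by (auto simp: e_def rscale_mult)
      also have "\<dots> = rscale e c"
        by (simp add: e_def of_real_quat_commute flip: rscale_mult)
      finally show ?thesis
        by blast
    qed
    then have "card (insert e E) \<le> card E"
      using E e \<open>e \<in> T\<close> T(2) by (intro E(5)) auto
    then show False
      using e E(1) by simp
  qed
  have "x = (\<Sum>e\<in>E. rscale e (ip e x))" if "x \<in> S" for x
  proof -
    have "x - (\<Sum>e\<in>E. rscale e (ip e x)) \<in> T"
      using that E(2)
      by (auto simp: T_def ip_diff_right ip_orthonormal_sum[OF E(3,1)] intro!: rsubD(3,5)[OF sub] rsub_sum[OF sub])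
    then show ?thesis
      using T0 by force
  qed
  then show ?thesis
    using that[of E] E by (auto simp: onb_def)
qed

end

section \<open>Words, moments and evaluation\<close>

lemma lstar_lstar [simp]: "lstar (lstar a) = a"
  by (cases a) auto

lemma letters_simps [simp]:
  "letters 0 = []" "letters (u + v) = letters u @ letters v"
  by (simp_all add: zero_qword_def plus_qword_def)

lemma letters_wstar [simp]: "letters (wstar w) = rev (map lstar (letters w))"
  by (simp add: wstar_def)

lemma wlen_simps [simp]:
  "wlen 0 = 0" "wlen (u + v) = wlen u + wlen v" "wlen (wstar w) = wlen w" "wlen (QWord xs) = length xs"
  by (simp_all add: wlen_def)

lemma qword_eqI: "letters u = letters v \<Longrightarrow> u = v"
  by (cases u; cases v) simp

lemma wstar_simps [simp]:
  "wstar 0 = 0" "wstar (u + v) = wstar v + wstar u" "wstar (wstar w) = w"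
  by (auto intro!: qword_eqI simp: rev_map o_def)

lemma QWord_append: "QWord (xs @ ys) = QWord xs + QWord ys"
  by (rule qword_eqI) simp

lemma QWord_Nil: "QWord [] = 0"
  by (simp add: zero_qword_def)

lemma mem_words_iff [simp]: "w \<in> words t \<longleftrightarrow> wlen w \<le> t"
  by (simp add: words_def)

lemma finite_words: "finite (words t :: 'n::finite qword set)"
proof -
  have "(UNIV :: 'n letter set) = range Q \<union> range Qbar"
    by (auto simp: image_iff) (metis letter.exhaust)
  then have "finite (UNIV :: 'n letter set)"
    by (metis finite finite_UnI finite_imageI)
  then have "finite {xs :: 'n letter list. set xs \<subseteq> UNIV \<and> length xs \<le> t}"
    by (rule finite_lists_length_le)
  moreover have "words t = QWord ` {xs :: 'n letter list. set xs \<subseteq> UNIV \<and> length xs \<le> t}"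
    by (auto simp: image_iff intro: qword.exhaust) (metis qword.exhaust wlen_simps(4))
  ultimately show ?thesis
    by simp
qed

section \<open>The moment functional and degrees\<close>

lemma ncpoly_sum_single: "p = (\<Sum>w\<in>Poly_Mapping.keys p. Poly_Mapping.single w (Poly_Mapping.lookup p w))"
  by (rule poly_mapping_eqI) (simp add: lookup_sum lookup_single when_def in_keys_iff)

lemma L_zero [simp]: "L y 0 = 0"
  by (simp add: L_def)

lemma L_add: "L y (p + q) = L y p + L y q"
  unfolding L_def by (rule setsum_keys_plus_distrib) (auto simp: scaleR_add_left)

lemma L_sum: "L y (sum f A) = (\<Sum>a\<in>A. L y (f a))"
  by (induction A rule: infinite_finite_induct) (auto simp: L_add)

lemma L_diff: "L y (p - q) = L y p - L y q"
  using L_add[of y "p - q" q] by simp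

lemma L_single [simp]: "L y (Poly_Mapping.single w c) = c *\<^sub>R y w"
  by (simp add: L_def)

lemma L_sandwich:
  "L y (mono_of u * p * mono_of v) =
    (\<Sum>w\<in>Poly_Mapping.keys p. Poly_Mapping.lookup p w *\<^sub>R y (u + w + v))"
proof -
  have "mono_of u * p * mono_of v =
      (\<Sum>w\<in>Poly_Mapping.keys p. Poly_Mapping.single (u + w + v) (Poly_Mapping.lookup p w))"
    by (subst ncpoly_sum_single[of p])
      (simp add: mono_of_def sum_distrib_left sum_distrib_right mult_single)
  then show ?thesis
    by (simp add: L_sum)
qed

lemma mono_of_mult: "mono_of u * mono_of v = mono_of (u + v)"
  by (simp add: mono_of_def mult_single)

lemma L_mono_of [simp]: "L y (mono_of w) = y w"
  by (simp add: mono_of_def)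

lemma L_commutator_sandwich:
  "L y (mono_of u * commutator (mono_of w + mono_of w') (mono_of b) * mono_of v) =
    y (u + w + b + v) + y (u + w' + b + v) - (y (u + b + w + v) + y (u + b + w' + v))"
  by (simp add: commutator_def algebra_simps mono_of_mult L_add L_diff)

lemma moment_matrix_eq: "moment_matrix y u v = y (wstar u + v)"
  by (simp add: moment_matrix_def mono_of_mult)

lemma wlen_le_ncdeg: "w \<in> Poly_Mapping.keys p \<Longrightarrow> wlen w \<le> ncdeg p"
  unfolding ncdeg_def by (intro Max_ge) auto

lemma ncdeg_le_half_deg: "ncdeg p \<le> 2 * half_deg p"
  unfolding half_deg_def by linarith

lemma half_deg_le_flatness_gap:
  "g \<in> set gs \<Longrightarrow> half_deg g \<le> flatness_gap gs hs" "h \<in> set hs \<Longrightarrow> half_deg h \<le> flatness_gap gs hs"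
  "1 \<le> flatness_gap gs hs"
  unfolding flatness_gap_def by (auto intro!: Max_ge)

section \<open>Evaluation at quaternionic points\<close>

lemma eval_word_simps [simp]:
  "eval_word a 0 = 1" "eval_word a (u + v) = eval_word a u * eval_word a v"
  by (simp_all add: eval_word_def)

lemma eval_letter_lstar [simp]: "eval_letter a (lstar l) = qcnj (eval_letter a l)"
  by (cases l) auto

lemma eval_word_wstar [simp]: "eval_word a (wstar w) = qcnj (eval_word a w)"
proof -
  have "prod_list (map (eval_letter a) (rev (map lstar xs))) =
      qcnj (prod_list (map (eval_letter a) xs))" for xs
    by (induction xs) (auto simp: qcnj_mult)
  then show ?thesis
    by (simp add: eval_word_def)
qed

lemma eval_nc_eq_L: "eval_nc a p = L (eval_word a) p"
  by (simp add: eval_nc_def L_def)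

lemma of_real_quat_left_commute: "(x::quat) * (of_real t * z) = of_real t * (x * z)"
  by (simp add: of_real_def)

text \<open>The squared moduli are real and hence central, so the value does not depend on where the
  cancelled pairs stood in the word. This gives the normal form constraint for Dirac
  moments.\<close>

definition nf_value :: "quat ^ 'n \<Rightarrow> ('n::finite \<Rightarrow> nat) \<times> 'n letter list \<Rightarrow> quat" where
  "nf_value a x = of_real (\<Prod>i\<in>UNIV. (norm (a $ i)) ^ (2 * fst x i)) * prod_list (map (eval_letter a) (snd x))"

lemma norm_eval_letter [simp]: "norm (eval_letter a l) = norm (a $ idx l)"
  by (cases l) auto

lemma nf_value_cons: "nf_value a (nf_cons l x) = eval_letter a l * nf_value a x"
proof -
  obtain \<alpha> w where x: "x = (\<alpha>, w)"
    by fastforce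
  show ?thesis
  proof (cases "\<exists>w'. w = lstar l # w'")
    case True
    then obtain w' where w: "w = lstar l # w'"
      by blast
    define \<beta> where "\<beta> = (\<alpha>(idx l := Suc (\<alpha> (idx l))))"
    have "(\<Prod>i\<in>UNIV. (norm (a $ i)) ^ (2 * \<beta> i)) =
        (norm (a $ idx l)) ^ (2 * \<beta> (idx l)) * (\<Prod>i\<in>UNIV - {idx l}. (norm (a $ i)) ^ (2 * \<beta> i))"
      by (rule prod.remove) auto
    also have "(\<Prod>i\<in>UNIV - {idx l}. (norm (a $ i)) ^ (2 * \<beta> i)) =
        (\<Prod>i\<in>UNIV - {idx l}. (norm (a $ i)) ^ (2 * \<alpha> i))"
      by (intro prod.cong) (auto simp: \<beta>_def)
    also have "(norm (a $ idx l)) ^ (2 * \<beta> (idx l)) * (\<Prod>i\<in>UNIV - {idx l}. (norm (a $ i)) ^ (2 * \<alpha> i)) =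
       (norm (a $ idx l))\<^sup>2 *
       ((norm (a $ idx l)) ^ (2 * \<alpha> (idx l)) * (\<Prod>i\<in>UNIV - {idx l}. (norm (a $ i)) ^ (2 * \<alpha> i)))"
      by (simp add: \<beta>_def power_add power2_eq_square)
    also have "(norm (a $ idx l)) ^ (2 * \<alpha> (idx l)) * (\<Prod>i\<in>UNIV - {idx l}. (norm (a $ i)) ^ (2 * \<alpha> i)) =
        (\<Prod>i\<in>UNIV. (norm (a $ i)) ^ (2 * \<alpha> i))"
      by (rule prod.remove[symmetric]) auto
    finally have p: "(\<Prod>i\<in>UNIV. (norm (a $ i)) ^ (2 * \<beta> i)) =
        (norm (a $ idx l))\<^sup>2 * (\<Prod>i\<in>UNIV. (norm (a $ i)) ^ (2 * \<alpha> i))" .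
    have "nf_value a (nf_cons l x) = nf_value a (\<beta>, w')"
      by (simp add: x w \<beta>_def)
    also have "\<dots> = of_real ((norm (a $ idx l))\<^sup>2) * of_real (\<Prod>i\<in>UNIV. (norm (a $ i)) ^ (2 * \<alpha> i)) *
        prod_list (map (eval_letter a) w')"
      by (simp only: nf_value_def p fst_conv snd_conv of_real_mult)
    also have "of_real ((norm (a $ idx l))\<^sup>2) = eval_letter a l * qcnj (eval_letter a l)"
      by (simp add: mult_qcnj_self)
    finally show ?thesis
      by (simp only: nf_value_def x w fst_conv snd_conv list.map prod_list.Cons eval_letter_lstar)
        (simp only: mult.assoc of_real_quat_left_commute)
  next
    case False
    then have "nf_cons l x = (\<alpha>, l # w)"
      by (cases w) (auto simp: x)
    then show ?thesis
      by (simp only: nf_value_def x fst_conv snd_conv list.map prod_list.Cons)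
        (simp only: mult.assoc of_real_quat_left_commute)
  qed
qed

lemma eval_word_normal_form: "eval_word a w = nf_value a (normal_form w)"
proof -
  have "prod_list (map (eval_letter a) xs) = nf_value a (foldr nf_cons xs (\<lambda>_. 0, []))" for xs
    by (induction xs) (simp_all add: nf_value_cons, simp add: nf_value_def)
  then show ?thesis
    by (simp add: eval_word_def normal_form_def)
qed

lemma qnonneg_qcnj_mult_real:
  assumes "0 \<le> t"
  shows "qnonneg (qcnj x * of_real t * x)"
proof -
  have "qcnj x * of_real t * x = of_real (t * (norm x)\<^sup>2)"
    by (simp only: mult.assoc of_real_quat_left_commute qcnj_mult_self of_real_mult)
  then show ?thesis
    using assms unfolding qnonneg_def by (intro exI[of _ "t * (norm x)\<^sup>2"]) simp
qed

text \<open>With \<open>z\<close> the evaluation of words, this is the moment matrix of a Dirac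
  measure for \<open>t\<close> = 1, and a localizing matrix for \<open>t\<close> the value of the
  constraint polynomial.\<close>

lemma qpsd_rank_one:
  assumes "0 \<le> t"
  shows "qpsd I (\<lambda>u v. qcnj (z u) * of_real t * z v)"
  unfolding qpsd_def
proof (intro conjI allI ballI)
  show "qcnj (z u) * of_real t * z v = qcnj (qcnj (z v) * of_real t * z u)" for u v
    by (simp add: qcnj_mult mult.assoc)
  fix x
  have "(\<Sum>u\<in>I. \<Sum>v\<in>I. qcnj (x u) * (qcnj (z u) * of_real t * z v) * x v)
      = qcnj (\<Sum>u\<in>I. z u * x u) * of_real t * (\<Sum>v\<in>I. z v * x v)"
    by (simp add: qcnj_sum sum_distrib_left sum_distrib_right qcnj_mult mult.assoc)
      (rule sum.swap)
  then show "qnonneg (\<Sum>u\<in>I. \<Sum>v\<in>I. qcnj (x u) * (qcnj (z u) * of_real t * z v) * x v)"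
    using qnonneg_qcnj_mult_real[OF assms] by simp
qed

lemma L_eval_sandwich:
  "L (eval_word a) (mono_of u * p * mono_of v) = eval_word a u * eval_nc a p * eval_word a v"
  by (simp add: L_sandwich eval_nc_def sum_distrib_left sum_distrib_right)

text \<open>The value of w + w* is twice a real part and therefore central. This yields the
  commutator constraints for Dirac moments and also places these commutators in the vanishing
  ideal.\<close>

lemma eval_nc_commutator:
  "eval_nc a (commutator (mono_of w + mono_of (wstar w)) p) = 0"
proof -
  have mult: "eval_nc a (mono_of u * q) = eval_word a u * eval_nc a q"
    "eval_nc a (q * mono_of u) = eval_nc a q * eval_word a u" for u q
    using L_eval_sandwich[of a u q 0] L_eval_sandwich[of a 0 q u]
    by (simp_all add: eval_nc_eq_L mono_of_def single_one)
  have "eval_nc a (commutator (mono_of w + mono_of (wstar w)) p) =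
      (eval_word a w + qcnj (eval_word a w)) * eval_nc a p -
      eval_nc a p * (eval_word a w + qcnj (eval_word a w))"
    using mult by (simp add: commutator_def eval_nc_eq_L L_diff L_add distrib_left distrib_right)
  then show ?thesis
    by (simp only: add_qcnj of_real_quat_commute[of _ "eval_nc a p"] diff_self)
qed

lemma dirac_moment_feasible:
  assumes "a \<in> feasible_set gs hs"
  shows "moment_feasible gs hs d (eval_word a)"
  unfolding moment_feasible_def
proof (intro conjI ballI allI impI)
  show "eval_word a u = eval_word a v" if "normal_form u = normal_form v" for u v
    using that by (simp add: eval_word_normal_form)
  show "qre (eval_word a u) = qre (eval_word a v)" if "cyc_equiv u v" for u v
    using that by (auto simp: cyc_equiv_def intro: qre_mult_commute)
  have "moment_matrix (eval_word a) = (\<lambda>u v. qcnj (eval_word a u) * of_real 1 * eval_word a v)"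
    by (simp add: moment_matrix_eq fun_eq_iff)
  then show "qpsd (words d) (moment_matrix (eval_word a))"
    using qpsd_rank_one[of 1] by simp
  show "qpsd (words (d - half_deg g)) (localizing_matrix g (eval_word a))" if g: "g \<in> set gs" for g
  proof -
    obtain t where t: "0 \<le> t" "eval_nc a g = of_real t"
      using assms g by (auto simp: feasible_set_def qnonneg_def)
    have "localizing_matrix g (eval_word a) = (\<lambda>u v. qcnj (eval_word a u) * of_real t * eval_word a v)"
      by (simp add: localizing_matrix_def L_eval_sandwich t fun_eq_iff)
    then show ?thesis
      using qpsd_rank_one[OF t(1)] by simp
  qed
  show "L (eval_word a) (mono_of u * h * mono_of v) = 0" if "h \<in> set hs" for h u v
    using assms that by (simp add: L_eval_sandwich feasible_set_def)
  show "L (eval_word a) (mono_of u * commutator (mono_of w + mono_of (wstar w)) (mono_of (QWord [Q i])) * mono_of v) = 0"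
    for i u v w
    by (simp add: L_eval_sandwich eval_nc_commutator)
qed auto

text \<open>Cyclic invariance of the real part is what allows \<open>LR\<close> to read the moment
  of \<open>b + a\<close> for a term with words \<open>a\<close> and \<open>b\<close>.\<close>

lemma LR_eval_word: "LR (eval_word a) f = qre (eval_qp a f)"
  unfolding LR_def eval_qp_def qre_sum
proof (rule sum.cong[OF refl], clarify)
  fix u v
  show "qre (Poly_Mapping.lookup f (u, v) * eval_word a (v + u)) =
      qre (eval_word a u * Poly_Mapping.lookup f (u, v) * eval_word a v)"
    using qre_mult_commute[of "eval_word a u" "Poly_Mapping.lookup f (u, v) * eval_word a v"]
    by (simp add: mult.assoc)
qed

lemma relax_value_le_f_min: "relax_value f gs hs d \<le> f_min f gs hs"
  unfolding f_min_def relax_value_def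
proof (rule INF_greatest)
  fix a
  assume "a \<in> feasible_set gs hs"
  then show "(INF y\<in>{y. moment_feasible gs hs d y}. ereal (LR y f)) \<le> ereal (qre (eval_qp a f))"
    using INF_lower[of "eval_word a" "{y. moment_feasible gs hs d y}" "\<lambda>y. ereal (LR y f)"]
    by (simp add: LR_eval_word dirac_moment_feasible)
qed

section \<open>Flat moment data\<close>

text \<open>A vector indexed by \<open>J\<close> is padded with zeros to all of
  \<open>I\<close>.\<close>

lemma qpsd_subset:
  assumes "qpsd I M" "finite I" "J \<subseteq> I"
  shows "qnonneg (\<Sum>u\<in>J. \<Sum>v\<in>J. qcnj (c u) * M u v * c v)"
proof -
  define c' where "c' u = (if u \<in> J then c u else 0)" for u
  have "(\<Sum>u\<in>I. \<Sum>v\<in>I. qcnj (c' u) * M u v * c' v) = (\<Sum>u\<in>J. \<Sum>v\<in>I. qcnj (c' u) * M u v * c' v)"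
    by (rule sum.mono_neutral_right[OF assms(2,3)]) (simp add: c'_def)
  also have "\<dots> = (\<Sum>u\<in>J. \<Sum>v\<in>J. qcnj (c' u) * M u v * c' v)"
    by (rule sum.cong[OF refl], rule sum.mono_neutral_right[OF assms(2,3)]) (simp add: c'_def)
  also have "\<dots> = (\<Sum>u\<in>J. \<Sum>v\<in>J. qcnj (c u) * M u v * c v)"
    by (simp add: c'_def)
  finally have eq: "(\<Sum>u\<in>I. \<Sum>v\<in>I. qcnj (c' u) * M u v * c' v) =
      (\<Sum>u\<in>J. \<Sum>v\<in>J. qcnj (c u) * M u v * c v)" .
  have "qnonneg (\<Sum>u\<in>I. \<Sum>v\<in>I. qcnj (c' u) * M u v * c' v)"
    using assms(1) unfolding qpsd_def by (elim conjE allE)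
  then show ?thesis
    by (simp only: eq)
qed

lemma qnonneg_mult_of_real_cancel:
  assumes "qnonneg (of_real t * x)" "0 < t"
  shows "qnonneg x"
proof -
  obtain s where s: "0 \<le> s" "of_real t * x = of_real s"
    using assms(1) by (auto simp: qnonneg_def)
  have "x = of_real (s / t)"
    using s(2) assms(2) by (simp add: quat_eq_iff quat_times_sel field_simps del: of_real_divide)
  then show ?thesis
    using s(1) assms(2) unfolding qnonneg_def by (intro exI[of _ "s / t"]) simp
qed

text \<open>Common interface of two realisations of the moments: the canonical representation from
  the hypotheses, and a concrete one built on functions of words. Adjointness of the operators is
  derived from \<open>gram\<close>.\<close>

locale flat_moments = right_quat_fin_dim rscale ip S r
  for rscale :: "'h::ab_group_add \<Rightarrow> quat \<Rightarrow> 'h" and ip S r +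
  fixes y :: "'n::finite qword \<Rightarrow> quat" and d :: nat and J :: "'n qword set"
    and bv :: "'n qword \<Rightarrow> 'h" and X :: "'n letter \<Rightarrow> 'h \<Rightarrow> 'h"
  assumes d_pos: "1 \<le> d" and J_words: "J \<subseteq> words (d - 1)"
    and gram: "wlen u \<le> d \<Longrightarrow> wlen v \<le> d \<Longrightarrow> ip (bv u) (bv v) = y (wstar u + v)"
    and S_span: "x \<in> S \<Longrightarrow> \<exists>c. x = (\<Sum>v\<in>J. rscale (bv v) (c v))"
    and bv_in: "wlen w \<le> d \<Longrightarrow> bv w \<in> S"
    and X_lin: "rlin S (X a)"
    and X_bv: "wlen w \<le> d - 1 \<Longrightarrow> X a (bv w) = bv (QWord [a] + w)"
begin

lemma J_le: "v \<in> J \<Longrightarrow> wlen v \<le> d - 1" "v \<in> J \<Longrightarrow> wlen v \<le> d"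
  using J_words d_pos by (auto dest!: subsetD)

lemma S_eqI:
  assumes "x \<in> S" "z \<in> S" "\<And>u. u \<in> J \<Longrightarrow> ip (bv u) x = ip (bv u) z"
  shows "x = z"
proof -
  have "x - z \<in> S"
    using assms rsubD[OF sub] by simp
  moreover from this obtain c where "x - z = (\<Sum>v\<in>J. rscale (bv v) (c v))"
    using S_span by blast
  then have "ip (x - z) (x - z) = (\<Sum>v\<in>J. qcnj (c v) * ip (bv v) (x - z))"
    by (simp add: ip_sum_left ip_rscale_left)
  then have "ip (x - z) (x - z) = 0"
    using assms(3) by (simp add: ip_diff_right)
  ultimately show ?thesis
    using definite by force
qed

lemma rlin_eq_on_S:
  assumes "rlin S A" "rlin S B" "\<And>v. v \<in> J \<Longrightarrow> A (bv v) = B (bv v)" "x \<in> S"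
  shows "A x = B x"
proof -
  obtain c where "x = (\<Sum>v\<in>J. rscale (bv v) (c v))"
    using S_span[OF assms(4)] by blast
  then show ?thesis
    using assms(3) bv_in J_le
    by (simp add: rlin_sum[OF sub assms(1)] rlin_sum[OF sub assms(2)] rsubD[OF sub]
        rlinD[OF assms(1)] rlinD[OF assms(2)])
qed

text \<open>Carrying a letter across the Gram form only regroups the word whose moment is taken. The
  words of \<open>J\<close> have length at most d - 1, which leaves room for the extra letter on
  either side.\<close>

lemma X_adj:
  assumes "x \<in> S" "z \<in> S"
  shows "ip (X (lstar a) x) z = ip x (X a z)"
proof -
  obtain c where c: "x = (\<Sum>v\<in>J. rscale (bv v) (c v))"
    using S_span[OF assms(1)] by blast
  obtain c' where c': "z = (\<Sum>v\<in>J. rscale (bv v) (c' v))"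
    using S_span[OF assms(2)] by blast
  have X_sum: "X b (\<Sum>v\<in>J. rscale (bv v) (k v)) = (\<Sum>v\<in>J. rscale (bv (QWord [b] + v)) (k v))" for b k
    using bv_in J_le by (simp add: rlin_sum[OF sub X_lin] rsubD[OF sub] rlinD[OF X_lin] X_bv)
  have ws: "wstar (QWord [lstar a]) = QWord [a]"
    by (rule qword_eqI) simp
  have ip_bv: "ip (bv (QWord [lstar a] + u)) (bv v) = ip (bv u) (bv (QWord [a] + v))"
    if "u \<in> J" "v \<in> J" for u v
    using J_le[OF that(1)] J_le[OF that(2)] d_pos by (simp add: gram ws add.assoc)
  show ?thesis
    unfolding c c' X_sum
    by (simp add: ip_sum_left ip_sum_right ip_rscale_left ip_rscale_right ip_bv)
qed

lemma foldr_X_in: "x \<in> S \<Longrightarrow> foldr X xs x \<in> S"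
  by (rule rlinD(1)[OF rlin_foldr[OF X_lin]])

lemma foldr_X_adj:
  assumes "x \<in> S" "z \<in> S"
  shows "ip (foldr X (rev (map lstar xs)) x) z = ip x (foldr X xs z)"
  using assms by (induction xs arbitrary: x) (auto simp: X_adj foldr_X_in rlinD(1)[OF X_lin])

lemma foldr_X_bv: "length xs + wlen v \<le> d \<Longrightarrow> foldr X xs (bv v) = bv (QWord xs + v)"
proof (induction xs)
  case (Cons a xs)
  have "foldr X (a # xs) (bv v) = bv (QWord [a] + (QWord xs + v))"
    using Cons by (simp add: X_bv)
  also have "QWord [a] + (QWord xs + v) = QWord (a # xs) + v"
    by (rule qword_eqI) simp
  finally show ?case .
qed (simp add: QWord_Nil)

text \<open>Moments up to length 2d are recovered from vectors of words up to length d: the word is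
  cut so that its first part moves to \<open>u\<close> by adjunction, and neither side exceeds
  d.\<close>

lemma ip_foldr_X_bv:
  assumes "wlen u \<le> d" "wlen v \<le> d" "wlen u + length xs + wlen v \<le> 2 * d"
  shows "ip (bv u) (foldr X xs (bv v)) = y (wstar u + QWord xs + v)"
proof -
  define ps qs where "ps = take (d - wlen u) xs" and "qs = drop (d - wlen u) xs"
  have xs: "xs = ps @ qs"
    by (simp add: ps_def qs_def)
  have len: "length ps + wlen u \<le> d" "length qs + wlen v \<le> d"
    using assms by (auto simp: ps_def qs_def)
  have ws: "wstar (QWord (rev (map lstar ps))) = QWord ps"
    by (rule qword_eqI) (simp add: rev_map o_def)
  have "ip (bv u) (foldr X xs (bv v)) = ip (foldr X (rev (map lstar ps)) (bv u)) (foldr X qs (bv v))"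
    by (simp add: xs foldr_X_adj foldr_X_in bv_in assms)
  also have "\<dots> = ip (bv (QWord (rev (map lstar ps)) + u)) (bv (QWord qs + v))"
    using len by (simp add: foldr_X_bv)
  also have "\<dots> = y (wstar u + QWord xs + v)"
    using len by (simp add: gram ws xs QWord_append add.assoc)
  finally show ?thesis .
qed

lemma flat_rep_rlin: "rlin S (flat_rep rscale X p)"
proof -
  have F: "rlin S (\<lambda>x. rscale (foldr X (letters w) x) (of_real t))" for w t
    by (rule rlin_rscale_real[OF sub rlin_foldr[OF X_lin]])
  note lin = rlinD[OF rlin_foldr[OF X_lin]]
  show ?thesis
    unfolding rlin_def flat_rep_def
    by (auto intro!: rsub_sum[OF sub] rlinD(1)[OF F]
        simp: lin rscale_add_left sum.distrib rscale_sum_left of_real_quat_commute simp flip: rscale_mult)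
qed

lemma ip_flat_rep:
  assumes "wlen u \<le> d" "wlen v \<le> d" "wlen u + wlen v + ncdeg p \<le> 2 * d"
  shows "ip (bv u) (flat_rep rscale X p (bv v)) = L y (mono_of (wstar u) * p * mono_of v)"
  unfolding flat_rep_def L_sandwich ip_sum_right
proof (rule sum.cong[OF refl])
  fix w
  assume "w \<in> Poly_Mapping.keys p"
  then have "wlen w \<le> ncdeg p"
    by (rule wlen_le_ncdeg)
  then have "wlen u + length (letters w) + wlen v \<le> 2 * d"
    using assms(3) by (simp add: wlen_def)
  from ip_foldr_X_bv[OF assms(1,2) this]
  show "ip (bv u) (rscale (foldr X (letters w) (bv v)) (of_real (Poly_Mapping.lookup p w))) =
      Poly_Mapping.lookup p w *\<^sub>R y (wstar u + w + v)"
    by (simp add: ip_rscale_right scaleR_conv_of_real of_real_quat_commute)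
qed

lemma foldr_X_eigenvector:
  assumes "x \<in> S" "\<And>a. X a x = rscale x (eval_letter q a)"
  shows "foldr X (letters w) x = rscale x (eval_word q w)"
proof -
  have "foldr X xs x = rscale x (prod_list (map (eval_letter q) xs))" for xs
    by (induction xs) (simp_all add: rscale_one rlinD[OF X_lin] assms rscale_mult)
  then show ?thesis
    by (simp add: eval_word_def)
qed

lemma flat_rep_eigenvector:
  assumes "x \<in> S" "\<And>a. X a x = rscale x (eval_letter q a)"
  shows "flat_rep rscale X p x = rscale x (eval_nc q p)"
  unfolding flat_rep_def eval_nc_def rscale_sum_right
  by (simp add: foldr_X_eigenvector[OF assms] scaleR_conv_of_real of_real_quat_commute
      flip: rscale_mult)

text \<open>The components in \<open>F\<close> are left unnormalised, since a quaternionic rescaling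
  would conjugate their eigenvalues and change the atoms. As \<open>bv 0\<close> is exactly their
  sum, orthogonality turns each moment into the sum of \<open>ip x x\<close> times the value of the
  word at the atom of \<open>x\<close>.\<close>

lemma atomic_representation:
  assumes F: "finite F" "F \<subseteq> S" "card F \<le> r" "0 \<notin> F" "bv 0 = \<Sum>F"
    and orth: "\<And>x z. x \<in> F \<Longrightarrow> z \<in> F \<Longrightarrow> x \<noteq> z \<Longrightarrow> ip x z = 0"
    and eig: "\<And>a x. x \<in> F \<Longrightarrow> \<exists>c. X a x = rscale x c"
    and gs: "\<And>g. g \<in> set gs \<Longrightarrow> half_deg g \<le> d \<and> J \<subseteq> words (d - half_deg g) \<and>
      qpsd (words (d - half_deg g)) (localizing_matrix g y)"
    and hs: "\<And>h. h \<in> set hs \<Longrightarrow> half_deg h \<le> d \<and> J \<subseteq> words (d - half_deg h) \<and>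
      (\<forall>u\<in>J. \<forall>v\<in>J. L y (mono_of (wstar u) * h * mono_of v) = 0)"
  shows "\<exists>P lam. finite P \<and> card P \<le> r \<and> (\<forall>p\<in>P. 0 < lam p) \<and> P \<subseteq> feasible_set gs hs \<and>
    (\<forall>w. wlen w \<le> 2 * d \<longrightarrow> y w = (\<Sum>p\<in>P. lam p *\<^sub>R eval_word p w))"
proof -
  define \<kappa> where "\<kappa> a x = (SOME c. X a x = rscale x c)" for a x
  have \<kappa>: "X a x = rscale x (\<kappa> a x)" if "x \<in> F" for a x
    unfolding \<kappa>_def by (rule someI_ex[OF eig[OF that]])
  define n where "n x = qre (ip x x)" for x
  have n: "ip x x = of_real (n x)" "0 < n x" if x: "x \<in> F" for x
  proof -
    show "ip x x = of_real (n x)"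
      unfolding n_def by (rule ip_self)
    show "0 < n x"
      unfolding n_def by (rule ip_pos) (use x F(2,4) definite in blast)
  qed
  have \<kappa>_star: "\<kappa> (lstar a) x = qcnj (\<kappa> a x)" if x: "x \<in> F" for a x
  proof -
    have "qcnj (\<kappa> (lstar a) x) * of_real (n x) = of_real (n x) * \<kappa> a x"
      using X_adj[of x x a] x F(2) by (auto simp: \<kappa> ip_rscale_left ip_rscale_right n)
    then have "of_real (n x) * qcnj (\<kappa> (lstar a) x) = of_real (n x) * \<kappa> a x"
      by (simp only: of_real_quat_commute)
    then have "qcnj (\<kappa> (lstar a) x) = \<kappa> a x"
      using n(2)[OF x] by simp
    then show ?thesis
      by (metis qcnj_qcnj)
  qed
  define q where "q x = (\<chi> i. \<kappa> (Q i) x)" for x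
  have q: "X a x = rscale x (eval_letter (q x) a)" if x: "x \<in> F" for a x
  proof (cases a)
    case (Q i)
    then show ?thesis
      using \<kappa>[OF x] by (simp add: q_def)
  next
    case (Qbar i)
    then show ?thesis
      using \<kappa>[OF x] \<kappa>_star[OF x, of "Q i"] by (simp add: q_def)
  qed
  have xS: "x \<in> S" if "x \<in> F" for x
    using that F(2) by blast
  note flat_rep_F = flat_rep_eigenvector[OF xS q]
  have moments: "y w = (\<Sum>x\<in>F. n x *\<^sub>R eval_word (q x) w)" if "wlen w \<le> 2 * d" for w
  proof -
    have "y w = ip (bv 0) (foldr X (letters w) (bv 0))"
      using that by (subst ip_foldr_X_bv) (auto simp: wlen_def)
    also have "\<dots> = (\<Sum>x\<in>F. ip x (\<Sum>z\<in>F. foldr X (letters w) z))"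
      by (simp add: F(5) ip_sum_left rlin_sum[OF sub rlin_foldr[OF X_lin]] xS)
    also have "\<dots> = (\<Sum>x\<in>F. \<Sum>z\<in>F. ip x z * eval_word (q z) w)"
      by (simp add: ip_sum_right foldr_X_eigenvector[OF xS q] ip_rscale_right)
    also have "\<dots> = (\<Sum>x\<in>F. \<Sum>z\<in>F. if z = x then n x *\<^sub>R eval_word (q x) w else 0)"
      by (intro sum.cong refl) (auto simp: orth n scaleR_conv_of_real)
    finally show ?thesis
      using F(1) by simp
  qed
  \<comment> \<open>Expanded in words of \<open>J\<close>, which are short enough for the localizing
    matrix, the vector \<open>x\<close> gives that matrix the quadratic form value
    \<open>n x\<close> times \<open>g\<close> at the atom.\<close>
  have g_nonneg: "qnonneg (eval_nc (q x) g)" if x: "x \<in> F" and g: "g \<in> set gs" for x g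
  proof -
    obtain c where c: "x = (\<Sum>v\<in>J. rscale (bv v) (c v))"
      using S_span[OF xS[OF x]] by blast
    have Jg: "wlen u + half_deg g \<le> d" if "u \<in> J" for u
    proof -
      have "wlen u \<le> d - half_deg g" "half_deg g \<le> d"
        using gs[OF g] that by auto
      then show ?thesis
        by simp
    qed
    have "flat_rep rscale X g x = (\<Sum>v\<in>J. rscale (flat_rep rscale X g (bv v)) (c v))"
      unfolding c using bv_in J_le
      by (simp add: rlin_sum[OF sub flat_rep_rlin] rsubD[OF sub] rlinD[OF flat_rep_rlin])
    then have "ip x (flat_rep rscale X g x) =
        (\<Sum>u\<in>J. \<Sum>v\<in>J. qcnj (c u) * ip (bv u) (flat_rep rscale X g (bv v)) * c v)"
      by (subst c) (simp add: ip_sum_left ip_sum_right ip_rscale_left ip_rscale_right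
          sum_distrib_right, rule sum.swap)
    also have "\<dots> = (\<Sum>u\<in>J. \<Sum>v\<in>J. qcnj (c u) * localizing_matrix g y u v * c v)"
    proof (intro sum.cong refl)
      fix u v
      assume "u \<in> J" "v \<in> J"
      then have "wlen u + wlen v + ncdeg g \<le> 2 * d"
        using Jg[of u] Jg[of v] ncdeg_le_half_deg[of g] by linarith
      then show "qcnj (c u) * ip (bv u) (flat_rep rscale X g (bv v)) * c v =
          qcnj (c u) * localizing_matrix g y u v * c v"
        using J_le \<open>u \<in> J\<close> \<open>v \<in> J\<close> by (simp add: ip_flat_rep localizing_matrix_def)
    qed
    finally have eq: "ip x (flat_rep rscale X g x) =
        (\<Sum>u\<in>J. \<Sum>v\<in>J. qcnj (c u) * localizing_matrix g y u v * c v)" .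
    have "J \<subseteq> words (d - half_deg g)" "qpsd (words (d - half_deg g)) (localizing_matrix g y)"
      using gs[OF g] by blast+
    then have "qnonneg (ip x (flat_rep rscale X g x))"
      unfolding eq by (intro qpsd_subset[OF _ finite_words])
    then have "qnonneg (of_real (n x) * eval_nc (q x) g)"
      using x by (simp add: flat_rep_F ip_rscale_right n)
    then show ?thesis
      using n(2)[OF x] by (rule qnonneg_mult_of_real_cancel)
  qed
  \<comment> \<open>The constraints make \<open>h\<close> annihilate each spanning vector, so it
    acts as zero on \<open>S\<close>; on an eigenvector this action is the value at the
    atom.\<close>
  have h_zero: "eval_nc (q x) h = 0" if x: "x \<in> F" and h: "h \<in> set hs" for x h
  proof -
    have Jh: "wlen u + half_deg h \<le> d" if "u \<in> J" for u
    proof -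
      have "wlen u \<le> d - half_deg h" "half_deg h \<le> d"
        using hs[OF h] that by auto
      then show ?thesis
        by simp
    qed
    have "flat_rep rscale X h (bv v) = 0" if v: "v \<in> J" for v
    proof (rule S_eqI)
      show "ip (bv u) (flat_rep rscale X h (bv v)) = ip (bv u) 0" if "u \<in> J" for u
      proof -
        have "wlen u + wlen v + ncdeg h \<le> 2 * d"
          using Jh[of u] Jh[of v] that v ncdeg_le_half_deg[of h] by linarith
        then show ?thesis
          using hs[OF h] that v J_le by (simp add: ip_flat_rep)
      qed
    qed (use v J_le bv_in rlinD(1)[OF flat_rep_rlin] rsubD[OF sub] in auto)
    then have "flat_rep rscale X h x = (\<lambda>_. 0) x"
      by (intro rlin_eq_on_S[OF flat_rep_rlin _ _ xS[OF x]]) (auto simp: rlin_def rsubD[OF sub])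
    then have "rscale x (eval_nc (q x) h) = 0"
      using x by (simp add: flat_rep_F)
    then show ?thesis
      using rscale_eq_0D x F(4) by blast
  qed
  \<comment> \<open>Several components can share an atom. Their weights are merged, so that the
    points come out distinct.\<close>
  define lam where "lam p = (\<Sum>x\<in>{x \<in> F. q x = p}. n x)" for p
  have "y w = (\<Sum>p\<in>q ` F. lam p *\<^sub>R eval_word p w)" if "wlen w \<le> 2 * d" for w
    unfolding moments[OF that] lam_def scaleR_sum_left
    by (subst sum.image_gen[OF F(1), of _ q]) (auto intro!: sum.cong)
  moreover have "0 < lam p" if "p \<in> q ` F" for p
    unfolding lam_def using that F(1) n(2) by (intro sum_pos) auto
  moreover have "q ` F \<subseteq> feasible_set gs hs"
    using g_nonneg h_zero by (auto simp: feasible_set_def)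
  moreover have "card (q ` F) \<le> r"
    using card_image_le[OF F(1), of q] F(3) by simp
  ultimately show ?thesis
    using F(1) by (intro exI[of _ "q ` F"] exI[of _ lam]) auto
qed

text \<open>The commutator constraints mention only the letters q_i. Since w + w* acts as a
  self-adjoint operator, passing to adjoints transfers them to the conjugate letters.\<close>

lemma central_of_generators:
  assumes C: "\<And>w i x. length w \<le> 3 \<Longrightarrow> x \<in> S \<Longrightarrow>
      foldr X w (X (Q i) x) + foldr X (rev (map lstar w)) (X (Q i) x) =
      X (Q i) (foldr X w x) + X (Q i) (foldr X (rev (map lstar w)) x)"
    and w: "length w \<le> 3" and x: "x \<in> S"
  shows "foldr X w (X b x) + foldr X (rev (map lstar w)) (X b x) =
      X b (foldr X w x) + X b (foldr X (rev (map lstar w)) x)"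
proof (cases b)
  case (Q i)
  then show ?thesis
    using C[OF w x] by simp
next
  case (Qbar i)
  define A where "A x = foldr X w x + foldr X (rev (map lstar w)) x" for x
  have A: "rlin S A"
    unfolding A_def by (intro rlin_add rlin_foldr X_lin sub)
  have AX: "A (X (Q i) z) = X (Q i) (A z)" if "z \<in> S" for z
    using C[OF w that] that by (simp add: A_def rlinD[OF X_lin] foldr_X_in)
  have A_adj: "ip u (A z) = ip (A u) z" if "u \<in> S" "z \<in> S" for u z
    using foldr_X_adj[OF that, of w] foldr_X_adj[OF that, of "rev (map lstar w)"]
    by (simp add: A_def ip_add_left ip_add_right rev_map o_def)
  have adj: "ip (X (Q i) u) z = ip u (X (Qbar i) z)" if "u \<in> S" "z \<in> S" for u z
    using X_adj[OF that, of "Qbar i"] by simp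
  note in_S = rlinD(1)[OF A] rlinD(1)[OF X_lin] x
  have "A (X (Qbar i) x) = X (Qbar i) (A x)"
  proof (rule S_eqI)
    fix u
    assume "u \<in> J"
    then have u: "bv u \<in> S"
      using bv_in J_le by blast
    have "ip (bv u) (A (X (Qbar i) x)) = ip (X (Q i) (A (bv u))) x"
      using u in_S by (simp add: A_adj adj)
    also have "\<dots> = ip (bv u) (X (Qbar i) (A x))"
      using u in_S by (simp add: AX[symmetric] A_adj[symmetric] adj)
    finally show "ip (bv u) (A (X (Qbar i) x)) = ip (bv u) (X (Qbar i) (A x))" .
  qed (use in_S in auto)
  then show ?thesis
    using x by (simp add: A_def Qbar rlinD[OF X_lin] foldr_X_in)
qed

text \<open>These are the nonzero components of \<open>bv 0\<close> along an orthonormal eigenbasis.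
  Distinct basis vectors give orthogonal, hence different, components, so their sum is a sum over a
  set.\<close>

lemma ex_orthogonal_eigenvectors:
  assumes C: "\<And>w i x. length w \<le> 3 \<Longrightarrow> x \<in> S \<Longrightarrow>
      foldr X w (X (Q i) x) + foldr X (rev (map lstar w)) (X (Q i) x) =
      X (Q i) (foldr X w x) + X (Q i) (foldr X (rev (map lstar w)) x)"
  obtains F where "finite F" "F \<subseteq> S" "card F \<le> r" "0 \<notin> F" "bv 0 = \<Sum>F"
    "\<And>x z. x \<in> F \<Longrightarrow> z \<in> F \<Longrightarrow> x \<noteq> z \<Longrightarrow> ip x z = 0"
    "\<And>a x. x \<in> F \<Longrightarrow> \<exists>c. X a x = rscale x c"
proof -
  obtain E where E: "onb S E" "\<And>a e. e \<in> E \<Longrightarrow> \<exists>c. X a e = rscale e c"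
    by (rule simultaneous_diagonalisation[OF lstar_lstar X_lin X_adj central_of_generators[OF C] that])
  define f where "f e = rscale e (ip e (bv 0))" for e
  define E' where "E' = {e \<in> E. ip e (bv 0) \<noteq> 0}"
  have E1: "finite E" "E \<subseteq> S" "orthonormal E"
    using E(1) by (auto simp: onb_def)
  have fE': "finite E'"
    using E1 by (simp add: E'_def)
  have ip_f: "ip (f e) (f e') = (if e = e' then qcnj (ip e (bv 0)) * ip e (bv 0) else 0)"
    if "e \<in> E" "e' \<in> E" for e e'
    using E1(3) that by (auto simp: f_def ip_rscale_left ip_rscale_right orthonormal_def)
  have f_nz: "ip (f e) (f e) \<noteq> 0" if "e \<in> E'" for e
    using that ip_f[of e e] by (auto simp: E'_def qcnj_mult_self)
  have inj: "inj_on f E'"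
  proof (rule inj_onI, rule ccontr)
    fix e e'
    assume *: "e \<in> E'" "e' \<in> E'" "f e = f e'" "e \<noteq> e'"
    then have "ip (f e) (f e) = 0"
      using ip_f[of e e'] by (auto simp: E'_def)
    then show False
      using f_nz[OF *(1)] by simp
  qed
  show ?thesis
  proof (rule that[of "f ` E'"])
    show "f ` E' \<subseteq> S"
      using E1(2) rsubD(3)[OF sub] by (auto simp: f_def E'_def)
    have "card E' \<le> card E"
      using E1 by (intro card_mono) (auto simp: E'_def)
    then show "card (f ` E') \<le> r"
      using bound[OF E1] by (simp add: card_image[OF inj])
    show "0 \<notin> f ` E'"
      using f_nz by force
    have "bv 0 = (\<Sum>e\<in>E. f e)"
      unfolding f_def using E(1) bv_in[of 0] unfolding onb_def by auto
    also have "\<dots> = (\<Sum>e\<in>E'. f e)"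
      using E1 by (intro sum.mono_neutral_right) (auto simp: E'_def f_def)
    also have "\<dots> = \<Sum>(f ` E')"
      by (simp add: sum.reindex[OF inj])
    finally show "bv 0 = \<Sum>(f ` E')" .
    show "ip x z = 0" if "x \<in> f ` E'" "z \<in> f ` E'" "x \<noteq> z" for x z
      using that ip_f by (fastforce simp: E'_def)
    show "\<exists>c. X a x = rscale x c" if x: "x \<in> f ` E'" for a x
    proof -
      obtain e where e: "e \<in> E'" "x = f e"
        using x by blast
      define \<xi> where "\<xi> = ip e (bv 0)"
      have e': "e \<in> E" "e \<in> S" "\<xi> \<noteq> 0"
        using e E1(2) by (auto simp: E'_def \<xi>_def)
      obtain c where c: "X a e = rscale e c"
        using E(2)[OF e'(1)] by blast
      have "X a x = rscale e (c * \<xi>)"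
        using e e' c by (simp add: f_def rlinD[OF X_lin] rscale_mult flip: \<xi>_def)
      \<comment> \<open>Passing from the basis vector to its component conjugates the eigenvalue by
        \<open>\<xi>\<close>.\<close>
      also have "c * \<xi> = \<xi> * (inverse \<xi> * c * \<xi>)"
        using e'(3) by (simp flip: mult.assoc)
      also have "rscale e \<dots> = rscale x (inverse \<xi> * c * \<xi>)"
        by (simp add: e f_def rscale_mult flip: \<xi>_def)
      finally show ?thesis
        by blast
    qed
  qed (use fE' in auto)
qed

end

section \<open>Rank and Gram realisation\<close>

lemma qrank_attained:
  assumes "finite I"
  obtains J where "J \<subseteq> I" "columns_independent I M J" "card J = qrank I M"
proof -
  have "qrank I M \<in> card ` {J. J \<subseteq> I \<and> columns_independent I M J}"
    unfolding qrank_def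
  proof (rule Max_in)
    show "finite (card ` {J. J \<subseteq> I \<and> columns_independent I M J})"
      using assms by simp
    have "{} \<in> {J. J \<subseteq> I \<and> columns_independent I M J}"
      by (simp add: columns_independent_def)
    then show "card ` {J. J \<subseteq> I \<and> columns_independent I M J} \<noteq> {}"
      by blast
  qed
  then obtain J where "J \<subseteq> I" "columns_independent I M J" "qrank I M = card J"
    by blast
  then show ?thesis
    by (intro that[of J]) simp_all
qed

lemma card_le_qrank:
  assumes "finite I" "J \<subseteq> I" "columns_independent I M J"
  shows "card J \<le> qrank I M"
  unfolding qrank_def by (rule Max_ge) (use assms in auto)

text \<open>Adjoining a column to a largest independent family creates a relation. Its coefficient
  at the new column is nonzero by independence, and it is divided out on the right.\<close>

lemma column_in_span:
  assumes I: "finite I" and J: "J \<subseteq> I" "columns_independent I M J" "card J = qrank I M" and w: "w \<in> I"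
  shows "\<exists>c. \<forall>u\<in>I. M u w = (\<Sum>v\<in>J. M u v * c v)"
proof (cases "w \<in> J")
  case True
  have fJ: "finite J"
    using I J(1) by (rule finite_subset[rotated])
  show ?thesis
    using True fJ by (intro exI[of _ "\<lambda>v. if v = w then 1 else 0"]) (simp add: if_distrib cong: if_cong)
next
  case False
  have fJ: "finite J"
    using I J(1) by (rule finite_subset[rotated])
  have "\<not> columns_independent I M (insert w J)"
    using card_le_qrank[OF I, of "insert w J" M] J w False fJ by auto
  then obtain c where c: "\<And>u. u \<in> I \<Longrightarrow> (\<Sum>v\<in>insert w J. M u v * c v) = 0" "\<exists>v\<in>insert w J. c v \<noteq> 0"
    unfolding columns_independent_def by blast
  have c1: "M u w * c w = - (\<Sum>v\<in>J. M u v * c v)" if "u \<in> I" for u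
    using c(1)[OF that] False fJ by (simp add: eq_neg_iff_add_eq_0)
  have "c w \<noteq> 0"
  proof
    assume "c w = 0"
    then have "\<forall>u\<in>I. (\<Sum>v\<in>J. M u v * c v) = 0"
      using c1 by simp
    then have "\<forall>v\<in>J. c v = 0"
      using J(2) unfolding columns_independent_def by blast
    then show False
      using c(2) \<open>c w = 0\<close> by auto
  qed
  have "M u w = (\<Sum>v\<in>J. M u v * (- c v * inverse (c w)))" if "u \<in> I" for u
  proof -
    have "M u w = M u w * c w * inverse (c w)"
      using \<open>c w \<noteq> 0\<close> by (simp add: mult.assoc)
    also have "\<dots> = (\<Sum>v\<in>J. M u v * (- c v * inverse (c w)))"
      unfolding c1[OF that] by (simp add: sum_distrib_right sum_negf mult.assoc)
    finally show ?thesis .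
  qed
  then show ?thesis
    by (intro exI[of _ "\<lambda>v. - c v * inverse (c w)"]) blast
qed

text \<open>If \<open>E\<close> were larger, the matrix of coefficients over \<open>J\<close> would
  have a nonzero right kernel vector, which is a relation within \<open>E\<close>; orthonormality
  excludes it.\<close>

lemma (in right_quat_semi_inner_space) orthonormal_card_le:
  assumes "finite E" "orthonormal E" "finite J"
    and span: "\<And>e. e \<in> E \<Longrightarrow> \<exists>c. e = (\<Sum>v\<in>J. rscale (b v) (c v))"
  shows "card E \<le> card J"
proof (rule ccontr)
  assume "\<not> card E \<le> card J"
  then have less: "card J < card E"
    by simp
  define C where "C v e = (SOME c. e = (\<Sum>v\<in>J. rscale (b v) (c v))) v" for v e
  have C: "e = (\<Sum>v\<in>J. rscale (b v) (C v e))" if "e \<in> E" for e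
    using someI_ex[OF span[OF that]] unfolding C_def .
  obtain k where k: "\<exists>e\<in>E. k e \<noteq> 0" "\<forall>v\<in>J. (\<Sum>e\<in>E. C v e * k e) = 0"
    using division_ring_kernel_nontrivial[OF assms(3,1) less, of C] by blast
  have "(\<Sum>e\<in>E. rscale e (k e)) = (\<Sum>e\<in>E. \<Sum>v\<in>J. rscale (b v) (C v e * k e))"
  proof (rule sum.cong[OF refl])
    fix e
    assume "e \<in> E"
    have "rscale (\<Sum>v\<in>J. rscale (b v) (C v e)) (k e) = (\<Sum>v\<in>J. rscale (b v) (C v e * k e))"
      by (simp add: rscale_sum_left rscale_mult)
    then show "rscale e (k e) = (\<Sum>v\<in>J. rscale (b v) (C v e * k e))"
      by (simp only: C[OF \<open>e \<in> E\<close>, symmetric])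
  qed
  also have "\<dots> = (\<Sum>v\<in>J. rscale (b v) (\<Sum>e\<in>E. C v e * k e))"
    by (subst sum.swap) (simp add: rscale_sum_right)
  also have "\<dots> = 0"
    using k(2) by simp
  finally have "(\<Sum>e\<in>E. rscale e (k e)) = 0" .
  then have "k e = 0" if "e \<in> E" for e
    using ip_orthonormal_sum[OF assms(2,1) that, of k] by simp
  then show False
    using k(1) by blast
qed

lemma flat_moments_of_basis:
  assumes "right_quat_semi_inner_space rscale ip"
    and sub: "right_quat_semi_inner_space.rsub rscale S"
    and def: "\<And>x. x \<in> S \<Longrightarrow> ip x x = 0 \<Longrightarrow> x = 0"
    and "1 \<le> d" "J \<subseteq> words (d - 1)" "card J = r"
    and "\<And>u v. wlen u \<le> d \<Longrightarrow> wlen v \<le> d \<Longrightarrow> ip (bv u) (bv v) = y (wstar u + v)"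
    and "\<And>x. x \<in> S \<Longrightarrow> \<exists>c. x = (\<Sum>v\<in>J. rscale (bv v) (c v))"
    and "\<And>w. wlen w \<le> d \<Longrightarrow> bv w \<in> S"
    and "\<And>a. right_quat_semi_inner_space.rlin rscale S (X a)"
    and "\<And>a w. wlen w \<le> d - 1 \<Longrightarrow> X a (bv w) = bv (QWord [a] + w)"
  shows "flat_moments rscale ip S r (y :: 'n::finite qword \<Rightarrow> quat) d J bv X"
proof -
  interpret right_quat_semi_inner_space rscale ip
    by fact
  have fJ: "finite J"
    using assms(5) finite_words by (rule finite_subset)
  show ?thesis
  proof unfold_locales
    show "card E \<le> r" if "finite E" "E \<subseteq> S" "orthonormal E" for E
      using orthonormal_card_le[OF that(1,3) fJ] assms(6,8) that(2) by blast
  qed (use assms in auto)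
qed

context right_quat_inner_space
begin

lemma semi_inner: "right_quat_semi_inner_space rscale ip"
  by unfold_locales
    (rule rscale_add_left rscale_add_right rscale_mult rscale_one ip_add_right ip_rscale_right
      ip_commute ip_nonneg)+

end

text \<open>The difference between \<open>bv w\<close> and its column expansion over
  \<open>J\<close> is orthogonal to all word vectors, hence to itself, and so vanishes by
  definiteness. Thus the vectors of \<open>J\<close> span the flat space.\<close>

lemma flat_moments_canonical:
  assumes can: "canonical_flat_rep rscale ip d r y bv X"
    and d: "1 \<le> d" and J: "J \<subseteq> words (d - 1)" "card J = r"
      "columns_independent (words d) (moment_matrix y) J"
    and span: "\<And>w. wlen w \<le> d \<Longrightarrow>
      \<exists>c. \<forall>u\<in>words d. moment_matrix y u w = (\<Sum>v\<in>J. moment_matrix y u v * c v)"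
  shows "flat_moments rscale ip (flat_space rscale d bv) r (y :: 'n::finite qword \<Rightarrow> quat) d J bv X"
proof -
  have canD: "right_quat_inner_space rscale ip"
    "\<And>u v. wlen u \<le> d \<Longrightarrow> wlen v \<le> d \<Longrightarrow> ip (bv u) (bv v) = y (wstar u + v)"
    "\<And>a x. x \<in> flat_space rscale d bv \<Longrightarrow> X a x \<in> flat_space rscale d bv"
    "\<And>a x z. x \<in> flat_space rscale d bv \<Longrightarrow> z \<in> flat_space rscale d bv \<Longrightarrow> X a (x + z) = X a x + X a z"
    "\<And>a x c. x \<in> flat_space rscale d bv \<Longrightarrow> X a (rscale x c) = rscale (X a x) c"
    "\<And>a w. wlen w \<le> d - 1 \<Longrightarrow> X a (bv w) = bv (QWord [a] + w)"
    using can unfolding canonical_flat_rep_def by auto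
  interpret right_quat_inner_space rscale ip
    by (rule canD(1))
  interpret semi: right_quat_semi_inner_space rscale ip
    by (rule semi_inner)
  let ?W = "words d :: 'n qword set"
  let ?S = "flat_space rscale d bv"
  define S' where "S' = range (\<lambda>c. \<Sum>v\<in>J. rscale (bv v) (c v))"
  have JW: "J \<subseteq> ?W"
    using J(1) by force
  have S': "semi.rsub S'"
    unfolding semi.rsub_def
  proof (intro conjI ballI allI)
    show "0 \<in> S'"
      unfolding S'_def by (intro image_eqI[of _ _ "\<lambda>_. 0"]) auto
    show "x + z \<in> S'" if xz: "x \<in> S'" "z \<in> S'" for x z
    proof -
      obtain c c' where "x = (\<Sum>v\<in>J. rscale (bv v) (c v))" "z = (\<Sum>v\<in>J. rscale (bv v) (c' v))"
        using xz by (auto simp: S'_def)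
      then show ?thesis
        unfolding S'_def
        by (intro image_eqI[of _ _ "\<lambda>v. c v + c' v"]) (auto simp: rscale_add_right sum.distrib)
    qed
    show "rscale x k \<in> S'" if x: "x \<in> S'" for x k
    proof -
      obtain c where "x = (\<Sum>v\<in>J. rscale (bv v) (c v))"
        using x by (auto simp: S'_def)
      then show ?thesis
        unfolding S'_def
        by (intro image_eqI[of _ _ "\<lambda>v. c v * k"]) (auto simp: semi.rscale_sum_left rscale_mult)
    qed
  qed
  have bv_S': "bv w \<in> S'" if w: "wlen w \<le> d" for w
  proof -
    obtain c where c: "\<And>u. u \<in> ?W \<Longrightarrow> moment_matrix y u w = (\<Sum>v\<in>J. moment_matrix y u v * c v)"
      using span[OF w] by blast
    define x where "x = bv w - (\<Sum>v\<in>J. rscale (bv v) (c v))"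
    have Jd: "v \<in> J \<Longrightarrow> wlen v \<le> d" for v
      using JW by auto
    have bx: "ip (bv u) x = 0" if "wlen u \<le> d" for u
      using c[of u] that w Jd
      by (simp add: x_def semi.ip_diff_right semi.ip_sum_right semi.ip_rscale_right canD(2) moment_matrix_eq)
    have "ip x x = ip (bv w) x - (\<Sum>v\<in>J. qcnj (c v) * ip (bv v) x)"
      by (subst (1) x_def) (simp add: semi.ip_diff_left semi.ip_sum_left semi.ip_rscale_left)
    then have "ip x x = 0"
      using bx w Jd by simp
    then have "x = 0"
      by (rule ip_definite)
    then have "bv w = (\<Sum>v\<in>J. rscale (bv v) (c v))"
      by (simp add: x_def)
    then show ?thesis
      unfolding S'_def by blast
  qed
  \<comment> \<open>Spans are formed over sets of vectors, so a sum over \<open>J\<close> becomes a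
    member of the span only after reindexing along \<open>bv\<close>. Two equal vectors would make
    two columns dependent.\<close>
  have inj: "inj_on bv J"
  proof (rule inj_onI, rule ccontr)
    fix s t
    assume st: "s \<in> J" "t \<in> J" "bv s = bv t" "s \<noteq> t"
    define c where "c v = (if v = s then 1 else if v = t then - 1 else 0 :: quat)" for v
    have fJ: "finite J"
      using JW finite_words by (rule finite_subset)
    have "(\<Sum>v\<in>J. moment_matrix y u v * c v) = 0" if u: "u \<in> ?W" for u
    proof -
      have mm: "moment_matrix y u v = ip (bv u) (bv v)" if "v \<in> J" for v
        using that u JW by (subst canD(2)) (auto simp: moment_matrix_eq)
      have "(\<Sum>v\<in>J. moment_matrix y u v * c v) = (\<Sum>v\<in>{s, t}. moment_matrix y u v * c v)"
        using fJ st by (intro sum.mono_neutral_right) (auto simp: c_def)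
      also have "\<dots> = ip (bv u) (bv s) - ip (bv u) (bv t)"
        using st(1,2,4) by (simp add: c_def mm)
      finally show ?thesis
        using st by simp
    qed
    then have "c s = 0"
      using J(3) st(1) unfolding columns_independent_def by blast
    then show False
      by (simp add: c_def)
  qed
  have "?S \<subseteq> S'"
    unfolding flat_space_def rspan_def
    by (auto intro!: semi.rsub_sum[OF S'] semi.rsubD(3)[OF S'] bv_S')
  moreover have "S' \<subseteq> ?S"
  proof
    fix x
    assume "x \<in> S'"
    then obtain c where "x = (\<Sum>v\<in>J. rscale (bv v) (c v))"
      by (auto simp: S'_def)
    also have "\<dots> = (\<Sum>z\<in>bv ` J. rscale z (c (inv_into J bv z)))"
      using inj by (simp add: sum.reindex)
    finally have x: "x = (\<Sum>z\<in>bv ` J. rscale z (c (inv_into J bv z)))" .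
    have "finite (bv ` J)"
      using JW finite_words by (meson finite_imageI finite_subset)
    then show "x \<in> ?S"
      unfolding flat_space_def rspan_def
      using JW x by (intro CollectI exI[of _ "bv ` J"] exI[of _ "\<lambda>z. c (inv_into J bv z)"]) auto
  qed
  ultimately have eq: "?S = S'"
    by (rule antisym)
  show ?thesis
  proof (rule flat_moments_of_basis[OF semi_inner _ _ d J(1,2)])
    show "semi.rsub ?S"
      using S' eq by simp
    show "\<exists>c. x = (\<Sum>v\<in>J. rscale (bv v) (c v))" if "x \<in> ?S" for x
      using that unfolding eq S'_def by blast
    show "semi.rlin ?S (X a)" for a
      unfolding semi.rlin_def using canD(3-5) by blast
    show "bv w \<in> ?S" if "wlen w \<le> d" for w
      using bv_S'[OF that] eq by simp
  qed (use canD(2,6) ip_definite in auto)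
qed

section \<open>Gram realisation of the moment matrix\<close>

lemma qpsd_semi_inner:
  fixes M :: "'i \<Rightarrow> 'i \<Rightarrow> quat"
  assumes "qpsd W M"
  shows "right_quat_semi_inner_space (\<lambda>x c w. x w * c)
    (\<lambda>x z. \<Sum>u\<in>W. \<Sum>v\<in>W. qcnj (x u) * M u v * z v)"
proof
  fix x z z' :: "'i \<Rightarrow> quat" and c c' :: quat
  show "(\<lambda>w. (x + z) w * c) = (\<lambda>w. x w * c) + (\<lambda>w. z w * c)"
    by (simp add: fun_eq_iff distrib_right)
  show "(\<lambda>w. x w * (c + c')) = (\<lambda>w. x w * c) + (\<lambda>w. x w * c')"
    by (simp add: fun_eq_iff distrib_left)
  show "(\<lambda>w. x w * (c * c')) = (\<lambda>w. x w * c * c')"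
    by (simp add: mult.assoc)
  show "(\<lambda>w. x w * 1) = x"
    by simp
  show "(\<Sum>u\<in>W. \<Sum>v\<in>W. qcnj (x u) * M u v * (z + z') v) =
      (\<Sum>u\<in>W. \<Sum>v\<in>W. qcnj (x u) * M u v * z v) + (\<Sum>u\<in>W. \<Sum>v\<in>W. qcnj (x u) * M u v * z' v)"
    by (simp add: distrib_left sum.distrib)
  show "(\<Sum>u\<in>W. \<Sum>v\<in>W. qcnj (x u) * M u v * (z v * c)) =
      (\<Sum>u\<in>W. \<Sum>v\<in>W. qcnj (x u) * M u v * z v) * c"
    by (simp add: sum_distrib_right mult.assoc)
  have "qcnj (\<Sum>u\<in>W. \<Sum>v\<in>W. qcnj (x u) * M u v * z v) =
      (\<Sum>u\<in>W. \<Sum>v\<in>W. qcnj (z v) * (qcnj (M u v) * x u))"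
    by (simp add: qcnj_sum qcnj_mult mult.assoc)
  also have "\<dots> = (\<Sum>v\<in>W. \<Sum>u\<in>W. qcnj (z v) * (qcnj (M u v) * x u))"
    by (rule sum.swap)
  also have "\<dots> = (\<Sum>v\<in>W. \<Sum>u\<in>W. qcnj (z v) * M v u * x u)"
  proof (intro sum.cong refl)
    fix u v
    assume "v \<in> W" "u \<in> W"
    then have "M v u = qcnj (M u v)"
      using assms unfolding qpsd_def by blast
    then show "qcnj (z v) * (qcnj (M u v) * x u) = qcnj (z v) * M v u * x u"
      by (simp add: mult.assoc)
  qed
  finally show "(\<Sum>u\<in>W. \<Sum>v\<in>W. qcnj (z u) * M u v * x v) =
      qcnj (\<Sum>u\<in>W. \<Sum>v\<in>W. qcnj (x u) * M u v * z v)"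
    by simp
  show "qnonneg (\<Sum>u\<in>W. \<Sum>v\<in>W. qcnj (x u) * M u v * x v)"
    using assms unfolding qpsd_def by blast
qed

text \<open>The hypotheses of the theorem supply a representation only for gap 1 and d at least 2;
  this construction covers the remaining cases. Functions supported on \<open>J\<close> form a
  complement of the null vectors of the Gram form, and \<open>bv w\<close> is the representative
  there of the unit vector at \<open>w\<close>.\<close>

lemma ex_flat_moments:
  assumes psd: "qpsd (words d) (moment_matrix y)"
    and d: "1 \<le> d" and J: "J \<subseteq> words (d - 1)" "card J = r"
      "columns_independent (words d) (moment_matrix y) J"
    and span: "\<And>w. wlen w \<le> d \<Longrightarrow>
      \<exists>c. \<forall>u\<in>words d. moment_matrix y u w = (\<Sum>v\<in>J. moment_matrix y u v * c v)"
  shows "\<exists>(rscale :: ('n qword \<Rightarrow> quat) \<Rightarrow> quat \<Rightarrow> _) ip S bv X.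
    flat_moments rscale ip S r (y :: 'n::finite qword \<Rightarrow> quat) d J bv X"
proof -
  let ?W = "words d :: 'n qword set"
  define M where "M = moment_matrix y"
  define rscale where "rscale = (\<lambda>(x :: 'n qword \<Rightarrow> quat) c w. x w * c)"
  define ip where "ip = (\<lambda>x z. \<Sum>u\<in>?W. \<Sum>v\<in>?W. qcnj (x u) * M u v * z v)"
  have semi: "right_quat_semi_inner_space rscale ip"
    unfolding rscale_def ip_def by (rule qpsd_semi_inner) (simp add: M_def psd)
  interpret right_quat_semi_inner_space rscale ip
    by (rule semi)
  have JW: "J \<subseteq> ?W"
    using J(1) by force
  have fJ: "finite J"
    using JW finite_words by (rule finite_subset)
  define S where "S = {x :: 'n qword \<Rightarrow> quat. \<forall>w. w \<notin> J \<longrightarrow> x w = 0}"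
  define unit where "unit u = (\<lambda>w. if w = u then 1 else 0 :: quat)" for u :: "'n qword"
  have ip_unit: "ip (unit u) x = (\<Sum>v\<in>?W. M u v * x v)" if u: "u \<in> ?W" for u x
  proof -
    have "ip (unit u) x = (\<Sum>s\<in>?W. if s = u then \<Sum>v\<in>?W. M u v * x v else 0)"
      unfolding ip_def by (intro sum.cong refl) (simp add: unit_def)
    then show ?thesis
      using u by (simp add: finite_words)
  qed
  have unit_S: "unit v \<in> S" if "v \<in> J" for v
    using that by (auto simp: S_def unit_def)
  have ip_unit_S: "ip (unit u) x = (\<Sum>v\<in>J. M u v * x v)" if "u \<in> ?W" "x \<in> S" for u x
    unfolding ip_unit[OF that(1)] using that(2) JW
    by (intro sum.mono_neutral_right finite_words) (auto simp: S_def)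
  have ip_unit_unit: "ip (unit u) (unit v) = M u v" if "u \<in> ?W" "v \<in> ?W" for u v
    unfolding ip_unit[OF that(1)] using that(2) by (simp add: unit_def if_distrib finite_words cong: if_cong)
  have S_zero: "x = 0" if x: "x \<in> S" and "\<And>u. u \<in> ?W \<Longrightarrow> ip (unit u) x = 0" for x
  proof -
    have "\<forall>u\<in>?W. (\<Sum>v\<in>J. M u v * x v) = 0"
      using that by (simp add: ip_unit_S)
    then have "\<forall>v\<in>J. x v = 0"
      using J(3) unfolding columns_independent_def M_def by blast
    then show ?thesis
      using x by (auto simp: S_def fun_eq_iff)
  qed
  have S_def0: "x = 0" if "x \<in> S" "ip x x = 0" for x
    using S_zero[OF that(1)] ip_null[OF that(2)] by blast
  have subS: "rsub S"
    unfolding rsub_def by (auto simp: S_def rscale_def)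
  define bv where "bv w = (SOME x. x \<in> S \<and> (\<forall>u\<in>?W. ip (unit u) x = M u w))" for w
  have ex_bv: "\<exists>x. x \<in> S \<and> (\<forall>u\<in>?W. ip (unit u) x = M u w)" if w: "wlen w \<le> d" for w
  proof -
    obtain c where c: "\<And>u. u \<in> ?W \<Longrightarrow> M u w = (\<Sum>v\<in>J. M u v * c v)"
      using span[OF w] unfolding M_def by blast
    define x where "x = (\<lambda>v. if v \<in> J then c v else 0)"
    have "x \<in> S"
      by (simp add: x_def S_def)
    moreover have "ip (unit u) x = M u w" if "u \<in> ?W" for u
      unfolding ip_unit_S[OF that \<open>x \<in> S\<close>] c[OF that] by (simp add: x_def)
    ultimately show ?thesis
      by blast
  qed
  have bv: "bv w \<in> S" "\<And>u. u \<in> ?W \<Longrightarrow> ip (unit u) (bv w) = M u w" if "wlen w \<le> d" for w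
    using someI_ex[OF ex_bv[OF that]] unfolding bv_def by blast+
  have bv_unit: "bv v = unit v" if v: "v \<in> J" for v
  proof -
    have vd: "wlen v \<le> d"
      using v JW by auto
    have "bv v - unit v = 0"
    proof (rule S_zero)
      show "bv v - unit v \<in> S"
        using bv(1)[OF vd] unit_S[OF v] by (simp add: rsubD[OF subS])
      show "ip (unit u) (bv v - unit v) = 0" if "u \<in> ?W" for u
        using that vd by (simp add: ip_diff_right bv(2) ip_unit_unit)
    qed
    then show ?thesis
      by simp
  qed
  have expand: "x = (\<Sum>v\<in>J. rscale (bv v) (x v))" if "x \<in> S" for x
  proof
    fix w
    have "(\<Sum>v\<in>J. rscale (bv v) (x v)) w = (\<Sum>v\<in>J. bv v w * x v)"
      using fJ by (induction J rule: finite_induct) (auto simp: rscale_def)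
    also have "\<dots> = (\<Sum>v\<in>J. if v = w then x w else 0)"
      by (intro sum.cong refl) (auto simp: bv_unit unit_def)
    also have "\<dots> = x w"
      using that fJ by (auto simp: S_def)
    finally show "x w = (\<Sum>v\<in>J. rscale (bv v) (x v)) w"
      by simp
  qed
  have gram: "ip (bv u) (bv v) = M u v" if uv: "wlen u \<le> d" "wlen v \<le> d" for u v
  proof -
    \<comment> \<open>The representative and its unit vector have the same products with all unit
      vectors, so one may replace the other in the Gram form.\<close>
    have z: "ip (unit s) (bv u - unit u) = 0" if "s \<in> ?W" for s
      using that uv by (simp add: ip_diff_right bv(2) ip_unit_unit)
    have "ip (bv u - unit u) (bv v) = (\<Sum>t\<in>J. ip (bv u - unit u) (unit t) * bv v t)"
      by (subst expand[OF bv(1)[OF uv(2)]]) (simp add: ip_sum_right ip_rscale_right bv_unit)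
    also have "\<dots> = 0"
    proof (rule sum.neutral, rule ballI)
      fix t
      assume "t \<in> J"
      then have "ip (unit t) (bv u - unit u) = 0"
        using z JW by blast
      then show "ip (bv u - unit u) (unit t) * bv v t = 0"
        using ip_commute[of "bv u - unit u" "unit t"] by simp
    qed
    finally have "ip (bv u) (bv v) = ip (unit u) (bv v)"
      by (simp add: ip_diff_left)
    then show ?thesis
      using uv by (simp add: bv(2))
  qed
  \<comment> \<open>The rule is imposed on the words of \<open>J\<close>. For other words of length
    at most d - 1 it follows from the shift property of the moment matrix, which moves the letter
    from the column to the row index.\<close>
  define X where "X a x = (\<Sum>v\<in>J. rscale (bv (QWord [a] + v)) (x v))" for a and x :: "'n qword \<Rightarrow> quat"
  have aJ: "wlen (QWord [a] + v) \<le> d" if "v \<in> J" for a :: "'n letter" and v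
    using that J(1) d by force
  have X_S: "X a x \<in> S" for a x
    unfolding X_def by (intro rsub_sum[OF subS] rsubD(3)[OF subS] bv(1) aJ)
  have X_lin: "rlin S (X a)" for a
    unfolding rlin_def
  proof (intro conjI ballI allI)
    fix x z :: "'n qword \<Rightarrow> quat" and c
    show "X a x \<in> S"
      by (rule X_S)
    show "X a (x + z) = X a x + X a z"
      by (simp add: X_def rscale_add_right sum.distrib)
    have "rscale x c v = x v * c" for v
      by (simp add: rscale_def)
    then show "X a (rscale x c) = rscale (X a x) c"
      by (simp add: X_def rscale_sum_left rscale_mult)
  qed
  have ws: "wstar (QWord [lstar a]) = QWord [a]" for a :: "'n letter"
    by (rule qword_eqI) simp
  have X_bv: "X a (bv w) = bv (QWord [a] + w)" if w: "wlen w \<le> d - 1" for a w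
  proof -
    have wd: "wlen w \<le> d" "wlen (QWord [a] + w) \<le> d"
      using w d by auto
    define x where "x = X a (bv w) - bv (QWord [a] + w)"
    have xS: "x \<in> S"
      unfolding x_def by (intro rsubD(5)[OF subS] X_S bv(1) wd)
    have "ip (bv u) x = 0" if u: "u \<in> J" for u
    proof -
      have ud: "wlen u \<le> d" "wlen (QWord [lstar a] + u) \<le> d"
        using u JW aJ[OF u, of "lstar a"] by auto
      have shift: "M u (QWord [a] + v) = M (QWord [lstar a] + u) v" for v
        by (simp add: M_def moment_matrix_eq ws add.assoc)
      have "ip (bv u) (X a (bv w)) = (\<Sum>v\<in>J. M (QWord [lstar a] + u) v * bv w v)"
        unfolding X_def using ud aJ by (simp add: ip_sum_right ip_rscale_right gram shift)
      also have "\<dots> = ip (unit (QWord [lstar a] + u)) (bv w)"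
        using ud by (intro ip_unit_S[symmetric] bv(1) wd) simp
      also have "\<dots> = M (QWord [lstar a] + u) w"
        using ud by (intro bv(2) wd) simp
      also have "\<dots> = ip (bv u) (bv (QWord [a] + w))"
        using ud wd by (simp only: gram shift)
      finally show ?thesis
        by (simp add: x_def ip_diff_right)
    qed
    then have "ip x x = 0"
      by (subst (1) expand[OF xS]) (simp add: ip_sum_left ip_rscale_left)
    then show ?thesis
      using S_def0[OF xS] by (simp add: x_def)
  qed
  have "flat_moments rscale ip S r y d J bv X"
  proof (rule flat_moments_of_basis[OF semi subS S_def0 d J(1,2)])
    show "ip (bv u) (bv v) = y (wstar u + v)" if "wlen u \<le> d" "wlen v \<le> d" for u v
      using gram[OF that] by (simp add: M_def moment_matrix_eq)
    show "\<exists>c. x = (\<Sum>v\<in>J. rscale (bv v) (c v))" if "x \<in> S" for x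
      by (rule exI[of _ x], rule expand[OF that])
  qed (auto intro: bv(1) X_lin X_bv)
  then show ?thesis
    by blast
qed

section \<open>Extraction of the atoms\<close>

lemma ncdeg_le: "(\<And>w. w \<in> Poly_Mapping.keys p \<Longrightarrow> wlen w \<le> k) \<Longrightarrow> ncdeg p \<le> k"
  unfolding ncdeg_def by (subst Max_le_iff) auto

context right_quat_semi_inner_space
begin

lemma flat_rep_add: "flat_rep rscale X (p + q) x = flat_rep rscale X p x + flat_rep rscale X q x"
  unfolding flat_rep_def by (rule setsum_keys_plus_distrib) (auto simp: rscale_add_right)

lemma flat_rep_diff: "flat_rep rscale X (p - q) x = flat_rep rscale X p x - flat_rep rscale X q x"
  using flat_rep_add[of X "p - q" q x] by simp

lemma flat_rep_mono_of: "flat_rep rscale X (mono_of w) x = foldr X (letters w) x"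
  by (simp add: flat_rep_def mono_of_def rscale_one)

end

context flat_moments
begin

text \<open>By \<open>S_eqI\<close> the two operators need to be compared only between words
  \<open>u\<close>, \<open>v\<close> of \<open>J\<close>. There both sides are moments of length at
  most 2d, and their equality is a commutator constraint.\<close>

lemma central_of_moments:
  assumes J2: "2 \<le> d" "J \<subseteq> words (d - 2)"
    and comm: "\<And>i u v w. wlen u + wlen v + wlen w + 1 \<le> 2 * d \<Longrightarrow>
      L y (mono_of u * commutator (mono_of w + mono_of (wstar w)) (mono_of (QWord [Q i])) * mono_of v) = 0"
    and w: "length w \<le> 3" and x: "x \<in> S"
  shows "foldr X w (X (Q i) x) + foldr X (rev (map lstar w)) (X (Q i) x) =
    X (Q i) (foldr X w x) + X (Q i) (foldr X (rev (map lstar w)) x)"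
proof -
  define A where "A x = foldr X w x + foldr X (rev (map lstar w)) x" for x
  have A: "rlin S A"
    unfolding A_def by (intro rlin_add rlin_foldr X_lin sub)
  note lin = rlinD[OF A] rlinD[OF X_lin]
  have "A (X (Q i) x) = X (Q i) (A x)"
  proof (rule rlin_eq_on_S[of "\<lambda>x. A (X (Q i) x)" "\<lambda>x. X (Q i) (A x)", OF _ _ _ x])
    show "rlin S (\<lambda>x. A (X (Q i) x))" "rlin S (\<lambda>x. X (Q i) (A x))"
      unfolding rlin_def by (auto simp: lin)
    fix v
    assume v: "v \<in> J"
    show "A (X (Q i) (bv v)) = X (Q i) (A (bv v))"
    proof (rule S_eqI)
      fix u
      assume u: "u \<in> J"
      have len: "wlen u + 2 \<le> d" "wlen v + 2 \<le> d"
        using u v J2 by (force dest: subsetD)+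
      have ip_eq: "ip (bv u) (foldr X xs (bv v)) = y (wstar u + QWord xs + v)" if "length xs \<le> 4" for xs
        using len that by (intro ip_foldr_X_bv) auto
      have ws: "wstar (QWord w) = QWord (rev (map lstar w))"
        by (rule qword_eqI) simp
      have "ip (bv u) (A (X (Q i) (bv v))) =
          ip (bv u) (foldr X (w @ [Q i]) (bv v)) + ip (bv u) (foldr X (rev (map lstar w) @ [Q i]) (bv v))"
        by (simp add: A_def ip_add_right)
      also have "\<dots> = y (wstar u + QWord w + QWord [Q i] + v) + y (wstar u + wstar (QWord w) + QWord [Q i] + v)"
        using w by (simp only: ip_eq length_append length_rev length_map list.size)
          (simp add: ip_eq ws QWord_append add.assoc)
      also have "\<dots> = y (wstar u + QWord [Q i] + QWord w + v) + y (wstar u + QWord [Q i] + wstar (QWord w) + v)"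
        using comm[of "wstar u" v "QWord w" i] len w by (simp add: L_commutator_sandwich)
      also have "\<dots> = ip (bv u) (foldr X ([Q i] @ w) (bv v)) + ip (bv u) (foldr X ([Q i] @ rev (map lstar w)) (bv v))"
        using w by (subst (1 2) ip_eq) (simp_all add: ws QWord_append add.assoc del: append_Cons)
      also have "\<dots> = ip (bv u) (X (Q i) (A (bv v)))"
        using v bv_in J_le by (simp add: A_def ip_add_right rlinD[OF X_lin] foldr_X_in)
      finally show "ip (bv u) (A (X (Q i) (bv v))) = ip (bv u) (X (Q i) (A (bv v)))" .
    qed (use v bv_in J_le lin(1,7) in auto)
  qed
  then show ?thesis
    using x by (simp add: A_def rlinD[OF X_lin] foldr_X_in)
qed

text \<open>The commutator vanishes at every quaternionic point and its degree is at most 4, so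
  scalar consistency applies to it directly.\<close>

lemma central_of_scalar_consistent:
  assumes S: "S = flat_space rscale d bv" and sc: "scalar_consistent rscale d bv X"
    and w: "length w \<le> 3" and x: "x \<in> S"
  shows "foldr X w (X (Q i) x) + foldr X (rev (map lstar w)) (X (Q i) x) =
    X (Q i) (foldr X w x) + X (Q i) (foldr X (rev (map lstar w)) x)"
proof -
  define p where "p = commutator (mono_of (QWord w) + mono_of (wstar (QWord w))) (mono_of (QWord [Q i]))"
  have p: "p = mono_of (QWord w + QWord [Q i]) + mono_of (wstar (QWord w) + QWord [Q i]) -
      (mono_of (QWord [Q i] + QWord w) + mono_of (QWord [Q i] + wstar (QWord w)))"
    by (simp add: p_def commutator_def distrib_left distrib_right mono_of_mult)
  have "Poly_Mapping.keys p \<subseteq> {QWord w + QWord [Q i], wstar (QWord w) + QWord [Q i],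
      QWord [Q i] + QWord w, QWord [Q i] + wstar (QWord w)}"
    unfolding p mono_of_def
    by (auto dest!: subsetD[OF keys_diff] subsetD[OF Poly_Mapping.keys_add])
  then have "ncdeg p \<le> 4"
    using w by (intro ncdeg_le) (auto dest!: subsetD)
  moreover have "p \<in> vanishing_ideal"
    by (simp add: vanishing_ideal_def p_def eval_nc_commutator)
  ultimately have "flat_rep rscale X p x = 0"
    using sc x unfolding scalar_consistent_def S by blast
  then show ?thesis
    by (simp add: p flat_rep_add flat_rep_diff flat_rep_mono_of)
qed

end

text \<open>Independence on the rows in \<open>I'\<close> persists when rows are added. Equality of
  the ranks then makes the family largest for \<open>I\<close>, so it spans all columns
  there.\<close>

lemma rank_basis:
  assumes I: "finite I" "I' \<subseteq> I" and rank: "qrank I M = r" "qrank I' M = r"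
  obtains J where "J \<subseteq> I'" "columns_independent I M J" "card J = r"
    "\<And>w. w \<in> I \<Longrightarrow> \<exists>c. \<forall>u\<in>I. M u w = (\<Sum>v\<in>J. M u v * c v)"
proof -
  have "finite I'"
    using I(2,1) by (rule finite_subset)
  then obtain J where J: "J \<subseteq> I'" "columns_independent I' M J" "card J = qrank I' M"
    by (rule qrank_attained)
  have ind: "columns_independent I M J"
    using J(2) I(2) unfolding columns_independent_def by blast
  show ?thesis
  proof (rule that[OF J(1) ind])
    show "card J = r"
      using J(3) rank by simp
    then show "\<exists>c. \<forall>u\<in>I. M u w = (\<Sum>v\<in>J. M u v * c v)" if "w \<in> I" for w
      using J(1) I rank(1) by (intro column_in_span[OF I(1) _ ind _ that]) auto
  qed
qed

lemma ex_atoms: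
  fixes y :: "'n::finite qword \<Rightarrow> quat" and rscale :: "'h::ab_group_add \<Rightarrow> quat \<Rightarrow> 'h"
  assumes feas: "moment_feasible gs hs d y"
    and delta: "\<delta> = flatness_gap gs hs" "\<delta> \<le> d"
    and rank: "qrank (words d) (moment_matrix y) = r" "qrank (words (d - \<delta>)) (moment_matrix y) = r"
    and consistency: "2 \<le> d \<Longrightarrow> \<delta> = 1 \<Longrightarrow>
      canonical_flat_rep rscale ip d r y bv X \<and> scalar_consistent rscale d bv X"
  shows "\<exists>P lam. finite P \<and> card P \<le> r \<and> (\<forall>p\<in>P. 0 < lam p) \<and> P \<subseteq> feasible_set gs hs \<and>
    (\<forall>w. wlen w \<le> 2 * d \<longrightarrow> y w = (\<Sum>p\<in>P. lam p *\<^sub>R eval_word p w))"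
proof -
  have \<delta>1: "1 \<le> \<delta>"
    using half_deg_le_flatness_gap(3) delta(1) by simp
  then have d1: "1 \<le> d"
    using delta(2) by simp
  have sub_words: "words (d - \<delta>) \<subseteq> (words d :: 'n qword set)"
    by auto
  obtain J :: "'n qword set" where J: "J \<subseteq> words (d - \<delta>)"
    "columns_independent (words d) (moment_matrix y) J" "card J = r"
    and span: "\<And>w. w \<in> words d \<Longrightarrow>
      \<exists>c. \<forall>u\<in>words d. moment_matrix y u w = (\<Sum>v\<in>J. moment_matrix y u v * c v)"
    by (rule rank_basis[OF finite_words sub_words rank that])
  have J1: "J \<subseteq> words (d - 1)"
    using J(1) \<delta>1 by force
  have span': "\<exists>c. \<forall>u\<in>words d. moment_matrix y u w = (\<Sum>v\<in>J. moment_matrix y u v * c v)"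
    if "wlen w \<le> d" for w
    using span[of w] that by simp
  have Jdeg: "k \<le> d \<and> J \<subseteq> words (d - k)" if "k \<le> \<delta>" for k
    using J(1) that delta(2) by force
  have psd: "qpsd (words d) (moment_matrix y)"
    and comm: "\<And>i u v w. wlen u + wlen v + wlen w + 1 \<le> 2 * d \<Longrightarrow>
      L y (mono_of u * commutator (mono_of w + mono_of (wstar w)) (mono_of (QWord [Q i])) * mono_of v) = 0"
    and y0: "y 0 = 1"
    using feas unfolding moment_feasible_def by blast+
  have gs: "half_deg g \<le> d \<and> J \<subseteq> words (d - half_deg g) \<and>
      qpsd (words (d - half_deg g)) (localizing_matrix g y)" if "g \<in> set gs" for g
    using Jdeg[of "half_deg g"] half_deg_le_flatness_gap(1)[OF that, of hs] delta(1) feas that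
    unfolding moment_feasible_def by blast
  have hs: "half_deg h \<le> d \<and> J \<subseteq> words (d - half_deg h) \<and>
      (\<forall>u\<in>J. \<forall>v\<in>J. L y (mono_of (wstar u) * h * mono_of v) = 0)" if h: "h \<in> set hs" for h
  proof -
    have k: "half_deg h \<le> \<delta>"
      using half_deg_le_flatness_gap(2)[OF h, of gs] delta(1) by simp
    have "L y (mono_of (wstar u) * h * mono_of v) = 0" if "u \<in> J" "v \<in> J" for u v
    proof -
      have "u \<in> words (d - half_deg h)" "v \<in> words (d - half_deg h)" "half_deg h \<le> d"
        using Jdeg[OF k] that by blast+
      then have "wlen (wstar u) + wlen v + ncdeg h \<le> 2 * d"
        using ncdeg_le_half_deg[of h] by simp
      then show ?thesis
        using feas h unfolding moment_feasible_def by blast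
    qed
    then show ?thesis
      using Jdeg[OF k] by blast
  qed
  consider "d = 1" | (two) "2 \<le> d" "\<delta> = 1" | (large) "2 \<le> d" "2 \<le> \<delta>"
    using d1 \<delta>1 by linarith
  then show ?thesis
  proof cases
    \<comment> \<open>Here \<open>J\<close> contains at most the empty word, so \<open>S\<close> is
      the line through \<open>bv' 0\<close>, and this vector is an eigenvector of every
      letter.\<close>
    case 1
    obtain rscale' :: "('n qword \<Rightarrow> quat) \<Rightarrow> quat \<Rightarrow> ('n qword \<Rightarrow> quat)" and ip' S bv' X'
      where "flat_moments rscale' ip' S r y d J bv' X'"
      using ex_flat_moments[OF psd d1 J1 J(3,2) span'] by blast
    then interpret flat_moments rscale' ip' S r y d J bv' X' .
    have J0: "v = 0" if "v \<in> J" for v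
      using J1 1 that by (intro qword_eqI) (auto simp: wlen_def)
    have unit: "ip' (bv' 0) (bv' 0) = 1"
      using gram[of 0 0] y0 by simp
    have inS: "bv' 0 \<in> S"
      using bv_in[of 0] by simp
    show ?thesis
    proof (rule atomic_representation[of "{bv' 0}", OF _ _ _ _ _ _ _ gs hs])
      show "card {bv' 0} \<le> r"
        by (rule bound) (use unit inS in \<open>auto simp: orthonormal_def\<close>)
      show "\<exists>c. X' a x = rscale' x c" if "x \<in> {bv' 0}" for a x
      proof -
        obtain c where "X' a (bv' 0) = (\<Sum>v\<in>J. rscale' (bv' v) (c v))"
          using S_span[OF rlinD(1)[OF X_lin inS]] by blast
        also have "\<dots> = (\<Sum>v\<in>J. rscale' (bv' 0) (c v))"
          using J0 by (intro sum.cong) auto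
        also have "\<dots> = rscale' (bv' 0) (\<Sum>v\<in>J. c v)"
          by (rule rscale_sum_right[symmetric])
        finally show ?thesis
          using that by auto
      qed
      show "0 \<notin> {bv' 0}"
        using unit by auto
    qed (use inS in auto)
  next
    case two
    then have can: "canonical_flat_rep rscale ip d r y bv X" "scalar_consistent rscale d bv X"
      using consistency by auto
    interpret flat_moments rscale ip "flat_space rscale d bv" r y d J bv X
      by (rule flat_moments_canonical[OF can(1) d1 J1 J(3,2) span'])
    obtain F where F: "finite F" "F \<subseteq> flat_space rscale d bv" "card F \<le> r" "0 \<notin> F" "bv 0 = \<Sum>F"
      "\<And>x z. x \<in> F \<Longrightarrow> z \<in> F \<Longrightarrow> x \<noteq> z \<Longrightarrow> ip x z = 0"
      "\<And>a x. x \<in> F \<Longrightarrow> \<exists>c. X a x = rscale x c"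
      by (rule ex_orthogonal_eigenvectors[OF central_of_scalar_consistent[OF refl can(2)] that])
    show ?thesis
      by (rule atomic_representation[OF F gs hs])
  next
    case large
    obtain rscale' :: "('n qword \<Rightarrow> quat) \<Rightarrow> quat \<Rightarrow> ('n qword \<Rightarrow> quat)" and ip' S bv' X'
      where "flat_moments rscale' ip' S r y d J bv' X'"
      using ex_flat_moments[OF psd d1 J1 J(3,2) span'] by blast
    then interpret flat_moments rscale' ip' S r y d J bv' X' .
    have J2: "J \<subseteq> words (d - 2)"
      using Jdeg[of 2] large by simp
    obtain F where F: "finite F" "F \<subseteq> S" "card F \<le> r" "0 \<notin> F" "bv' 0 = \<Sum>F"
      "\<And>x z. x \<in> F \<Longrightarrow> z \<in> F \<Longrightarrow> x \<noteq> z \<Longrightarrow> ip' x z = 0"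
      "\<And>a x. x \<in> F \<Longrightarrow> \<exists>c. X' a x = rscale' x c"
      by (rule ex_orthogonal_eigenvectors[OF central_of_moments[OF large(1) J2 comm] that])
    show ?thesis
      by (rule atomic_representation[OF F gs hs])
  qed
qed

text \<open>Outside a null set \<open>f\<close> agrees with the simple function \<open>g\<close>
  carried by the atoms. Separation makes finite sets closed, hence measurable.\<close>

lemma has_bochner_integral_atomic_measure:
  fixes f :: "'a::t1_space \<Rightarrow> 'b::{banach, second_countable_topology}"
  assumes inj: "inj_on pt {1..N}" and lam: "\<And>\<nu>. \<nu> \<in> {1..N} \<Longrightarrow> 0 \<le> lam \<nu>"
    and f: "f \<in> borel_measurable borel"
  shows "has_bochner_integral (atomic_measure N lam pt) f (\<Sum>\<nu>=1..N. lam \<nu> *\<^sub>R f (pt \<nu>))"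
proof -
  let ?\<mu> = "atomic_measure N lam pt"
  have point: "emeasure ?\<mu> {pt \<nu>} = ennreal (lam \<nu>)" if \<nu>: "\<nu> \<in> {1..N}" for \<nu>
  proof -
    have "emeasure ?\<mu> {pt \<nu>} = (\<Sum>k=1..N. ennreal (lam k) * indicator {pt \<nu>} (pt k))"
      by (rule emeasure_atomic_measure) simp
    also have "\<dots> = (\<Sum>k=1..N. if k = \<nu> then ennreal (lam k) else 0)"
      using inj \<nu> by (intro sum.cong refl) (auto simp: inj_on_eq_iff)
    finally show ?thesis
      using \<nu> by simp
  qed
  define g where "g x = (\<Sum>\<nu>=1..N. indicator {pt \<nu>} x *\<^sub>R f (pt \<nu>))" for x
  have "has_bochner_integral ?\<mu> g (\<Sum>\<nu>=1..N. measure ?\<mu> {pt \<nu>} *\<^sub>R f (pt \<nu>))"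
    unfolding g_def
    by (intro has_bochner_integral_sum has_bochner_integral_indicator) (auto simp: point)
  also have "(\<Sum>\<nu>=1..N. measure ?\<mu> {pt \<nu>} *\<^sub>R f (pt \<nu>)) = (\<Sum>\<nu>=1..N. lam \<nu> *\<^sub>R f (pt \<nu>))"
    using lam by (intro sum.cong refl) (simp add: measure_def point)
  finally have g: "has_bochner_integral ?\<mu> g (\<Sum>\<nu>=1..N. lam \<nu> *\<^sub>R f (pt \<nu>))" .
  have "g (pt k) = f (pt k)" if k: "k \<in> {1..N}" for k
  proof -
    have "g (pt k) = (\<Sum>\<nu>=1..N. if \<nu> = k then f (pt k) else 0)"
      unfolding g_def using inj k by (intro sum.cong refl) (auto simp: inj_on_eq_iff)
    then show ?thesis
      using k by simp
  qed
  moreover have "UNIV - pt ` {1..N} \<in> null_sets ?\<mu>"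
  proof -
    have meas: "UNIV - pt ` {1..N} \<in> sets borel"
      by (intro borel_open open_Diff open_UNIV finite_imp_closed) auto
    then have "emeasure ?\<mu> (UNIV - pt ` {1..N}) = 0"
      unfolding emeasure_atomic_measure[OF meas] by (intro sum.neutral) auto
    then show ?thesis
      using meas by (simp add: null_sets_def)
  qed
  ultimately have ae: "AE x in ?\<mu>. g x = f x"
    by (intro AE_I'[of "UNIV - pt ` {1..N}"]) auto
  have "f \<in> borel_measurable ?\<mu>"
    by (subst measurable_cong_sets[OF sets_atomic_measure refl]) (rule f)
  then show ?thesis
    by (rule has_bochner_integralI_AE[OF g _ ae])
qed

lemma continuous_eval_letter: "continuous_on UNIV (\<lambda>a. eval_letter a l)"
  by (cases l) (auto intro!: continuous_intros bounded_linear.continuous_on[OF bounded_linear_qcnj])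

lemma continuous_eval_word: "continuous_on UNIV (\<lambda>a :: quat ^ 'n::finite. eval_word a w)"
proof -
  have "continuous_on UNIV (\<lambda>a :: quat ^ 'n. prod_list (map (eval_letter a) xs))" for xs
    by (induction xs) (auto intro!: continuous_intros continuous_eval_letter)
  then show ?thesis
    by (simp add: eval_word_def)
qed

text \<open>The degree bound keeps every moment entering \<open>LR\<close> within length 2d, the
  range in which \<open>y\<close> is a mixture of evaluations.\<close>

lemma LR_mixture:
  assumes "qpdeg f \<le> 2 * d" "\<And>w. wlen w \<le> 2 * d \<Longrightarrow> y w = (\<Sum>p\<in>P. lam p *\<^sub>R eval_word p w)"
  shows "LR y f = (\<Sum>p\<in>P. lam p * qre (eval_qp p f))"
proof -
  have "LR y f = (\<Sum>(a, b)\<in>Poly_Mapping.keys f.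
      \<Sum>p\<in>P. lam p * qre (Poly_Mapping.lookup f (a, b) * eval_word p (b + a)))"
    unfolding LR_def qre_sum
  proof (rule sum.cong[OF refl], clarify)
    fix a b
    assume "(a, b) \<in> Poly_Mapping.keys f"
    then have "wlen a + wlen b \<le> qpdeg f"
      unfolding qpdeg_def by (intro Max_ge) (auto simp: image_iff intro!: bexI[of _ "(a, b)"])
    then have "y (b + a) = (\<Sum>p\<in>P. lam p *\<^sub>R eval_word p (b + a))"
      using assms by simp
    then show "qre (Poly_Mapping.lookup f (a, b) * y (b + a)) =
        (\<Sum>p\<in>P. lam p * qre (Poly_Mapping.lookup f (a, b) * eval_word p (b + a)))"
      by (simp only: sum_distrib_left qre_sum mult_scaleR_right scaleR_quat_sel)
  qed
  also have "\<dots> = (\<Sum>p\<in>P. lam p * LR (eval_word p) f)"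
    unfolding LR_def qre_sum sum_distrib_left by (subst sum.swap) (simp add: case_prod_unfold)
  finally show ?thesis
    by (simp add: LR_eval_word)
qed

theorem theorem6p6:
  fixes f :: "'n::finite qpoly"
    and gs hs :: "'n ncpoly list"
    and y :: "'n qword \<Rightarrow> quat"
    and d r \<delta> :: nat
    and rscale :: "'h::ab_group_add \<Rightarrow> quat \<Rightarrow> 'h"
    and ip :: "'h \<Rightarrow> 'h \<Rightarrow> quat"
    and bv :: "'n qword \<Rightarrow> 'h"
    and X :: "'n letter \<Rightarrow> 'h \<Rightarrow> 'h"
  assumes f_sym: "qp_equal (qpstar f) f"
    and g_sym: "\<forall>g\<in>set gs. ncstar g = g"
    and deg_f: "qpdeg f \<le> 2 * d"
    and opt: "relax_optimal f gs hs d y"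
    and delta: "\<delta> = flatness_gap gs hs"
    and d_ge: "\<delta> \<le> d"
    and rank_d: "qrank (words d) (moment_matrix y) = r"
    and rank_d_delta: "qrank (words (d - \<delta>)) (moment_matrix y) = r"
    and consistency: "2 \<le> d \<Longrightarrow> \<delta> = 1 \<Longrightarrow>
      canonical_flat_rep rscale ip d r y bv X \<and> scalar_consistent rscale d bv X"
  shows "relax_value f gs hs d = f_min f gs hs \<and>
    (\<exists>N pt lam.
      N \<le> r \<and>
      inj_on pt {1..N} \<and>
      (\<forall>\<nu>\<in>{1..N}. pt \<nu> \<in> feasible_set gs hs) \<and>
      (\<forall>\<nu>\<in>{1..N}. 0 < lam \<nu>) \<and>
      (\<Sum>\<nu>=1..N. lam \<nu>) = 1 \<and>
      represents d (atomic_measure N lam pt) y \<and>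
      (\<forall>\<nu>\<in>{1..N}. is_minimizer f gs hs (pt \<nu>)))"
proof -
  have feas: "moment_feasible gs hs d y" and opt_value: "relax_value f gs hs d = ereal (LR y f)"
    using opt by (simp_all add: relax_optimal_def)
  obtain P lam where P: "finite P" "card P \<le> r" "\<And>p. p \<in> P \<Longrightarrow> 0 < lam p" "P \<subseteq> feasible_set gs hs"
    and y: "\<And>w. wlen w \<le> 2 * d \<Longrightarrow> y w = (\<Sum>p\<in>P. lam p *\<^sub>R eval_word p w)"
    using ex_atoms[OF feas delta d_ge rank_d rank_d_delta consistency] by blast
  define \<phi> where "\<phi> p = qre (eval_qp p f)" for p
  have "y 0 = 1"
    using feas by (simp add: moment_feasible_def)
  then have "qre (\<Sum>p\<in>P. lam p *\<^sub>R (1 :: quat)) = 1"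
    using y[of 0] by simp
  then have lam1: "(\<Sum>p\<in>P. lam p) = 1"
    by (simp add: qre_sum)
  have f_min_le: "f_min f gs hs \<le> ereal (\<phi> p)" if "p \<in> P" for p
    unfolding f_min_def \<phi>_def using that P(4) by (intro INF_lower) auto
  have le_\<phi>: "LR y f \<le> \<phi> p" if "p \<in> P" for p
    using order_trans[OF relax_value_le_f_min[of f gs hs d] f_min_le[OF that]] by (simp add: opt_value)
  \<comment> \<open>The optimal value is a convex combination of the numbers
    \<open>\<phi> p\<close>, none of which lies below it. Positive weights force every term of this
    zero sum to vanish.\<close>
  have "(\<Sum>p\<in>P. lam p * (\<phi> p - LR y f)) = 0"
    using LR_mixture[OF deg_f y] lam1
    by (simp add: right_diff_distrib sum_subtractf \<phi>_def flip: sum_distrib_right)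
  then have "\<forall>p\<in>P. lam p * (\<phi> p - LR y f) = 0"
    using le_\<phi> P(3) by (subst (asm) sum_nonneg_eq_0_iff[OF P(1)]) (auto simp: less_imp_le)
  then have \<phi>: "\<phi> p = LR y f" if "p \<in> P" for p
    using P(3)[OF that] that by force
  \<comment> \<open>The weights sum to 1, so some atom exists; its objective value bounds the
    infimum from above.\<close>
  have "P \<noteq> {}"
    using lam1 by auto
  then have f_min: "f_min f gs hs = ereal (LR y f)"
    using f_min_le \<phi> relax_value_le_f_min[of f gs hs d] by (intro antisym) (auto simp: opt_value)
  obtain pt where pt: "bij_betw pt {1..card P} P"
    using ex_bij_betw_nat_finite_1[OF P(1)] by blast
  have ptP: "pt \<nu> \<in> P" if "\<nu> \<in> {1..card P}" for \<nu>
    using pt that by (rule bij_betw_apply)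
  have lam_pt: "(\<Sum>\<nu>=1..card P. lam (pt \<nu>)) = 1"
    using sum.reindex_bij_betw[OF pt, of lam] lam1 by simp
  have inj: "inj_on pt {1..card P}"
    using pt by (rule bij_betw_imp_inj_on)
  have "represents d (atomic_measure (card P) (\<lambda>\<nu>. lam (pt \<nu>)) pt) y"
    unfolding represents_def
  proof
    fix w :: "'n qword"
    assume "w \<in> words (2 * d)"
    then have yw: "y w = (\<Sum>\<nu>=1..card P. lam (pt \<nu>) *\<^sub>R eval_word (pt \<nu>) w)"
      using y[of w] sum.reindex_bij_betw[OF pt, of "\<lambda>p. lam p *\<^sub>R eval_word p w"] by simp
    show "has_bochner_integral (atomic_measure (card P) (\<lambda>\<nu>. lam (pt \<nu>)) pt) (\<lambda>a. eval_word a w) (y w)"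
      unfolding yw
      by (rule has_bochner_integral_atomic_measure[OF inj])
        (auto intro!: less_imp_le P(3) ptP borel_measurable_continuous_onI continuous_eval_word)
  qed
  moreover have "is_minimizer f gs hs (pt \<nu>)" if "\<nu> \<in> {1..card P}" for \<nu>
    using ptP[OF that] P(4) \<phi>[of "pt \<nu>"] by (auto simp: is_minimizer_def f_min \<phi>_def)
  ultimately show ?thesis
    using P ptP lam_pt inj
    by (intro conjI exI[of _ "card P"] exI[of _ pt] exI[of _ "\<lambda>\<nu>. lam (pt \<nu>)"])
      (auto simp: f_min opt_value)
qed

end
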